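(* Let $m\ge 1$, $n=2m$, let $K$ be an infinite field contained in a local field $L$, and let $\overline{L}$ be an algebraic closure of $L$. Let $r\ge 1$ and let $w\in \mathrm{GL}_n(\overline{L})\ast \mathbf{F}_r$ be a (reduced) word of length $l\ge 2$ none of whose critical constants is Tomanov-small with respect to $\mathbf{G}=\mathrm{Sp}_{2m}$, i.e. $\mathbf{\Lambda}(\overline{L})\cap I(w)=\varnothing$. Then $\dim\bigl(w(\mathrm{Sp}_{2m}(K)^r)\bigr)\ge n=2m$.
   Context: Words: $\mathbf{F}_r=\langle x_1,\dots,x_r\rangle$ is the free group of rank $r$. A word with constants in a group $C$ is $w=c_0x_{i(1)}^{\varepsilon(1)}c_1\cdots c_{l-1}x_{i(l)}^{\varepsilon(l)}c_l\in C\ast\mathbf{F}_r$ with $c_j\in C$, $\varepsilon(j)\in\{\pm1\}$, taken reduced: if $i(j)=i(j+1)$ and $\varepsilon(j)=-\varepsilon(j+1)$ then $c_j\ne 1$. Its length is $l$. An index $j\in\{1,\dots,l-1\}$ is critical if $i(j)=i(j+1)$ and $\varepsilon(j)=-\varepsilon(j+1)$; then $c_j$ is a critical constant, and $I(w)$ denotes the set of critical constants. For a subgroup $G\le C$, $w(G^r)\subseteq C$ is the image of the word map $(g_1,\dots,g_r)\mapsto w(g_1,\dots,g_r)$. Dimension: for a subset $T$ of the $n\times n$ matrices $\mathbf{M}_n(\overline{L})$, $\dim(T)$ is the Krull dimension of its Zariski closure in $\mathbf{M}_n(\overline{L})$. Tomanov-small constants: let $\mathbf{G}\le\mathrm{GL}(\mathbf{V})$,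 $\mathbf{V}=\mathbf{A}^n$ (here $\mathbf{G}=\mathrm{Sp}_{2m}$ with its natural action on $\mathbf{A}^{2m}$ preserving a nondegenerate alternating form), let $\mathbf{T}$ be a maximal torus of $\mathbf{G}$, and let $e_1,\dots,e_n$ be a basis of weight vectors of $\mathbf{V}(\overline{L})$ for $\mathbf{T}$ with $e_1$ a highest weight vector and $e_n$ a lowest weight vector; $e_1^\ast,\dots,e_n^\ast$ is the dual basis. Groups act from the right, and $c^g=g^{-1}cg$. Then $\mathbf{\Lambda}(\overline{L})=\{c\in\mathrm{GL}(\mathbf{V}(\overline{L})) : (e_1.c^g).e_n^\ast=0\text{ for all }g\in\mathbf{G}(\overline{L})\}$, where $v.e_n^\ast$ is the value of the functional $e_n^\ast$ at $v$. *)

theory Defs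
  imports
    "HOL-Analysis.Analysis"
    "HOL-Algebra.Algebraic_Closure_Type"
    "Jordan_Normal_Form.VS_Connect"
begin

(* Matrices act on row vectors from the right throughout. *)

section \<open>Local fields\<close>

(* A local field is a non-discrete, locally compact Hausdorff topological field; the archimedean
   ones are included. The class perfect_space gives non-discreteness. *)
class local_field = Fields.field + t2_space + perfect_space
    + topological_ab_group_add + topological_semigroup_mult +
  assumes tendsto_inverse_nhds: "a \<noteq> 0 \<Longrightarrow> (inverse \<longlongrightarrow> inverse a) (nhds a)"
    and locally_compact: "\<exists>U C. open U \<and> compact C \<and> x \<in> U \<and> U \<subseteq> C"


section \<open>Words with constants\<close>

(* The pair (c0, [(i1, e1, c1), ..., (il, el, cl)]) stands for
   c0 * x_i1^e1 * c1 * ... * x_il^el * cl. The elements of the free product of C with the free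
   group on x_1, ..., x_r correspond to the reduced words. *)
type_synonym 'a cword = "'a \<times> (nat \<times> int \<times> 'a) list"

definition word_length :: "'a cword \<Rightarrow> nat" where
  "word_length w = length (snd w)"

(* For 1 \<le> j \<le> word_length w, these are i(j), \<epsilon>(j) and c_j. *)
definition word_var :: "'a cword \<Rightarrow> nat \<Rightarrow> nat" where
  "word_var w j = fst (snd w ! (j - 1))"

definition word_sign :: "'a cword \<Rightarrow> nat \<Rightarrow> int" where
  "word_sign w j = fst (snd (snd w ! (j - 1)))"

definition word_const :: "'a cword \<Rightarrow> nat \<Rightarrow> 'a" where
  "word_const w j = snd (snd (snd w ! (j - 1)))"

definition is_word :: "('a, 'b) monoid_scheme \<Rightarrow> nat \<Rightarrow> 'a cword \<Rightarrow> bool" where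
  "is_word C r w \<longleftrightarrow> fst w \<in> carrier C \<and>
     (\<forall>j \<in> {1..word_length w}.
        word_var w j \<in> {1..r} \<and> word_sign w j \<in> {1, -1} \<and> word_const w j \<in> carrier C)"

definition critical_indices :: "'a cword \<Rightarrow> nat set" where
  "critical_indices w = {j \<in> {1..<word_length w}.
     word_var w j = word_var w (j + 1) \<and> word_sign w j = - word_sign w (j + 1)}"

definition critical_constants :: "'a cword \<Rightarrow> 'a set" where
  "critical_constants w = word_const w ` critical_indices w"

definition reduced_word :: "('a, 'b) monoid_scheme \<Rightarrow> nat \<Rightarrow> 'a cword \<Rightarrow> bool" where
  "reduced_word C r w \<longleftrightarrow> is_word C r w \<and>
     (\<forall>j \<in> critical_indices w. word_const w j \<noteq> \<one>\<^bsub>C\<^esub>)"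

definition word_eval :: "('a, 'b) monoid_scheme \<Rightarrow> 'a cword \<Rightarrow> (nat \<Rightarrow> 'a) \<Rightarrow> 'a" where
  "word_eval C w g =
     foldl (\<lambda>a (i, s, c). a \<otimes>\<^bsub>C\<^esub> (g i [^]\<^bsub>C\<^esub> s) \<otimes>\<^bsub>C\<^esub> c) (fst w) (snd w)"

definition word_image :: "('a, 'b) monoid_scheme \<Rightarrow> 'a cword \<Rightarrow> nat \<Rightarrow> 'a set \<Rightarrow> 'a set" where
  "word_image C w r G = {word_eval C w g | g. g \<in> {1..r} \<rightarrow> G}"


section \<open>Zariski topology and dimension\<close>

inductive_set poly_functions :: "nat \<Rightarrow> ('a::Fields.field mat \<Rightarrow> 'a) set" for n :: nat where
  const: "(\<lambda>_. c) \<in> poly_functions n"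
| coord: "i < n \<Longrightarrow> j < n \<Longrightarrow> (\<lambda>A. A $$ (i, j)) \<in> poly_functions n"
| add: "p \<in> poly_functions n \<Longrightarrow> q \<in> poly_functions n \<Longrightarrow> (\<lambda>A. p A + q A) \<in> poly_functions n"
| mult: "p \<in> poly_functions n \<Longrightarrow> q \<in> poly_functions n \<Longrightarrow> (\<lambda>A. p A * q A) \<in> poly_functions n"

(* The Zariski topology on the n x n matrices, generated by the principal open sets. *)
definition zariski :: "nat \<Rightarrow> 'a::Fields.field mat topology" where
  "zariski n = topology_generated_by
     {{A \<in> carrier_mat n n. p A \<noteq> 0} | p. p \<in> poly_functions n}"

definition irreducible_in :: "'a topology \<Rightarrow> 'a set \<Rightarrow> bool" where
  "irreducible_in S Z \<longleftrightarrow> Z \<subseteq> topspace S \<and> Z \<noteq> {} \<and>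
     (\<forall>A B. closedin S A \<and> closedin S B \<and> Z \<subseteq> A \<union> B \<longrightarrow> Z \<subseteq> A \<or> Z \<subseteq> B)"

(* Supremum of the lengths of chains Z 0 < ... < Z k of irreducible closed sets;
   with this convention the empty space gets dimension 0. *)
definition krull_dim :: "'a topology \<Rightarrow> enat" where
  "krull_dim S = Sup {enat k | k. \<exists>Z :: nat \<Rightarrow> 'a set.
     (\<forall>i\<le>k. closedin S (Z i) \<and> irreducible_in S (Z i)) \<and> (\<forall>i<k. Z i \<subset> Z (Suc i))}"

definition zariski_dim :: "nat \<Rightarrow> 'a::Fields.field mat set \<Rightarrow> enat" where
  "zariski_dim n T = krull_dim (subtopology (zariski n) (Abstract_Topology.closure_of (zariski n) T))"


section \<open>General linear and symplectic groups\<close>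

definition GL :: "nat \<Rightarrow> 'a::Fields.field mat monoid" where
  "GL n = units_of (ring_mat TYPE('a) n ())"

definition row_act :: "'a::Fields.field vec \<Rightarrow> 'a mat \<Rightarrow> 'a vec" where
  "row_act v A = transpose_mat A *\<^sub>v v"

definition symplectic_form :: "nat \<Rightarrow> 'a::Fields.field mat" where
  "symplectic_form m = four_block_mat (0\<^sub>m m m) (1\<^sub>m m) (- 1\<^sub>m m) (0\<^sub>m m m)"

(* The points over F of Sp_{2m}, for a subfield F of the ambient field. *)
definition Sp :: "nat \<Rightarrow> 'a::Fields.field set \<Rightarrow> 'a mat set" where
  "Sp m F = {A \<in> carrier_mat (2 * m) (2 * m). elements_mat A \<subseteq> F \<and>
     A * symplectic_form m * transpose_mat A = symplectic_form m}"


section \<open>Tori and weights\<close>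

(* Here the ambient field is meant to be algebraically closed, so that linear algebraic groups
   are identified with their groups of points. *)

definition diagonalizable_set :: "nat \<Rightarrow> 'a::Fields.field mat set \<Rightarrow> bool" where
  "diagonalizable_set n T \<longleftrightarrow>
     (\<exists>P \<in> carrier (GL n). \<forall>t \<in> T. diagonal_mat (P * t * inv\<^bsub>GL n\<^esub> P))"

definition torus :: "nat \<Rightarrow> 'a::Fields.field mat set \<Rightarrow> bool" where
  "torus n T \<longleftrightarrow> subgroup T (GL n) \<and>
     closedin (subtopology (zariski n) (carrier (GL n))) T \<and>
     connectedin (zariski n) T \<and> diagonalizable_set n T"

definition maximal_torus :: "nat \<Rightarrow> 'a::Fields.field mat set \<Rightarrow> 'a mat set \<Rightarrow> bool" where
  "maximal_torus n G T \<longleftrightarrow> torus n T \<and> T \<subseteq> G \<and>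
     (\<forall>T'. torus n T' \<and> T' \<subseteq> G \<and> T \<subseteq> T' \<longrightarrow> T' = T)"

(* The group of rational characters of T; the regular functions on GL_n are the polynomial
   functions divided by powers of the determinant. *)
definition char_group :: "nat \<Rightarrow> 'a::Fields.field mat set \<Rightarrow> ('a mat \<Rightarrow> 'a) monoid" where
  "char_group n T =
     \<lparr>carrier = {\<alpha> \<in> T \<rightarrow>\<^sub>E UNIV - {0}.
        (\<forall>s \<in> T. \<forall>t \<in> T. \<alpha> (s * t) = \<alpha> s * \<alpha> t) \<and>
        (\<exists>p \<in> poly_functions n. \<exists>k. \<forall>t \<in> T. \<alpha> t = p t / Determinant.det t ^ k)},
      monoid.mult = (\<lambda>\<alpha> \<beta>. \<lambda>t \<in> T. \<alpha> t * \<beta> t),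
      one = (\<lambda>t \<in> T. 1)\<rparr>"

(* P is the set of positive elements of a total order compatible with the group structure. *)
definition positive_cone :: "('a, 'b) monoid_scheme \<Rightarrow> 'a set \<Rightarrow> bool" where
  "positive_cone H P \<longleftrightarrow> P \<subseteq> carrier H \<and> \<one>\<^bsub>H\<^esub> \<notin> P \<and>
     (\<forall>a \<in> P. \<forall>b \<in> P. a \<otimes>\<^bsub>H\<^esub> b \<in> P) \<and>
     (\<forall>a \<in> carrier H - {\<one>\<^bsub>H\<^esub>}. a \<in> P \<longleftrightarrow> inv\<^bsub>H\<^esub> a \<notin> P)"

definition weight_vector ::
  "nat \<Rightarrow> 'a::Fields.field mat set \<Rightarrow> ('a mat \<Rightarrow> 'a) \<Rightarrow> 'a vec \<Rightarrow> bool" where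
  "weight_vector n T \<alpha> v \<longleftrightarrow> \<alpha> \<in> carrier (char_group n T) \<and> v \<in> carrier_vec n \<and> v \<noteq> 0\<^sub>v n \<and>
     (\<forall>t \<in> T. row_act v t = \<alpha> t \<cdot>\<^sub>v v)"

definition weights :: "nat \<Rightarrow> 'a::Fields.field mat set \<Rightarrow> ('a mat \<Rightarrow> 'a) set" where
  "weights n T = {\<alpha>. \<exists>v. weight_vector n T \<alpha> v}"

(* The highest (lowest) weight is the largest (smallest) one for the ordering of the characters
   given by P; the corresponding positive roots are the roots lying in P. *)
definition highest_weight_vector ::
  "nat \<Rightarrow> 'a::Fields.field mat set \<Rightarrow> ('a mat \<Rightarrow> 'a) set \<Rightarrow> 'a vec \<Rightarrow> bool" where
  "highest_weight_vector n T P v \<longleftrightarrow> (\<exists>\<alpha>. weight_vector n T \<alpha> v \<and>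
     (\<forall>\<beta> \<in> weights n T - {\<alpha>}. \<alpha> \<otimes>\<^bsub>char_group n T\<^esub> inv\<^bsub>char_group n T\<^esub> \<beta> \<in> P))"

definition lowest_weight_vector ::
  "nat \<Rightarrow> 'a::Fields.field mat set \<Rightarrow> ('a mat \<Rightarrow> 'a) set \<Rightarrow> 'a vec \<Rightarrow> bool" where
  "lowest_weight_vector n T P v \<longleftrightarrow> (\<exists>\<alpha>. weight_vector n T \<alpha> v \<and>
     (\<forall>\<beta> \<in> weights n T - {\<alpha>}. \<beta> \<otimes>\<^bsub>char_group n T\<^esub> inv\<^bsub>char_group n T\<^esub> \<alpha> \<in> P))"

definition weight_basis :: "nat \<Rightarrow> 'a::Fields.field mat set \<Rightarrow> (nat \<Rightarrow> 'a vec) \<Rightarrow> bool" where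
  "weight_basis n T e \<longleftrightarrow> inj_on e {1..n} \<and>
     vectorspace.basis class_ring (module_vec TYPE('a) n) (e ` {1..n}) \<and>
     (\<forall>i \<in> {1..n}. \<exists>\<alpha>. weight_vector n T \<alpha> (e i))"

(* The functional with coordinate vector f takes the value scalar_prod v f at v. *)
definition dual_basis ::
  "nat \<Rightarrow> (nat \<Rightarrow> 'a::Fields.field vec) \<Rightarrow> (nat \<Rightarrow> 'a vec) \<Rightarrow> bool" where
  "dual_basis n e f \<longleftrightarrow>
     (\<forall>j \<in> {1..n}. f j \<in> carrier_vec n \<and>
        (\<forall>i \<in> {1..n}. scalar_prod (e i) (f j) = (if i = j then 1 else 0)))"

(* The set \<Lambda> of Tomanov-small elements with respect to G, where v is the highest weight vector
   and f the functional dual to the lowest weight vector. *)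
definition tomanov_small ::
  "nat \<Rightarrow> 'a::Fields.field mat set \<Rightarrow> 'a vec \<Rightarrow> 'a vec \<Rightarrow> 'a mat set" where
  "tomanov_small n G v f = {c \<in> carrier (GL n).
     \<forall>g \<in> G. scalar_prod (row_act v (inv\<^bsub>GL n\<^esub> g * c * g)) f = 0}"

end

theory Submission
  imports Defs
begin

unbundle no vec_syntax
unbundle no inner_syntax
no_notation fps_nth (infixl \<open>$\<close> 75)

text \<open>
  Let \<open>B(x, y)\<close> be the alternating form. The weights of a maximal torus of \<open>Sp\<close> on the natural
  representation have multiplicity one and come in inverse pairs, so the functional dual to the lowest
  weight vector is a multiple of \<open>B(\<cdot>, e\<^sub>1)\<close>, and \<open>c\<close> is Tomanov-small iff \<open>B(v c, v) = 0\<close> for all \<open>v\<close>.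

  For \<open>\<beta> = B(a, b) \<noteq> 0\<close> and a scalar \<open>s\<close> let \<open>h(a, b, s)\<close> be the symplectic map scaling \<open>a\<close> by \<open>s\<close>, \<open>b\<close> by
  \<open>1/s\<close> and fixing their orthogonal complement. Its inverse is \<open>h(b, a, s)\<close>, and
  \<open>s \<beta> h(a, b, s)\<close> is polynomial with leading term \<open>x \<mapsto> s\<^sup>2 B(x, b) a\<close>. Substitute such elements,
  with vectors over \<open>K\<close> and one common \<open>s\<close>, for the variables of \<open>w\<close>. The top coefficient in \<open>s\<close> of the value
  is a product of factors \<open>B(v c\<^sub>j, v')\<close> times a rank one map whose image is spanned by \<open>a c\<^sub>l\<close>, where \<open>a\<close>
  belongs to the last letter. The factors do not vanish for generic vectors: if \<open>v \<noteq> v'\<close> this is clear, and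
  \<open>v = v'\<close> occurs only at critical indices.

  Let \<open>s\<close> and \<open>n - 1\<close> coordinates of \<open>a\<close> vary, and let \<open>Z\<^sub>k\<close> be the closure of the values obtained when only
  the first \<open>k\<close> of these \<open>n\<close> parameters vary. Then \<open>Z\<^sub>0 \<subseteq> \<dots> \<subseteq> Z\<^sub>n\<close> are irreducible, and they are distinct:
  \<open>k + 1\<close> suitable matrix coordinates have \<open>1, a\<^sub>1, \<dots>, a\<^sub>k\<close> as ratios of their leading coefficients, hence
  are algebraically independent on \<open>Z\<^bsub>k+1\<^esub>\<close>, whereas any \<open>k + 1\<close> rational functions of \<open>k\<close> parameters are
  algebraically dependent.
\<close>

section \<open>Separately polynomial functions\<close>

text \<open>The bound n arises as (n - 1) + 1. The rank one top coefficient remembers the line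
  spanned by \<open>a c_l\<close>, a point of projective (n - 1)-space, and the growth in s adds one
  parameter. Each letter contributes degree 2 in s to the numerator but only degree 1 to the
  denominator, so a suitable matrix coordinate grows like s^l, and the total degree of a monomial in
  such coordinates shows in its exponent of s.

  One obstacle is that \<open>a\<close> cannot be varied in the last letter alone: that letter or
  its inverse may recur, so the factors B(v c_j, v') vary with \<open>a\<close> as well. They form
  one common factor that does not involve s, and it drops out of the ratios.

  Another is that all points must be rational over K. Density of the K-points and differentials are
  avoided: vanishing is tested on infinite sets, one variable at a time, which also makes the
  argument independent of the characteristic.

  The torus is arbitrary. In place of conjugacy of maximal tori, the given weight basis is made
  symplectic; this places the torus inside a conjugate of the diagonal one, and maximality does the
  rest.\<close>

text \<open>Functions that are polynomial of bounded degree in each single variable take the place of multivariate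
  polynomials.\<close>

definition sep_poly :: "'i set \<Rightarrow> nat \<Rightarrow> (('i \<Rightarrow> 'a::Fields.field) \<Rightarrow> 'a) \<Rightarrow> bool" where
  "sep_poly I d f \<longleftrightarrow>
     (\<forall>i\<in>I. \<forall>p. \<exists>q. Polynomial.degree q \<le> d \<and> (\<forall>t. f (p(i := t)) = poly q t))"

lemma sep_polyE:
  assumes "sep_poly I d f" "i \<in> I"
  obtains q where "Polynomial.degree q \<le> d" "\<And>t. f (p(i := t)) = poly q t"
  using assms unfolding sep_poly_def by blast

lemma sep_poly_mono: "sep_poly I d f \<Longrightarrow> d \<le> e \<Longrightarrow> sep_poly I e f"
  unfolding sep_poly_def by (meson le_trans)

lemma sep_poly_subset: "sep_poly I d f \<Longrightarrow> J \<subseteq> I \<Longrightarrow> sep_poly J d f"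
  unfolding sep_poly_def by blast

lemma sep_poly_const: "sep_poly I 0 (\<lambda>_. c)"
  unfolding sep_poly_def by (intro ballI allI exI[of _ "[:c:]"]) auto

lemma sep_poly_var: "sep_poly I 1 (\<lambda>p. p i)"
  unfolding sep_poly_def
proof (intro ballI allI)
  fix j and p :: "'a \<Rightarrow> 'b"
  show "\<exists>q. Polynomial.degree q \<le> 1 \<and> (\<forall>t. (p(j := t)) i = poly q t)"
    by (rule exI[of _ "if i = j then [:0, 1:] else [:p i:]"]) auto
qed

lemma sep_poly_add:
  assumes "sep_poly I d f" "sep_poly I d g"
  shows "sep_poly I d (\<lambda>p. f p + g p)"
  unfolding sep_poly_def
proof (intro ballI allI)
  fix i p assume i: "i \<in> I"
  obtain a where "Polynomial.degree a \<le> d" "\<And>t. f (p(i := t)) = poly a t"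
    using sep_polyE[OF assms(1) i] by blast
  moreover obtain b where "Polynomial.degree b \<le> d" "\<And>t. g (p(i := t)) = poly b t"
    using sep_polyE[OF assms(2) i] by blast
  ultimately show "\<exists>q. Polynomial.degree q \<le> d \<and> (\<forall>t. f (p(i := t)) + g (p(i := t)) = poly q t)"
    by (intro exI[of _ "a + b"]) (auto intro: degree_add_le)
qed

lemma sep_poly_mult:
  assumes "sep_poly I d f" "sep_poly I e g"
  shows "sep_poly I (d + e) (\<lambda>p. f p * g p)"
  unfolding sep_poly_def
proof (intro ballI allI)
  fix i p assume i: "i \<in> I"
  obtain a where "Polynomial.degree a \<le> d" "\<And>t. f (p(i := t)) = poly a t"
    using sep_polyE[OF assms(1) i] by blast
  moreover obtain b where "Polynomial.degree b \<le> e" "\<And>t. g (p(i := t)) = poly b t"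
    using sep_polyE[OF assms(2) i] by blast
  ultimately show "\<exists>q. Polynomial.degree q \<le> d + e \<and> (\<forall>t. f (p(i := t)) * g (p(i := t)) = poly q t)"
    by (intro exI[of _ "a * b"]) (auto intro: order_trans[OF degree_mult_le])
qed

lemma sep_poly_sum:
  assumes "\<And>x. x \<in> V \<Longrightarrow> sep_poly I d (f x)"
  shows "sep_poly I d (\<lambda>p. \<Sum>x\<in>V. f x p)"
  using assms
proof (induction V rule: infinite_finite_induct)
  case (insert x V)
  then show ?case by (auto intro!: sep_poly_add)
qed (auto intro: sep_poly_mono[OF sep_poly_const])

lemma sep_poly_prod:
  assumes "\<And>x. x \<in> V \<Longrightarrow> sep_poly I d (f x)"
  shows "sep_poly I (card V * d) (\<lambda>p. \<Prod>x\<in>V. f x p)"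
  using assms
proof (induction V rule: infinite_finite_induct)
  case (insert x V)
  then show ?case by (auto intro!: sep_poly_mult)
qed (auto intro: sep_poly_mono[OF sep_poly_const])

lemma sep_poly_power:
  assumes "sep_poly I d f"
  shows "sep_poly I (k * d) (\<lambda>p. f p ^ k)"
  using sep_poly_prod[of "{..<k}" I d "\<lambda>_. f"] assms by simp

text \<open>The coordinates in \<open>I\<close> are moved into \<open>S\<close> one at a time: along
  each coordinate line through the current point the function is a nonzero polynomial of degree at
  most \<open>d\<close>, which has fewer than \<open>card S\<close> roots.\<close>

lemma sep_poly_grid_nonzero:
  assumes "finite I" "sep_poly I d f" "f p \<noteq> 0" "d < card S"
  shows "\<exists>z. (\<forall>i\<in>I. z i \<in> S) \<and> (\<forall>i. i \<notin> I \<longrightarrow> z i = p i) \<and> f z \<noteq> 0"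
proof -
  have "J \<subseteq> I \<Longrightarrow> f p \<noteq> 0 \<Longrightarrow> 
    \<exists>z. (\<forall>i\<in>J. z i \<in> S) \<and> (\<forall>i. i \<notin> J \<longrightarrow> z i = p i) \<and> f z \<noteq> 0" if "finite J" for J p
    using that
  proof (induction J arbitrary: p)
    case empty
    then show ?case by auto
  next
    case (insert j J)
    have jI: "j \<in> I" using insert.prems(1) by simp
    obtain q where q: "Polynomial.degree q \<le> d" "\<And>t. f (p(j := t)) = poly q t"
      using sep_polyE[OF assms(2) jI] by blast
    have "q \<noteq> 0" using q(2)[of "p j"] insert.prems by auto
    then have "card {t. poly q t = 0} \<le> d" "finite {t. poly q t = 0}"
      using card_poly_roots_bound[of q] q(1) poly_roots_finite[of q] by auto
    then obtain t where t: "t \<in> S" "poly q t \<noteq> 0"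
    proof -
      have "\<not> S \<subseteq> {t. poly q t = 0}"
        using card_mono[OF \<open>finite {t. poly q t = 0}\<close>, of S] \<open>card {t. poly q t = 0} \<le> d\<close> assms(4) by linarith
      then show ?thesis using that by blast
    qed
    have "J \<subseteq> I" "f (p(j := t)) \<noteq> 0" using insert.prems t q by auto
    from insert.IH[OF this] obtain z where
      z: "\<forall>i\<in>J. z i \<in> S" "\<forall>i. i \<notin> J \<longrightarrow> z i = (p(j := t)) i" "f z \<noteq> 0" by blast
    have "z j = t" using z(2) insert.hyps by auto
    then show ?case using z t by (intro exI[of _ z]) auto
  qed
  then show ?thesis using assms by blast
qed

section \<open>Polynomial functions of unspecified degree and their common nonvanishing
  points\<close>

definition mpoly_fun :: "'i set \<Rightarrow> (('i \<Rightarrow> 'a::Fields.field) \<Rightarrow> 'a) \<Rightarrow> bool" where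
  "mpoly_fun I f \<longleftrightarrow> (\<exists>d. sep_poly I d f)"

lemma mpoly_fun_subset: "mpoly_fun I f \<Longrightarrow> J \<subseteq> I \<Longrightarrow> mpoly_fun J f"
  unfolding mpoly_fun_def using sep_poly_subset by blast

lemma mpoly_fun_const [intro, simp]: "mpoly_fun I (\<lambda>_. c)"
  unfolding mpoly_fun_def using sep_poly_const by blast

lemma mpoly_fun_var [intro, simp]: "mpoly_fun I (\<lambda>p. p i)"
  unfolding mpoly_fun_def by (rule exI[of _ 1]) (rule sep_poly_var)

lemma mpoly_fun_add [intro]:
  assumes "mpoly_fun I f" "mpoly_fun I g"
  shows "mpoly_fun I (\<lambda>p. f p + g p)"
proof -
  obtain d e where "sep_poly I d f" "sep_poly I e g" using assms unfolding mpoly_fun_def by blast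
  then have "sep_poly I (max d e) (\<lambda>p. f p + g p)"
    by (intro sep_poly_add) (auto elim: sep_poly_mono)
  then show ?thesis unfolding mpoly_fun_def by blast
qed

lemma mpoly_fun_mult [intro]:
  "mpoly_fun I f \<Longrightarrow> mpoly_fun I g \<Longrightarrow> mpoly_fun I (\<lambda>p. f p * g p)"
  unfolding mpoly_fun_def using sep_poly_mult by blast

lemma mpoly_fun_uminus [intro]: "mpoly_fun I f \<Longrightarrow> mpoly_fun I (\<lambda>p. - f p)"
  using mpoly_fun_mult[of I "\<lambda>_. -1" f] by simp

lemma mpoly_fun_diff [intro]:
  "mpoly_fun I f \<Longrightarrow> mpoly_fun I g \<Longrightarrow> mpoly_fun I (\<lambda>p. f p - g p)"
  using mpoly_fun_add[of I f "\<lambda>p. - g p"] by auto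

lemma mpoly_fun_sum [intro]:
  "(\<And>x. x \<in> V \<Longrightarrow> mpoly_fun I (f x)) \<Longrightarrow> mpoly_fun I (\<lambda>p. \<Sum>x\<in>V. f x p)"
  by (induction V rule: infinite_finite_induct) auto

lemma mpoly_fun_prod [intro]:
  "(\<And>x. x \<in> V \<Longrightarrow> mpoly_fun I (f x)) \<Longrightarrow> mpoly_fun I (\<lambda>p. \<Prod>x\<in>V. f x p)"
  by (induction V rule: infinite_finite_induct) auto

lemma mpoly_fun_power [intro]: "mpoly_fun I f \<Longrightarrow> mpoly_fun I (\<lambda>p. f p ^ k)"
  unfolding mpoly_fun_def using sep_poly_power by blast

text \<open>Irreducibility of affine space, with coordinates in an infinite set. The product of
  \<open>f\<close> and \<open>g\<close> offers no starting point, since it may vanish at both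
  \<open>p\<close> and \<open>q\<close>. Instead both points move at once: coordinate by coordinate
  they receive the same value from \<open>K\<close>, outside the roots of two nonzero one-variable
  polynomials, until they coincide.\<close>

lemma mpoly_fun_common_nonzero:
  fixes f g :: "('i \<Rightarrow> 'a::Fields.field) \<Rightarrow> 'a"
  assumes "finite I" "infinite K" "mpoly_fun I f" "mpoly_fun I g" "f p \<noteq> 0" "g q \<noteq> 0"
    and "\<And>i. i \<notin> I \<Longrightarrow> p i = q i"
  shows "\<exists>z. (\<forall>i\<in>I. z i \<in> K) \<and> (\<forall>i. i \<notin> I \<longrightarrow> z i = p i) \<and> f z \<noteq> 0 \<and> g z \<noteq> 0"
proof -
  obtain d where d: "sep_poly I d f" using assms unfolding mpoly_fun_def by blast
  obtain e where e: "sep_poly I e g" using assms unfolding mpoly_fun_def by blast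
  have "J \<subseteq> I \<Longrightarrow> f p \<noteq> 0 \<Longrightarrow> g q \<noteq> 0 \<Longrightarrow> (\<forall>i. i \<notin> J \<longrightarrow> p i = q i) \<Longrightarrow>
    \<exists>z. (\<forall>i\<in>J. z i \<in> K) \<and> (\<forall>i. i \<notin> J \<longrightarrow> z i = p i) \<and> f z \<noteq> 0 \<and> g z \<noteq> 0" if "finite J" for J p q
    using that
  proof (induction J arbitrary: p q)
    case empty
    then have "p = q" by auto
    then show ?case using empty by auto
  next
    case (insert j J)
    have jI: "j \<in> I" using insert.prems(1) by simp
    obtain a where a: "\<And>t. f (p(j := t)) = poly a t"
      using sep_polyE[OF d jI] by blast
    obtain b where b: "\<And>t. g (q(j := t)) = poly b t"
      using sep_polyE[OF e jI] by blast
    have "a \<noteq> 0" "b \<noteq> 0" using a[of "p j"] b[of "q j"] insert.prems by auto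
    then have "finite ({t. poly a t = 0} \<union> {t. poly b t = 0})"
      using poly_roots_finite by blast
    then obtain t where t: "t \<in> K" "poly a t \<noteq> 0" "poly b t \<noteq> 0"
    proof -
      assume "finite ({t. poly a t = 0} \<union> {t. poly b t = 0})"
      then have "\<not> K \<subseteq> {t. poly a t = 0} \<union> {t. poly b t = 0}"
        using assms(2) finite_subset by blast
      then show ?thesis using that by blast
    qed
    have "J \<subseteq> I" "f (p(j := t)) \<noteq> 0" "g (q(j := t)) \<noteq> 0"
      "\<forall>i. i \<notin> J \<longrightarrow> (p(j := t)) i = (q(j := t)) i" using insert.prems t a b by auto
    from insert.IH[OF this] obtain z where
      z: "\<forall>i\<in>J. z i \<in> K" "\<forall>i. i \<notin> J \<longrightarrow> z i = (p(j := t)) i" "f z \<noteq> 0" "g z \<noteq> 0" by blast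
    have "z j = t" using z(2) insert.hyps by auto
    then show ?case using z t by (intro exI[of _ z]) auto
  qed
  then show ?thesis using assms by blast
qed

text \<open>The product of the members already treated is again a polynomial function, so a finite
  family reduces to two functions. Fixing the coordinates outside \<open>I\<close> by
  \<open>p0\<close> makes the separate witnesses comparable.\<close>

lemma mpoly_fun_family_nonzero:
  fixes f :: "'x \<Rightarrow> ('i \<Rightarrow> 'a::Fields.field) \<Rightarrow> 'a"
  assumes "finite I" "infinite K" "finite V"
    and "\<And>x. x \<in> V \<Longrightarrow> mpoly_fun I (f x)"
    and "\<And>x. x \<in> V \<Longrightarrow> \<exists>p. (\<forall>i. i \<notin> I \<longrightarrow> p i = p0 i) \<and> f x p \<noteq> 0"
  shows "\<exists>z. (\<forall>i\<in>I. z i \<in> K) \<and> (\<forall>i. i \<notin> I \<longrightarrow> z i = p0 i) \<and> (\<forall>x\<in>V. f x z \<noteq> 0)"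
  using assms(3-)
proof (induction V)
  case empty
  obtain t where "t \<in> K" using assms(2) by fastforce
  then show ?case by (intro exI[of _ "\<lambda>i. if i \<in> I then t else p0 i"]) auto
next
  case (insert x V)
  have "\<exists>z. (\<forall>i\<in>I. z i \<in> K) \<and> (\<forall>i. i \<notin> I \<longrightarrow> z i = p0 i) \<and> (\<forall>x\<in>V. f x z \<noteq> 0)"
    using insert.prems by (intro insert.IH) blast+
  then obtain z where z: "\<forall>i\<in>I. z i \<in> K" "\<forall>i. i \<notin> I \<longrightarrow> z i = p0 i" "\<forall>x\<in>V. f x z \<noteq> 0" by blast
  obtain p where p: "\<forall>i. i \<notin> I \<longrightarrow> p i = p0 i" "f x p \<noteq> 0" using insert.prems(2) by blast
  have 1: "mpoly_fun I (f x)" "mpoly_fun I (\<lambda>z. \<Prod>x\<in>V. f x z)"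
    using insert.prems(1) by (simp, intro mpoly_fun_prod, simp)
  have 2: "(\<Prod>x\<in>V. f x z) \<noteq> 0" using z insert.hyps by auto
  have 3: "p i = z i" if "i \<notin> I" for i using p z that by auto
  from mpoly_fun_common_nonzero[OF assms(1,2) 1 p(2) 2 3] obtain z' where
    "\<forall>i\<in>I. z' i \<in> K" "\<forall>i. i \<notin> I \<longrightarrow> z' i = p i" "f x z' \<noteq> 0" "(\<Prod>x\<in>V. f x z') \<noteq> 0" by blast
  then show ?case using p insert.hyps by (intro exI[of _ z']) auto
qed

section \<open>Algebraic dependence by counting equations and unknowns\<close>

lemma homogeneous_system_nontrivial:
  fixes A :: "'e \<Rightarrow> 'x \<Rightarrow> 'a::Fields.field"
  assumes "finite E" "finite V" "card E < card V"
  shows "\<exists>q. (\<exists>x\<in>V. q x \<noteq> 0) \<and> (\<forall>e\<in>E. (\<Sum>x\<in>V. q x * A e x) = 0)"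
  using assms
proof (induction E arbitrary: V A)
  case empty
  then show ?case by (intro exI[of _ "\<lambda>_. 1"]) (auto simp: card_gt_0_iff)
next
  case (insert e E)
  show ?case
  proof (cases "\<forall>x\<in>V. A e x = 0")
    case True
    obtain q where "\<exists>x\<in>V. q x \<noteq> 0" "\<forall>e\<in>E. (\<Sum>x\<in>V. q x * A e x) = 0"
      using insert.IH[of V A] insert.prems insert.hyps by auto
    then show ?thesis using True by (intro exI[of _ q]) auto
  next
    case False
    then obtain x0 where x0: "x0 \<in> V" "A e x0 \<noteq> 0" by blast
    \<comment> \<open>Elimination with pivot \<open>x0\<close>: multiples of equation
      \<open>e\<close> are subtracted from the others. A solution of the smaller system extends to
      \<open>x0\<close> by solving equation \<open>e\<close>, which is the value given by
      \<open>q'\<close>.\<close>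
    define A' where "A' e' x = A e' x - A e' x0 / A e x0 * A e x" for e' x
    have "card E < card (V - {x0})" using insert.prems insert.hyps x0 by (simp add: card_Diff_singleton)
    then obtain q where q: "\<exists>x\<in>V - {x0}. q x \<noteq> 0" "\<forall>e\<in>E. (\<Sum>x\<in>V - {x0}. q x * A' e x) = 0"
      using insert.IH[of "V - {x0}" A'] insert.prems by auto
    define S where "S = (\<Sum>x\<in>V - {x0}. q x * A e x)"
    define q' where "q' x = (if x = x0 then - S / A e x0 else q x)" for x
    have sum': "(\<Sum>x\<in>V. q' x * A e' x) = - S / A e x0 * A e' x0 + (\<Sum>x\<in>V - {x0}. q x * A e' x)" for e'
      using sum.remove[OF insert.prems(1) x0(1), of "\<lambda>x. q' x * A e' x"]
      by (simp add: q'_def)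
    have "(\<Sum>x\<in>V. q' x * A e x) = 0" using x0 by (simp add: sum' S_def)
    moreover have "(\<Sum>x\<in>V. q' x * A e' x) = 0" if "e' \<in> E" for e'
    proof -
      have "0 = (\<Sum>x\<in>V - {x0}. q x * A' e' x)" using q that by simp
      also have "\<dots> = (\<Sum>x\<in>V - {x0}. q x * A e' x) - A e' x0 / A e x0 * S"
        unfolding A'_def S_def by (simp add: algebra_simps sum_subtractf sum_distrib_left)
      finally show ?thesis by (simp add: sum')
    qed
    moreover have "\<exists>x\<in>V. q' x \<noteq> 0" using q by (auto simp: q'_def)
    ultimately show ?thesis by (intro exI[of _ q']) auto
  qed
qed

text \<open>There are more monomials of degree at most \<open>M\<close> in each of the \<open>F j\<close> than points in a grid large
  enough to detect the vanishing of their linear combinations. The powers of \<open>d\<close> serve to clear denominators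
  of the quotients \<open>F j / d\<close>.\<close>

lemma algebraic_dependence:
  fixes F :: "'j \<Rightarrow> ('i \<Rightarrow> 'a::Fields.field) \<Rightarrow> 'a"
  assumes "finite I" "finite J" "card I < card J" "infinite (UNIV :: 'a set)"
    and "mpoly_fun I d" "\<And>j. j \<in> J \<Longrightarrow> mpoly_fun I (F j)"
  shows "\<exists>M q. (\<exists>\<mu>\<in>PiE J (\<lambda>_. {..M}). q \<mu> \<noteq> 0) \<and>
    (\<forall>p. (\<forall>i. i \<notin> I \<longrightarrow> p i = p0 i) \<longrightarrow>
      (\<Sum>\<mu>\<in>PiE J (\<lambda>_. {..M}). q \<mu> * (\<Prod>j\<in>J. F j p ^ \<mu> j * d p ^ (M - \<mu> j))) = 0)"
proof -
  obtain \<delta>0 where \<delta>0: "sep_poly I \<delta>0 d" using assms unfolding mpoly_fun_def by blast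
  have "\<forall>j\<in>J. \<exists>d. sep_poly I d (F j)" using assms unfolding mpoly_fun_def by blast
  then obtain \<delta>1 where \<delta>1: "\<And>j. j \<in> J \<Longrightarrow> sep_poly I (\<delta>1 j) (F j)" by metis
  define \<delta> where "\<delta> = \<delta>0 + (\<Sum>j\<in>J. \<delta>1 j)"
  have d: "sep_poly I \<delta> d" using \<delta>0 by (rule sep_poly_mono) (simp add: \<delta>_def)
  have F: "sep_poly I \<delta> (F j)" if "j \<in> J" for j
  proof -
    have "\<delta>1 j \<le> sum \<delta>1 J" using assms(2) that by (intro member_le_sum) auto
    then show ?thesis by (intro sep_poly_mono[OF \<delta>1[OF that]]) (simp add: \<delta>_def)
  qed
  \<comment> \<open>A detecting grid needs more than card J M \<delta> values per coordinate, and C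
    (M + 1) values are enough. Since C^(card I) = M, this amounts to at most M (M + 1)^(card I)
    points, fewer than the (M + 1)^(card I + 1) monomials available at least.\<close>
  define C where "C = Suc (card J * \<delta>)"
  define M where "M = C ^ card I"
  define V where "V = PiE J (\<lambda>_. {..M})"
  have finX: "finite V" unfolding V_def by (intro finite_PiE assms(2)) auto
  define G where "G \<mu> p = (\<Prod>j\<in>J. F j p ^ \<mu> j * d p ^ (M - \<mu> j))" for \<mu> p
  have G: "sep_poly I (card J * (M * \<delta>)) (G \<mu>)" if "\<mu> \<in> V" for \<mu>
    unfolding G_def
  proof (rule sep_poly_prod)
    fix j assume j: "j \<in> J"
    have "\<mu> j \<le> M" using that j unfolding V_def by auto
    then have "\<mu> j * \<delta> + (M - \<mu> j) * \<delta> = M * \<delta>" by (metis add_mult_distrib le_add_diff_inverse)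
    then show "sep_poly I (M * \<delta>) (\<lambda>p. F j p ^ \<mu> j * d p ^ (M - \<mu> j))"
      using sep_poly_mult[OF sep_poly_power[OF F[OF j]] sep_poly_power[OF d], of "\<mu> j" "M - \<mu> j"]
      by simp
  qed
  obtain S :: "'a set" where S: "finite S" "card S = Suc (card J * (M * \<delta>))"
    using infinite_arbitrarily_large[OF assms(4), of "Suc (card J * (M * \<delta>))"] by blast
  define E where "E = PiE I (\<lambda>_. S)"
  have "finite E" unfolding E_def by (intro finite_PiE assms(1) S(1))
  moreover have "card E < card V"
  proof -
    have "card E = card S ^ card I" unfolding E_def using assms(1) by (simp add: card_PiE)
    also have "\<dots> \<le> (C * (M + 1)) ^ card I"
      by (intro power_mono) (simp_all add: S(2) C_def add_mult_distrib2 mult.assoc mult.commute)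
    also have "\<dots> = M * (M + 1) ^ card I" by (simp only: power_mult_distrib M_def[symmetric])
    also have "\<dots> < (M + 1) ^ Suc (card I)" by simp
    also have "\<dots> \<le> (M + 1) ^ card J" using assms(3) by (intro power_increasing) simp_all
    also have "\<dots> = card V" unfolding V_def using assms(2) by (simp add: card_PiE)
    finally show ?thesis .
  qed
  ultimately obtain q where q: "\<exists>\<mu>\<in>V. q \<mu> \<noteq> 0"
    "\<And>\<sigma>. \<sigma> \<in> E \<Longrightarrow> (\<Sum>\<mu>\<in>V. q \<mu> * G \<mu> (\<lambda>i. if i \<in> I then \<sigma> i else p0 i)) = 0"
    using homogeneous_system_nontrivial[of E V "\<lambda>\<sigma> \<mu>. G \<mu> (\<lambda>i. if i \<in> I then \<sigma> i else p0 i)"] finX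
    by metis
  have sep: "sep_poly I (card J * (M * \<delta>)) (\<lambda>p. \<Sum>\<mu>\<in>V. q \<mu> * G \<mu> p)"
  proof (rule sep_poly_sum)
    fix \<mu> assume "\<mu> \<in> V"
    from sep_poly_mult[OF sep_poly_const G[OF this], of "q \<mu>"]
    show "sep_poly I (card J * (M * \<delta>)) (\<lambda>p. q \<mu> * G \<mu> p)" by (simp only: add_0)
  qed
  \<comment> \<open>The relation was imposed at the grid points only; a nonzero value anywhere on
    the slice through \<open>p0\<close> would produce a nonzero value at a grid point.\<close>
  have "(\<Sum>\<mu>\<in>V. q \<mu> * G \<mu> p) = 0" if p: "\<forall>i. i \<notin> I \<longrightarrow> p i = p0 i" for p
  proof (rule ccontr)
    assume "(\<Sum>\<mu>\<in>V. q \<mu> * G \<mu> p) \<noteq> 0"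
    then obtain z where
      z: "\<forall>i\<in>I. z i \<in> S" "\<forall>i. i \<notin> I \<longrightarrow> z i = p i" "(\<Sum>\<mu>\<in>V. q \<mu> * G \<mu> z) \<noteq> 0"
      using sep_poly_grid_nonzero[OF assms(1) sep, of p S] S(2) by auto
    have "(if i \<in> I then restrict z I i else p0 i) = z i" for i using z(2) p by simp
    moreover have "restrict z I \<in> E" using z(1) unfolding E_def by simp
    ultimately show False using q(2)[of "restrict z I"] z(3) by simp
  qed
  then show ?thesis using q(1) unfolding V_def G_def by (intro exI[of _ M] exI[of _ q]) auto
qed

section \<open>Leading terms in one variable\<close>

text \<open>With the other variables fixed, the sum is a polynomial in \<open>p j\<close> that
  vanishes on an infinite field, so each of its coefficients vanishes; a coefficient collects
  exactly the exponents with a prescribed value at \<open>j\<close>. Exponents may have entries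
  outside \<open>J\<close>, as long as their restrictions to \<open>J\<close> determine
  them.\<close>

lemma monomials_independent:
  fixes q :: "('j \<Rightarrow> nat) \<Rightarrow> 'a::Fields.field"
  assumes "finite J" "infinite (UNIV :: 'a set)" "finite A"
    and "\<And>\<mu> \<nu>. \<mu> \<in> A \<Longrightarrow> \<nu> \<in> A \<Longrightarrow> (\<forall>j\<in>J. \<mu> j = \<nu> j) \<Longrightarrow> \<mu> = \<nu>"
    and "\<And>p. (\<Sum>\<mu>\<in>A. q \<mu> * (\<Prod>j\<in>J. p j ^ \<mu> j)) = 0"
    and "\<mu> \<in> A"
  shows "q \<mu> = 0"
  using assms(1,3-)
proof (induction J arbitrary: A \<mu>)
  case empty
  then have "A = {\<mu>}" by blast
  then show ?case using empty.prems(3) by simp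
next
  case (insert j J)
  define B where "B = {\<nu> \<in> A. \<nu> j = \<mu> j}"
  show ?case
  proof (rule insert.IH[of B])
    fix p :: "'j \<Rightarrow> 'a"
    define r where "r \<nu> = q \<nu> * (\<Prod>i\<in>J. p i ^ \<nu> i)" for \<nu>
    define P where "P = (\<Sum>\<nu>\<in>A. Polynomial.monom (r \<nu>) (\<nu> j))"
    have "poly P t = 0" for t
    proof -
      have "(\<Prod>i\<in>J. (p(j := t)) i ^ \<nu> i) = (\<Prod>i\<in>J. p i ^ \<nu> i)" for \<nu> :: "'j \<Rightarrow> nat"
        using insert.hyps(2) by (intro prod.cong) auto
      then have "poly P t = (\<Sum>\<nu>\<in>A. q \<nu> * (\<Prod>i\<in>insert j J. (p(j := t)) i ^ \<nu> i))"
        using insert.hyps by (simp add: P_def r_def poly_sum poly_monom algebra_simps)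
      then show ?thesis using insert.prems(3) by simp
    qed
    then have "P = 0" using assms(2) poly_all_0_iff_0
      by (metis (mono_tags, lifting) UNIV_I finite_subset mem_Collect_eq poly_roots_finite subsetI)
    then have "Polynomial.coeff P (\<mu> j) = 0" by simp
    then have "(\<Sum>\<nu>\<in>A. if \<nu> j = \<mu> j then r \<nu> else 0) = 0"
      by (simp add: P_def coeff_sum)
    then show "(\<Sum>\<nu>\<in>B. q \<nu> * (\<Prod>i\<in>J. p i ^ \<nu> i)) = 0"
      using insert.prems(1) unfolding r_def B_def by (simp add: sum.inter_filter)
  next
    fix \<nu> \<kappa> assume "\<nu> \<in> B" "\<kappa> \<in> B" "\<forall>i\<in>J. \<nu> i = \<kappa> i"
    then show "\<nu> = \<kappa>" using insert.prems(2)[of \<nu> \<kappa>] by (auto simp: B_def)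
  qed (use insert.prems in \<open>auto simp: B_def\<close>)
qed

text \<open>The coefficient \<open>c\<close> may be zero.\<close>

definition has_lead :: "('a::Fields.field \<Rightarrow> 'a) \<Rightarrow> nat \<Rightarrow> 'a \<Rightarrow> bool" where
  "has_lead f d c \<longleftrightarrow>
     (\<exists>q. Polynomial.degree q \<le> d \<and> Polynomial.coeff q d = c \<and> (\<forall>s. f s = poly q s))"

lemma has_lead_const: "has_lead (\<lambda>_. c) 0 c"
  unfolding has_lead_def by (intro exI[of _ "[:c:]"]) auto

lemma has_lead_var: "has_lead (\<lambda>s. s) 1 1"
  unfolding has_lead_def by (intro exI[of _ "[:0, 1:]"]) auto

text \<open>Makes terms of lower order comparable with the dominant ones: they enter a sum with top
  coefficient 0.\<close>

lemma has_lead_raise: "has_lead f d c \<Longrightarrow> d < e \<Longrightarrow> has_lead f e 0"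
  unfolding has_lead_def by (metis coeff_eq_0 le_trans less_imp_le order_le_less_trans)

lemma has_lead_add:
  assumes "has_lead f d a" "has_lead g d b"
  shows "has_lead (\<lambda>s. f s + g s) d (a + b)"
proof -
  obtain p q where "Polynomial.degree p \<le> d" "Polynomial.coeff p d = a" "\<forall>s. f s = poly p s"
    "Polynomial.degree q \<le> d" "Polynomial.coeff q d = b" "\<forall>s. g s = poly q s"
    using assms unfolding has_lead_def by blast
  then show ?thesis unfolding has_lead_def
    by (intro exI[of _ "p + q"]) (auto intro: degree_add_le)
qed

lemma has_lead_mult:
  assumes "has_lead f d a" "has_lead g e b"
  shows "has_lead (\<lambda>s. f s * g s) (d + e) (a * b)"
proof -
  obtain p q where p: "Polynomial.degree p \<le> d" "Polynomial.coeff p d = a" "\<forall>s. f s = poly p s"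
    and q: "Polynomial.degree q \<le> e" "Polynomial.coeff q e = b" "\<forall>s. g s = poly q s"
    using assms unfolding has_lead_def by blast
  have "Polynomial.coeff (p * q) (d + e) = a * b"
  proof -
    have "Polynomial.coeff (p * q) (d + e) =
      (\<Sum>i\<le>d + e. Polynomial.coeff p i * Polynomial.coeff q (d + e - i))"
      by (rule coeff_mult)
    also have "\<dots> = (\<Sum>i\<in>{d}. Polynomial.coeff p i * Polynomial.coeff q (d + e - i))"
    proof (rule sum.mono_neutral_right)
      show "\<forall>i\<in>{..d + e} - {d}. Polynomial.coeff p i * Polynomial.coeff q (d + e - i) = 0"
      proof
        fix i assume "i \<in> {..d + e} - {d}"
        then have "i > d \<or> d + e - i > e" by auto
        then show "Polynomial.coeff p i * Polynomial.coeff q (d + e - i) = 0"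
          using p(1) q(1) coeff_eq_0[of p i] coeff_eq_0[of q "d + e - i"] by auto
      qed
    qed auto
    finally show ?thesis using p q by simp
  qed
  moreover have "Polynomial.degree (p * q) \<le> d + e" using p q degree_mult_le[of p q] by linarith
  ultimately show ?thesis unfolding has_lead_def using p q
    by (intro exI[of _ "p * q"]) auto
qed

lemma has_lead_sum:
  assumes "\<And>x. x \<in> V \<Longrightarrow> has_lead (f x) d (c x)"
  shows "has_lead (\<lambda>s. \<Sum>x\<in>V. f x s) d (\<Sum>x\<in>V. c x)"
proof -
  have 0: "has_lead (\<lambda>s::'b. 0) d 0" unfolding has_lead_def by (intro exI[of _ 0]) auto
  show ?thesis using assms
  proof (induction V rule: infinite_finite_induct)
    case (insert x V)
    have "has_lead (\<lambda>s. f x s + (\<Sum>x\<in>V. f x s)) d (c x + (\<Sum>x\<in>V. c x))"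
      using insert by (intro has_lead_add) simp_all
    then show ?case using insert.hyps by simp
  qed (use 0 in simp_all)
qed

lemma has_lead_prod:
  assumes "\<And>x. x \<in> V \<Longrightarrow> has_lead (f x) (d x) (c x)"
  shows "has_lead (\<lambda>s. \<Prod>x\<in>V. f x s) (\<Sum>x\<in>V. d x) (\<Prod>x\<in>V. c x)"
  using assms
proof (induction V rule: infinite_finite_induct)
  case (insert x V)
  have "has_lead (\<lambda>s. f x s * (\<Prod>x\<in>V. f x s)) (d x + (\<Sum>x\<in>V. d x)) (c x * (\<Prod>x\<in>V. c x))"
    using insert by (intro has_lead_mult) simp_all
  then show ?case using insert.hyps by simp
qed (simp_all add: has_lead_const)

lemma has_lead_power: "has_lead f d c \<Longrightarrow> has_lead (\<lambda>s. f s ^ k) (k * d) (c ^ k)"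
  using has_lead_prod[of "{..<k}" "\<lambda>_. f" "\<lambda>_. d" "\<lambda>_. c"] by simp

lemma has_lead_zero:
  assumes "has_lead f d c" "infinite S" "\<And>s. s \<in> S \<Longrightarrow> f s = 0"
  shows "c = 0"
proof -
  obtain q where q: "Polynomial.coeff q d = c" "\<forall>s. f s = poly q s"
    using assms(1) unfolding has_lead_def by blast
  have "S \<subseteq> {s. poly q s = 0}" using assms(3) q(2) by auto
  then have "q = 0" using assms(2) poly_roots_finite finite_subset by blast
  then show ?thesis using q by simp
qed

text \<open>If a relation between the quotients \<open>Y j / d\<close> has top total degree \<open>D\<close>, then only its terms of degree
  \<open>D\<close> contribute to the coefficient of highest degree in \<open>s\<close>, and they give a homogeneous relation between
  \<open>c\<close> and the variables \<open>p 1, \<dots>, p k\<close>.\<close>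

lemma leading_terms_independent:
  fixes Y :: "nat \<Rightarrow> (nat \<Rightarrow> 'a::Fields.field) \<Rightarrow> 'a"
  assumes K: "infinite K" and l: "l > 0"
    and d: "\<And>p. d p = p 0 ^ l * \<beta> p"
    and Y: "\<And>j p. j \<le> k \<Longrightarrow>
      has_lead (\<lambda>s. Y j (p(0 := s))) (2 * l) (\<kappa> p * (if j = 0 then c else p j))"
    and \<beta>: "mpoly_fun {..k} \<beta>" "\<And>p s. \<beta> (p(0 := s)) = \<beta> p" "\<beta> p0 \<noteq> 0"
    and \<lambda>: "mpoly_fun {..k} \<kappa>" "\<And>p s. \<kappa> (p(0 := s)) = \<kappa> p" "\<kappa> p0 \<noteq> 0"
    and c: "c \<noteq> 0"
    and q: "\<mu>0 \<in> PiE {..k} (\<lambda>_. {..M})" "q \<mu>0 \<noteq> 0"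
  shows "\<exists>p. (\<forall>i\<le>k. p i \<in> K) \<and> (\<forall>i>k. p i = p0 i) \<and> d p \<noteq> 0 \<and>
    (\<Sum>\<mu>\<in>PiE {..k} (\<lambda>_. {..M}). q \<mu> * (\<Prod>j\<le>k. Y j p ^ \<mu> j * d p ^ (M - \<mu> j))) \<noteq> 0"
proof (rule ccontr)
  assume neg: "\<not> ?thesis"
  define V where "V = PiE {..k} (\<lambda>_. {..M})"
  have finV: "finite V" unfolding V_def by (intro finite_PiE) auto
  define tot where "tot \<mu> = (\<Sum>j\<le>k. \<mu> j)" for \<mu> :: "nat \<Rightarrow> nat"
  \<comment> \<open>The top total degree among the monomials that really occur. It is attained by
    \<open>\<mu>1\<close>, whose coefficient will be shown to vanish.\<close>
  define D where "D = Max (tot ` {\<mu> \<in> V. q \<mu> \<noteq> 0})"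
  have fin2: "finite (tot ` {\<mu> \<in> V. q \<mu> \<noteq> 0})" using finV by simp
  have "tot \<mu>0 \<in> tot ` {\<mu> \<in> V. q \<mu> \<noteq> 0}" using q unfolding V_def by blast
  then have "D \<in> tot ` {\<mu> \<in> V. q \<mu> \<noteq> 0}" unfolding D_def using fin2 Max_in by blast
  then obtain \<mu>1 where \<mu>1: "\<mu>1 \<in> V" "q \<mu>1 \<noteq> 0" "tot \<mu>1 = D" by blast
  have D_max: "tot \<mu> \<le> D" if "\<mu> \<in> V" "q \<mu> \<noteq> 0" for \<mu>
    unfolding D_def using fin2 that by (intro Max_ge) auto
  define N where "N = M * Suc k"
  define A where "A = {\<mu> \<in> V. tot \<mu> = D}"
  have V_A: "V \<inter> A = A" by (auto simp: A_def)
  \<comment> \<open>The homogeneous part of degree \<open>D\<close>, with variable 0 specialised to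
    \<open>c\<close> and variable \<open>j\<close> to \<open>p j\<close>.\<close>
  define R where "R p = (\<Sum>\<mu>\<in>A. (q \<mu> * c ^ \<mu> 0) * (\<Prod>j=1..k. p j ^ \<mu> j))" for p :: "nat \<Rightarrow> 'a"
  define \<tau> where "\<tau> j p = (if j = 0 then c else p j)" for j :: nat and p :: "nat \<Rightarrow> 'a"
  have R_eq: "(\<Sum>\<mu>\<in>A. q \<mu> * (\<Prod>j\<le>k. \<tau> j p ^ \<mu> j)) = R p" for p
  proof -
    have "(\<Prod>j\<le>k. \<tau> j p ^ \<mu> j) = c ^ \<mu> 0 * (\<Prod>j=1..k. p j ^ \<mu> j)" for \<mu>
    proof -
      have "{..k} = insert 0 {1..k}" by auto
      then have "(\<Prod>j\<le>k. \<tau> j p ^ \<mu> j) = c ^ \<mu> 0 * (\<Prod>j=1..k. \<tau> j p ^ \<mu> j)"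
        by (simp add: \<tau>_def)
      also have "(\<Prod>j=1..k. \<tau> j p ^ \<mu> j) = (\<Prod>j=1..k. p j ^ \<mu> j)"
        by (intro prod.cong) (auto simp: \<tau>_def)
      finally show ?thesis .
    qed
    then show ?thesis unfolding R_def by (simp add: mult.assoc)
  qed
  \<comment> \<open>When only coordinate 0 varies over the nonzero elements of \<open>K\<close>, the
    whole sum vanishes by the negated claim, so its coefficient of degree
    \<open>l * N + l * D\<close> is 0. As \<kappa> and \<beta> ignore coordinate 0, that coefficient
    is the product displayed here. The value 0 has to be left out because \<open>d\<close> vanishes
    there.\<close>
  have key: "\<kappa> p ^ D * \<beta> p ^ (N - D) * R p = 0"
    if p: "\<forall>i\<le>k. p i \<in> K" "\<forall>i>k. p i = p0 i" "\<beta> p \<noteq> 0" for p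
  proof -
    define t where "t \<mu> s = q \<mu> * (\<Prod>j\<le>k. Y j (p(0 := s)) ^ \<mu> j * d (p(0 := s)) ^ (M - \<mu> j))" for \<mu> s
    have dl: "has_lead (\<lambda>s. d (p(0 := s))) l (\<beta> p)"
      using has_lead_mult[OF has_lead_power[OF has_lead_var, of l] has_lead_const, of "\<beta> p"]
      by (simp add: d \<beta>(2))
    have lead: "has_lead (t \<mu>) (l * N + l * tot \<mu>)
      (q \<mu> * (\<Prod>j\<le>k. (\<kappa> p * \<tau> j p) ^ \<mu> j * \<beta> p ^ (M - \<mu> j)))" if "\<mu> \<in> V" for \<mu>
    proof -
      have "has_lead (\<lambda>s. q \<mu> * (\<Prod>j\<le>k. Y j (p(0 := s)) ^ \<mu> j * d (p(0 := s)) ^ (M - \<mu> j)))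
        (0 + (\<Sum>j\<le>k. \<mu> j * (2 * l) + (M - \<mu> j) * l))
        (q \<mu> * (\<Prod>j\<le>k. (\<kappa> p * \<tau> j p) ^ \<mu> j * \<beta> p ^ (M - \<mu> j)))"
        unfolding \<tau>_def
        by (intro has_lead_mult has_lead_prod has_lead_power has_lead_const dl Y) simp
      \<comment> \<open>The factor with index \<open>j\<close> has degree 2 l \<mu> j + l (M - \<mu>
        j) = l M + l \<mu> j, so beyond a constant only the total degree of \<mu> matters.\<close>
      moreover have "(\<Sum>j\<le>k. \<mu> j * (2 * l) + (M - \<mu> j) * l) = l * N + l * tot \<mu>"
      proof -
        have "(\<Sum>j\<le>k. \<mu> j * (2 * l) + (M - \<mu> j) * l) = (\<Sum>j\<le>k. l * M + l * \<mu> j)"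
        proof (rule sum.cong[OF refl])
          fix j assume "j \<in> {..k}"
          then have "\<mu> j \<le> M" using that unfolding V_def by auto
          then obtain e where "M = \<mu> j + e" using le_Suc_ex by blast
          then show "\<mu> j * (2 * l) + (M - \<mu> j) * l = l * M + l * \<mu> j" by (simp add: algebra_simps)
        qed
        also have "\<dots> = l * N + l * tot \<mu>"
          by (simp add: sum.distrib N_def tot_def sum_distrib_left algebra_simps)
        finally show ?thesis .
      qed
      ultimately show ?thesis unfolding t_def by simp
    qed
    have "has_lead (t \<mu>) (l * N + l * D)
      (if \<mu> \<in> A then q \<mu> * (\<Prod>j\<le>k. (\<kappa> p * \<tau> j p) ^ \<mu> j * \<beta> p ^ (M - \<mu> j)) else 0)"
      if \<mu>: "\<mu> \<in> V" for \<mu>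
    proof (cases "q \<mu> = 0")
      case True
      then have "t \<mu> = (\<lambda>_. 0)" by (auto simp: t_def)
      moreover have "has_lead (\<lambda>_::'a. 0) (l * N + l * D) 0"
        unfolding has_lead_def by (intro exI[of _ 0]) auto
      ultimately show ?thesis using True by simp
    next
      case False
      show ?thesis
      proof (cases "tot \<mu> = D")
        case True
        then show ?thesis using lead[OF \<mu>] \<mu> by (simp add: A_def)
      next
        case 2: False
        then have "tot \<mu> < D" using D_max[OF \<mu> False] by simp
        then have "l * N + l * tot \<mu> < l * N + l * D" using l by simp
        then show ?thesis using has_lead_raise[OF lead[OF \<mu>]] 2 by (simp add: A_def)
      qed
    qed
    then have "has_lead (\<lambda>s. \<Sum>\<mu>\<in>V. t \<mu> s) (l * N + l * D)
      (\<Sum>\<mu>\<in>V. if \<mu> \<in> A then q \<mu> * (\<Prod>j\<le>k. (\<kappa> p * \<tau> j p) ^ \<mu> j * \<beta> p ^ (M - \<mu> j)) else 0)"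
      by (rule has_lead_sum)
    note sum_lead = this
    have t0: "(\<Sum>\<mu>\<in>V. t \<mu> s) = 0" if "s \<in> K - {0}" for s
    proof -
      have "\<forall>i\<le>k. (p(0 := s)) i \<in> K" "\<forall>i>k. (p(0 := s)) i = p0 i" "d (p(0 := s)) \<noteq> 0"
        using p that by (auto simp: d \<beta>(2))
      then show ?thesis using neg unfolding t_def V_def by blast
    qed
    have "infinite (K - {0})" using K by simp
    from has_lead_zero[OF sum_lead this t0] have "(\<Sum>\<mu>\<in>V. if \<mu> \<in> A then q \<mu> * (\<Prod>j\<le>k. (\<kappa> p * \<tau> j p) ^ \<mu> j * \<beta> p ^ (M - \<mu> j)) else 0) = 0" .
    then have "(\<Sum>\<mu>\<in>A. q \<mu> * (\<Prod>j\<le>k. (\<kappa> p * \<tau> j p) ^ \<mu> j * \<beta> p ^ (M - \<mu> j))) = 0"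
      by (simp only: sum.inter_restrict[OF finV, symmetric] V_A)
    moreover have "(\<Prod>j\<le>k. (\<kappa> p * \<tau> j p) ^ \<mu> j * \<beta> p ^ (M - \<mu> j)) =
      \<kappa> p ^ D * \<beta> p ^ (N - D) * (\<Prod>j\<le>k. \<tau> j p ^ \<mu> j)" if "\<mu> \<in> A" for \<mu>
    proof -
      have le: "\<mu> j \<le> M" if "j \<le> k" for j using that \<open>\<mu> \<in> A\<close> unfolding A_def V_def by auto
      have "(\<Sum>j\<le>k. M - \<mu> j) = N - D"
        using that sum_subtractf_nat[of "{..k}" \<mu> "\<lambda>_. M"] le by (simp add: N_def A_def tot_def mult.commute)
      moreover have "(\<Prod>j\<le>k. \<kappa> p ^ \<mu> j) = \<kappa> p ^ D" "(\<Prod>j\<le>k. \<beta> p ^ (M - \<mu> j)) = \<beta> p ^ (\<Sum>j\<le>k. M - \<mu> j)"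
        using that by (simp_all add: power_sum[symmetric] A_def tot_def)
      ultimately show ?thesis
        by (simp add: prod.distrib power_mult_distrib)
    qed
    ultimately have "(\<Sum>\<mu>\<in>A. q \<mu> * (\<kappa> p ^ D * \<beta> p ^ (N - D) * (\<Prod>j\<le>k. \<tau> j p ^ \<mu> j))) = 0" by simp
    then show ?thesis unfolding R_eq[symmetric] by (simp add: sum_distrib_left mult.left_commute)
  qed
  have infU: "infinite (UNIV :: 'a set)" using K finite_subset subset_UNIV by blast
  \<comment> \<open>The identity \<open>key\<close> speaks only of points over \<open>K\<close> with
    nonzero \<beta>, and it can be divided by its scalar factors only where \<kappa> is nonzero too.
    A point with \<open>R\<close> nonzero could be moved to a point satisfying all of this.\<close>
  have R0: "R p = 0" for p
  proof (rule ccontr)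
    assume nz: "R p \<noteq> 0"
    define p' where "p' i = (if i \<le> k then p i else p0 i)" for i
    have "R p' = R p" unfolding R_def p'_def by (intro sum.cong refl arg_cong2[of _ _ _ _ "(*)"] prod.cong) auto
    then have 1: "R p' \<noteq> 0" using nz by simp
    have 2: "mpoly_fun {..k} R" unfolding R_def[abs_def]
      by (intro mpoly_fun_sum mpoly_fun_mult mpoly_fun_prod mpoly_fun_power mpoly_fun_const mpoly_fun_var)
    have 3: "mpoly_fun {..k} (\<lambda>p. \<kappa> p * \<beta> p)" using \<lambda> \<beta> by (intro mpoly_fun_mult)
    have 4: "\<kappa> p0 * \<beta> p0 \<noteq> 0" using \<lambda> \<beta> by simp
    have 5: "p' i = p0 i" if "i \<notin> {..k}" for i using that by (simp add: p'_def)
    obtain z where z: "\<forall>i\<in>{..k}. z i \<in> K" "\<forall>i. i \<notin> {..k} \<longrightarrow> z i = p' i" "R z \<noteq> 0" "\<kappa> z * \<beta> z \<noteq> 0"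
      using mpoly_fun_common_nonzero[of "{..k}" K R "\<lambda>p. \<kappa> p * \<beta> p" p' p0] K 1 2 3 4 5 by auto
    then have "\<kappa> z ^ D * \<beta> z ^ (N - D) * R z = 0" by (intro key) (auto simp: p'_def)
    then show False using z by simp
  qed
  have "q \<mu>1 * c ^ \<mu>1 0 = 0"
  proof (rule monomials_independent[of "{1..k}" A "\<lambda>\<mu>. q \<mu> * c ^ \<mu> 0"])
    show "(\<Sum>\<mu>\<in>A. q \<mu> * c ^ \<mu> 0 * (\<Prod>j = 1..k. p j ^ \<mu> j)) = 0" for p
      using R0 unfolding R_def by simp
  next
    \<comment> \<open>The exponent at 0 no longer belongs to a variable, but on \<open>A\<close> it
      is recovered as \<open>D\<close> minus the sum of the other exponents.\<close>
    fix \<mu> \<nu> assume \<mu>\<nu>: "\<mu> \<in> A" "\<nu> \<in> A" "\<forall>j\<in>{1..k}. \<mu> j = \<nu> j"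
    have "{..k} = insert 0 {1..k}" by auto
    then have "tot \<mu> = \<mu> 0 + (\<Sum>j=1..k. \<mu> j)" "tot \<nu> = \<nu> 0 + (\<Sum>j=1..k. \<nu> j)" by (simp_all add: tot_def)
    moreover have "(\<Sum>j=1..k. \<mu> j) = (\<Sum>j=1..k. \<nu> j)" using \<mu>\<nu>(3) by (intro sum.cong) auto
    ultimately have "\<mu> 0 = \<nu> 0" using \<mu>\<nu> by (simp add: A_def)
    then have "\<mu> j = \<nu> j" if "j \<in> {..k}" for j using \<mu>\<nu>(3) that by (cases "j = 0") auto
    then show "\<mu> = \<nu>" using \<mu>\<nu>(1,2) PiE_ext[of \<mu> "{..k}" "\<lambda>_. {..M}" \<nu>]
      by (simp add: A_def V_def)
  qed (use \<mu>1 finV infU in \<open>auto simp: A_def\<close>)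
  then show False using \<mu>1 c by simp
qed

section \<open>Zariski topology and dimension\<close>

lemma topspace_zariski [simp]: "topspace (zariski n) = (carrier_mat n n :: 'a::Fields.field mat set)"
  unfolding zariski_def topology_generated_by_topspace
proof (rule subset_antisym)
  show "(carrier_mat n n :: 'a mat set) \<subseteq> \<Union> {{A \<in> carrier_mat n n. p A \<noteq> 0} |p. p \<in> poly_functions n}"
  proof
    fix A :: "'a mat" assume "A \<in> carrier_mat n n"
    then have "A \<in> {A \<in> carrier_mat n n. (\<lambda>_. 1 :: 'a) A \<noteq> 0}" by simp
    moreover have "(\<lambda>_. 1) \<in> poly_functions n" by (rule poly_functions.const)
    ultimately show "A \<in> \<Union> {{A \<in> carrier_mat n n. p A \<noteq> 0} |p. p \<in> poly_functions n}" by blast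
  qed
qed auto

lemma openin_principal:
  "p \<in> poly_functions n \<Longrightarrow> openin (zariski n) {A \<in> carrier_mat n n. p A \<noteq> 0}"
  unfolding zariski_def by (rule topology_generated_by_Basis) blast

lemma closedin_zeros:
  assumes "p \<in> poly_functions n"
  shows "closedin (zariski n) {A \<in> carrier_mat n n. p A = 0}"
proof -
  have "carrier_mat n n - {A \<in> carrier_mat n n. p A = 0} = {A \<in> carrier_mat n n. p A \<noteq> 0}" by auto
  then show ?thesis using openin_principal[OF assms] by (simp add: closedin_def)
qed

text \<open>Multiplying polynomials intersects principal open sets, so the generating family is
  already a basis.\<close>

lemma principal_open_basis:
  assumes "openin (zariski n) U" "x \<in> U"
  shows "\<exists>p\<in>poly_functions n. p x \<noteq> 0 \<and> {A \<in> carrier_mat n n. p A \<noteq> 0} \<subseteq> U"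
proof -
  have "generate_topology_on {{A \<in> carrier_mat n n. p A \<noteq> 0} | p. p \<in> poly_functions n} U"
    using assms(1) unfolding zariski_def by (rule openin_topology_generated_by)
  then show ?thesis using assms(2)
  proof induction
    case (Int a b)
    then obtain p q where "p \<in> poly_functions n" "p x \<noteq> 0" "{A \<in> carrier_mat n n. p A \<noteq> 0} \<subseteq> a"
      "q \<in> poly_functions n" "q x \<noteq> 0" "{A \<in> carrier_mat n n. q A \<noteq> 0} \<subseteq> b" by blast
    then show ?case by (intro bexI[of _ "\<lambda>A. p A * q A"] poly_functions.mult) auto
  next
    case (UN K)
    then obtain k where k: "k \<in> K" "x \<in> k" by blast
    from UN.IH[OF k] show ?case using k by blast
  qed auto
qed

lemma poly_functions_sum:
  "(\<And>x. x \<in> V \<Longrightarrow> f x \<in> poly_functions n) \<Longrightarrow> (\<lambda>A. \<Sum>x\<in>V. f x A) \<in> poly_functions n"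
  by (induction V rule: infinite_finite_induct) (auto intro: poly_functions.intros)

lemma poly_functions_prod:
  "(\<And>x. x \<in> V \<Longrightarrow> f x \<in> poly_functions n) \<Longrightarrow> (\<lambda>A. \<Prod>x\<in>V. f x A) \<in> poly_functions n"
  by (induction V rule: infinite_finite_induct) (auto intro: poly_functions.intros)

lemma poly_functions_power: "f \<in> poly_functions n \<Longrightarrow> (\<lambda>A. f A ^ k) \<in> poly_functions n"
  using poly_functions_prod[of "{..<k}" "\<lambda>_. f" n] by simp

text \<open>For a nonempty set, this is primality of the vanishing ideal. Stating it for the set
  itself, without its closure, lets it be checked by specialising parameters.\<close>

definition poly_irreducible :: "nat \<Rightarrow> 'a::Fields.field mat set \<Rightarrow> bool" where
  "poly_irreducible n S \<longleftrightarrow> S \<subseteq> carrier_mat n n \<and> S \<noteq> {} \<and>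
     (\<forall>P\<in>poly_functions n. \<forall>Q\<in>poly_functions n.
        (\<exists>x\<in>S. P x \<noteq> 0) \<longrightarrow> (\<exists>x\<in>S. Q x \<noteq> 0) \<longrightarrow> (\<exists>x\<in>S. P x \<noteq> 0 \<and> Q x \<noteq> 0))"

text \<open>If neither closed set contained \<open>S\<close>, their complements would contain
  principal open sets meeting \<open>S\<close>, and primality would give a point of \<open>S\<close>
  in both.\<close>

lemma poly_irreducible_closed_cover:
  assumes S: "poly_irreducible n S" and A: "closedin (zariski n) A" and B: "closedin (zariski n) B"
    and "S \<subseteq> A \<union> B"
  shows "S \<subseteq> A \<or> S \<subseteq> B"
proof (rule ccontr)
  assume "\<not> ?thesis"
  then obtain x y where xy: "x \<in> S" "x \<notin> A" "y \<in> S" "y \<notin> B" by blast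
  have SC: "S \<subseteq> carrier_mat n n" using S by (simp add: poly_irreducible_def)
  have "x \<in> carrier_mat n n - A" "y \<in> carrier_mat n n - B"
    using xy SC by blast+
  moreover have "openin (zariski n) (carrier_mat n n - A)" "openin (zariski n) (carrier_mat n n - B)"
    using A B by (simp_all add: closedin_def)
  ultimately obtain P Q where
    P: "P \<in> poly_functions n" "P x \<noteq> 0" "{M \<in> carrier_mat n n. P M \<noteq> 0} \<subseteq> carrier_mat n n - A" and
    Q: "Q \<in> poly_functions n" "Q y \<noteq> 0" "{M \<in> carrier_mat n n. Q M \<noteq> 0} \<subseteq> carrier_mat n n - B"
    using principal_open_basis[of n "carrier_mat n n - A" x]
      principal_open_basis[of n "carrier_mat n n - B" y] by auto
  then obtain z where "z \<in> S" "P z \<noteq> 0" "Q z \<noteq> 0"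
    using S xy unfolding poly_irreducible_def by blast
  moreover have "z \<in> carrier_mat n n" using \<open>z \<in> S\<close> SC by blast
  ultimately show False using P Q assms(4) by blast
qed

lemma poly_irreducible_connected:
  assumes "poly_irreducible n S"
  shows "connectedin (zariski n) S"
  unfolding connectedin_closedin
proof (intro conjI notI)
  show "S \<subseteq> topspace (zariski n)" using assms by (simp add: poly_irreducible_def)
  assume "\<exists>E1 E2. closedin (zariski n) E1 \<and> closedin (zariski n) E2 \<and> S \<subseteq> E1 \<union> E2 \<and>
    E1 \<inter> E2 \<inter> S = {} \<and> E1 \<inter> S \<noteq> {} \<and> E2 \<inter> S \<noteq> {}"
  then show False using poly_irreducible_closed_cover[OF assms] by blast
qed

text \<open>A closed set containing \<open>S\<close> contains its closure, so irreducibility passes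
  from \<open>S\<close> to the closure; since \<open>Z\<close> is closed, relatively closed subsets
  of \<open>Z\<close> are closed in the whole space.\<close>

lemma irreducible_in_closure:
  assumes S: "poly_irreducible n S"
    and X: "closedin (zariski n) Z" "S \<subseteq> Z"
  shows "irreducible_in (subtopology (zariski n) Z) (Abstract_Topology.closure_of (zariski n) S)"
    and "closedin (subtopology (zariski n) Z) (Abstract_Topology.closure_of (zariski n) S)"
proof -
  let ?C = "Abstract_Topology.closure_of (zariski n) S"
  have S': "S \<subseteq> carrier_mat n n" "S \<noteq> {}" using S by (auto simp: poly_irreducible_def)
  have sub: "S \<subseteq> ?C" using S' by (simp add: closure_of_subset)
  have CZ: "?C \<subseteq> Z" using X by (simp add: closure_of_minimal)
  show 1: "closedin (subtopology (zariski n) Z) ?C"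
    using CZ X(1) by (simp add: closedin_closed_subtopology)
  show "irreducible_in (subtopology (zariski n) Z) ?C"
    unfolding irreducible_in_def
  proof (intro conjI allI impI)
    show "?C \<subseteq> topspace (subtopology (zariski n) Z)" using 1 closedin_subset by blast
    show "?C \<noteq> {}" using sub S' by blast
  next
    fix A B assume "closedin (subtopology (zariski n) Z) A \<and>
      closedin (subtopology (zariski n) Z) B \<and> ?C \<subseteq> A \<union> B"
    then have AB: "closedin (zariski n) A" "closedin (zariski n) B" "S \<subseteq> A \<union> B"
      using X(1) sub by (auto simp: closedin_closed_subtopology)
    from poly_irreducible_closed_cover[OF S this]
    show "?C \<subseteq> A \<or> ?C \<subseteq> B" using AB closure_of_minimal by blast
  qed
qed

text \<open>The closures of the \<open>S k\<close> form the chain. Zero sets are closed, so a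
  polynomial vanishing on \<open>S k\<close> also vanishes on its closure, which makes every
  inclusion strict.\<close>

lemma zariski_dim_ge_chain:
  assumes T: "T \<subseteq> carrier_mat n n"
    and S: "\<And>k. k \<le> N \<Longrightarrow> S k \<subseteq> T" "\<And>k. k \<le> N \<Longrightarrow> poly_irreducible n (S k)"
      "\<And>k. k < N \<Longrightarrow> S k \<subseteq> S (Suc k)"
    and P: "\<And>k. k < N \<Longrightarrow> \<exists>P\<in>poly_functions n. (\<forall>x\<in>S k. P x = 0) \<and> (\<exists>x\<in>S (Suc k). P x \<noteq> 0)"
  shows "zariski_dim n T \<ge> enat N"
proof -
  let ?cl = "\<lambda>S. Abstract_Topology.closure_of (zariski n) S"
  let ?Y = "subtopology (zariski n) (?cl T)"
  have "closedin ?Y (?cl (S k)) \<and> irreducible_in ?Y (?cl (S k))" if "k \<le> N" for k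
  proof -
    have "S k \<subseteq> ?cl T" using S(1)[OF that] T closure_of_subset[of T "zariski n"] by auto
    then show ?thesis using irreducible_in_closure[OF S(2)[OF that], of "?cl T"] by auto
  qed
  moreover have "?cl (S k) \<subset> ?cl (S (Suc k))" if k: "k < N" for k
  proof
    show "?cl (S k) \<subseteq> ?cl (S (Suc k))" using S(3)[OF k] by (rule closure_of_mono)
    obtain P x where Px: "P \<in> poly_functions n" "\<forall>x\<in>S k. P x = 0" "x \<in> S (Suc k)" "P x \<noteq> 0"
      using P[OF k] by blast
    have "S k \<subseteq> {A \<in> carrier_mat n n. P A = 0}"
      using Px(2) S(1)[of k] k T by auto
    then have "?cl (S k) \<subseteq> {A \<in> carrier_mat n n. P A = 0}"
      using closedin_zeros[OF Px(1)] by (simp add: closure_of_minimal)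
    then have "x \<notin> ?cl (S k)" using Px by auto
    moreover have "x \<in> ?cl (S (Suc k))"
      using Px(3) closure_of_subset[of "S (Suc k)" "zariski n"] S(1)[of "Suc k"] k T by auto
    ultimately show "?cl (S k) \<noteq> ?cl (S (Suc k))" by blast
  qed
  ultimately have "enat N \<in> {enat k | k. \<exists>Z :: nat \<Rightarrow> 'a mat set.
     (\<forall>i\<le>k. closedin ?Y (Z i) \<and> irreducible_in ?Y (Z i)) \<and> (\<forall>i<k. Z i \<subset> Z (Suc i))}"
    by (intro CollectI exI[of _ N] conjI exI[of _ "\<lambda>k. ?cl (S k)"]) auto
  then show ?thesis unfolding zariski_dim_def krull_dim_def by (rule Sup_upper)
qed

text \<open>Rational functions with denominator a power of \<open>d\<close>; nothing is said where \<open>d\<close> vanishes.\<close>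

definition rat_fun :: "'i set \<Rightarrow> (('i \<Rightarrow> 'a::Fields.field) \<Rightarrow> 'a) \<Rightarrow> (('i \<Rightarrow> 'a) \<Rightarrow> 'a) \<Rightarrow> bool" where
  "rat_fun I d f \<longleftrightarrow> (\<exists>D F. mpoly_fun I F \<and> (\<forall>p. d p \<noteq> 0 \<longrightarrow> f p * d p ^ D = F p))"

lemma rat_fun_poly: "mpoly_fun I f \<Longrightarrow> rat_fun I d f"
  unfolding rat_fun_def by (intro exI[of _ 0] exI[of _ f]) simp

lemma rat_fun_add:
  assumes "mpoly_fun I d" "rat_fun I d f" "rat_fun I d g"
  shows "rat_fun I d (\<lambda>p. f p + g p)"
proof -
  obtain D F where F: "mpoly_fun I F" "\<forall>p. d p \<noteq> 0 \<longrightarrow> f p * d p ^ D = F p"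
    using assms(2) unfolding rat_fun_def by blast
  obtain E G where G: "mpoly_fun I G" "\<forall>p. d p \<noteq> 0 \<longrightarrow> g p * d p ^ E = G p"
    using assms(3) unfolding rat_fun_def by blast
  have "mpoly_fun I (\<lambda>p. F p * d p ^ E + G p * d p ^ D)" using F G assms(1)
    by (intro mpoly_fun_add mpoly_fun_mult mpoly_fun_power)
  moreover have "\<forall>p. d p \<noteq> 0 \<longrightarrow> (f p + g p) * d p ^ (D + E) = F p * d p ^ E + G p * d p ^ D"
    using F G by (auto simp: algebra_simps power_add)
  ultimately show ?thesis unfolding rat_fun_def by blast
qed

lemma rat_fun_mult:
  assumes "rat_fun I d f" "rat_fun I d g"
  shows "rat_fun I d (\<lambda>p. f p * g p)"
proof -
  obtain D F where F: "mpoly_fun I F" "\<forall>p. d p \<noteq> 0 \<longrightarrow> f p * d p ^ D = F p"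
    using assms(1) unfolding rat_fun_def by blast
  obtain E G where G: "mpoly_fun I G" "\<forall>p. d p \<noteq> 0 \<longrightarrow> g p * d p ^ E = G p"
    using assms(2) unfolding rat_fun_def by blast
  have "mpoly_fun I (\<lambda>p. F p * G p)" using F G by blast
  moreover have "\<forall>p. d p \<noteq> 0 \<longrightarrow> (f p * g p) * d p ^ (D + E) = F p * G p"
    unfolding F(2)[rule_format, symmetric] by (simp add: F(2)[rule_format, symmetric] G(2)[rule_format, symmetric] power_add)
  ultimately show ?thesis unfolding rat_fun_def by blast
qed

lemma rat_fun_poly_function:
  assumes "P \<in> poly_functions n" "mpoly_fun I d"
    and "\<And>i j. i < n \<Longrightarrow> j < n \<Longrightarrow> rat_fun I d (\<lambda>p. W p $$ (i, j))"
  shows "rat_fun I d (\<lambda>p. P (W p))"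
  using assms(1)
  by induction (auto intro: rat_fun_poly rat_fun_add rat_fun_mult assms(2,3))

text \<open>The affine subspace through \<open>p0\<close> in the directions \<open>I\<close>,
  restricted to free coordinates in \<open>K\<close> and to the locus where \<open>d\<close> is
  nonzero. Freezing coordinates, instead of dropping them, keeps parameter spaces of different
  dimensions nested in one type.\<close>

definition grid :: "'i set \<Rightarrow> 'a set \<Rightarrow> ('i \<Rightarrow> 'a) \<Rightarrow> (('i \<Rightarrow> 'a::zero) \<Rightarrow> 'a) \<Rightarrow> ('i \<Rightarrow> 'a) set" where
  "grid I K p0 d = {p. (\<forall>i\<in>I. p i \<in> K) \<and> (\<forall>i. i \<notin> I \<longrightarrow> p i = p0 i) \<and> d p \<noteq> 0}"

text \<open>Denominators are cleared, and one numerator is multiplied by \<open>d\<close> so that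
  the common nonvanishing point stays in the domain.\<close>

lemma rat_fun_grid_nonzero:
  assumes "finite I" "infinite K" "mpoly_fun I d" "rat_fun I d f" "rat_fun I d g"
    and "p \<in> grid I K p0 d" "f p \<noteq> 0" "q \<in> grid I K p0 d" "g q \<noteq> 0"
  shows "\<exists>z\<in>grid I K p0 d. f z \<noteq> 0 \<and> g z \<noteq> 0"
proof -
  obtain D F where F: "mpoly_fun I F" "\<forall>p. d p \<noteq> 0 \<longrightarrow> f p * d p ^ D = F p"
    using assms(4) unfolding rat_fun_def by blast
  obtain E G where G: "mpoly_fun I G" "\<forall>p. d p \<noteq> 0 \<longrightarrow> g p * d p ^ E = G p"
    using assms(5) unfolding rat_fun_def by blast
  have dp: "d p \<noteq> 0" "d q \<noteq> 0" using assms by (auto simp: grid_def)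
  then have nz: "F p * d p \<noteq> 0" "G q \<noteq> 0"
    using F(2) G(2) assms(7,9) by (metis mult_eq_0_iff power_not_zero)+
  have "mpoly_fun I (\<lambda>p. F p * d p)" using F(1) assms(3) by blast
  moreover have "p i = q i" if "i \<notin> I" for i using assms(6,8) that by (simp add: grid_def)
  ultimately obtain z where z: "\<forall>i\<in>I. z i \<in> K" "\<forall>i. i \<notin> I \<longrightarrow> z i = p i" "F z * d z \<noteq> 0" "G z \<noteq> 0"
    using mpoly_fun_common_nonzero[of I K "\<lambda>p. F p * d p" G p q] assms(1,2) G(1) nz by blast
  have "d z \<noteq> 0" using z(3) by auto
  then have "f z \<noteq> 0" "g z \<noteq> 0" using F(2) G(2) z(3,4) by (metis mult_eq_0_iff)+
  moreover have "z \<in> grid I K p0 d" using z assms(6) \<open>d z \<noteq> 0\<close> by (simp add: grid_def)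
  ultimately show ?thesis by blast
qed

text \<open>Polynomials in the entries of \<open>W\<close> pull back to rational functions of the
  parameters, so irreducibility of the parameter space carries over to its image.\<close>

lemma poly_irreducible_image:
  assumes "finite I" "infinite K" "mpoly_fun I d" "grid I K p0 d \<noteq> {}"
    and W: "\<And>p. p \<in> grid I K p0 d \<Longrightarrow> W p \<in> carrier_mat n n"
      "\<And>i j. i < n \<Longrightarrow> j < n \<Longrightarrow> rat_fun I d (\<lambda>p. W p $$ (i, j))"
  shows "poly_irreducible n (W ` grid I K p0 d)"
  unfolding poly_irreducible_def
proof (intro conjI ballI impI)
  fix P Q :: "'b mat \<Rightarrow> 'b"
  assume "P \<in> poly_functions n" "Q \<in> poly_functions n"
    and ex: "\<exists>x\<in>W ` grid I K p0 d. P x \<noteq> 0" "\<exists>x\<in>W ` grid I K p0 d. Q x \<noteq> 0"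
  then have rat: "rat_fun I d (\<lambda>p. P (W p))" "rat_fun I d (\<lambda>p. Q (W p))"
    using rat_fun_poly_function assms(3) W(2) by blast+
  obtain p q where "p \<in> grid I K p0 d" "P (W p) \<noteq> 0" "q \<in> grid I K p0 d" "Q (W q) \<noteq> 0"
    using ex by blast
  from rat_fun_grid_nonzero[OF assms(1-3) rat this]
  show "\<exists>x\<in>W ` grid I K p0 d. P x \<noteq> 0 \<and> Q x \<noteq> 0" by blast
qed (use W assms(4) in auto)

text \<open>Coordinate 0 of a parameter point plays the role of s, and the later ones are the
  directions that vary. The functions \<open>Y j\<close> are the numerators of the matrix
  coordinates \<open>y j\<close> over the common denominator \<open>d\<close>; degree 2 l against
  degree l is what allows the k + 1 coordinates on the (k + 1)-st set to be independent.\<close>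

lemma zariski_dim_ge_leading_terms:
  fixes W :: "(nat \<Rightarrow> 'a::Fields.field) \<Rightarrow> 'a mat"
  assumes K: "infinite K" and l: "l > 0" and T: "T \<subseteq> carrier_mat n n"
    and d: "\<And>p. d p = p 0 ^ l * \<beta> p" "d p0 \<noteq> 0" "\<And>i. p0 i \<in> K"
    and W: "\<And>p. (\<And>i. p i \<in> K) \<Longrightarrow> d p \<noteq> 0 \<Longrightarrow> W p \<in> T"
      "\<And>i j. i < n \<Longrightarrow> j < n \<Longrightarrow> rat_fun UNIV d (\<lambda>p. W p $$ (i, j))"
    and y: "\<And>j. y j \<in> poly_functions n" "\<And>j. mpoly_fun UNIV (Y j)"
      "\<And>j p. d p \<noteq> 0 \<Longrightarrow> y j (W p) * d p = Y j p"
    and Y: "\<And>j p. j < N \<Longrightarrow>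
      has_lead (\<lambda>s. Y j (p(0 := s))) (2 * l) (\<kappa> p * (if j = 0 then c else p j))"
    and \<beta>: "mpoly_fun UNIV \<beta>" "\<And>p s. \<beta> (p(0 := s)) = \<beta> p"
    and \<kappa>: "mpoly_fun UNIV \<kappa>" "\<And>p s. \<kappa> (p(0 := s)) = \<kappa> p" "\<kappa> p0 \<noteq> 0"
    and c: "c \<noteq> 0"
  shows "zariski_dim n T \<ge> enat N"
proof -
  define \<Omega> where "\<Omega> k = grid {..<k} K p0 d" for k
  have infU: "infinite (UNIV :: 'a set)" using K finite_subset subset_UNIV by blast
  have dpoly: "mpoly_fun UNIV d" unfolding d(1)[abs_def]
    by (intro mpoly_fun_mult mpoly_fun_power mpoly_fun_var \<beta>(1))
  have \<Omega>K: "p i \<in> K" if "p \<in> \<Omega> k" for p k i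
    using that d(3) unfolding \<Omega>_def grid_def by (cases "i < k") auto
  have \<Omega>d: "d p \<noteq> 0" if "p \<in> \<Omega> k" for p k using that unfolding \<Omega>_def grid_def by auto
  have p0: "p0 \<in> \<Omega> k" for k using d unfolding \<Omega>_def grid_def by auto
  have rat: "rat_fun I d (\<lambda>p. W p $$ (i, j))" if "i < n" "j < n" for i j I
    using W(2)[OF that] mpoly_fun_subset[OF _ subset_UNIV] unfolding rat_fun_def by blast
  show ?thesis
  proof (rule zariski_dim_ge_chain[where S = "\<lambda>k. W ` \<Omega> k"])
    show "W ` \<Omega> k \<subseteq> T" for k using W(1) \<Omega>K \<Omega>d by blast
    then show "poly_irreducible n (W ` \<Omega> k)" for k
      unfolding \<Omega>_def using T p0[of k] rat mpoly_fun_subset[OF dpoly]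
      by (intro poly_irreducible_image K) (auto simp: \<Omega>_def)
    have "\<Omega> k \<subseteq> \<Omega> (Suc k)" for k unfolding \<Omega>_def grid_def using d(3) by auto
    then show "W ` \<Omega> k \<subseteq> W ` \<Omega> (Suc k)" for k by blast
  next
    fix k assume k: "k < N"
    \<comment> \<open>There are k + 1 functions, with indices 0 to \<open>k\<close>, but only the
      \<open>k\<close> parameters below \<open>k\<close> are free. For \<open>k = 0\<close> the
      slice is a single point.\<close>
    have "\<exists>M q. (\<exists>\<mu>\<in>PiE {..k} (\<lambda>_. {..M}). q \<mu> \<noteq> 0) \<and>
      (\<forall>p. (\<forall>i. i \<notin> {..<k} \<longrightarrow> p i = p0 i) \<longrightarrow>
      (\<Sum>\<mu>\<in>PiE {..k} (\<lambda>_. {..M}). q \<mu> * (\<Prod>j\<le>k. Y j p ^ \<mu> j * d p ^ (M - \<mu> j))) = 0)"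
      by (rule algebraic_dependence)
        (use infU mpoly_fun_subset[OF dpoly] mpoly_fun_subset[OF y(2)] in auto)
    then obtain M q \<mu>0 where \<mu>0: "\<mu>0 \<in> PiE {..k} (\<lambda>_. {..M})" "q \<mu>0 \<noteq> 0" and
      q0: "\<And>p. (\<forall>i. i \<notin> {..<k} \<longrightarrow> p i = p0 i) \<Longrightarrow>
      (\<Sum>\<mu>\<in>PiE {..k} (\<lambda>_. {..M}). q \<mu> * (\<Prod>j\<le>k. Y j p ^ \<mu> j * d p ^ (M - \<mu> j))) = 0"
      by blast
    define V where "V = PiE {..k} (\<lambda>_. {..M})"
    define P where "P A = (\<Sum>\<mu>\<in>V. q \<mu> * (\<Prod>j\<le>k. y j A ^ \<mu> j))" for A
    have Ppoly: "P \<in> poly_functions n" unfolding P_def[abs_def]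
      by (intro poly_functions_sum poly_functions.mult poly_functions.const poly_functions_prod
          poly_functions_power y(1))
    \<comment> \<open>Multiplication by a power of \<open>d\<close> turns the relation among the
      \<open>y j\<close> into the homogenised relation among the \<open>Y j\<close> and
      \<open>d\<close>; where \<open>d\<close> is nonzero, both vanish together.\<close>
    have PW: "P (W p) * d p ^ (M * Suc k) =
      (\<Sum>\<mu>\<in>V. q \<mu> * (\<Prod>j\<le>k. Y j p ^ \<mu> j * d p ^ (M - \<mu> j)))" if dp: "d p \<noteq> 0" for p
    proof -
      have "(\<Prod>j\<le>k. y j (W p) ^ \<mu> j) * d p ^ (M * Suc k) =
        (\<Prod>j\<le>k. Y j p ^ \<mu> j * d p ^ (M - \<mu> j))" if "\<mu> \<in> V" for \<mu>
      proof -
        have "(\<Prod>j\<le>k. Y j p ^ \<mu> j * d p ^ (M - \<mu> j)) = (\<Prod>j\<le>k. y j (W p) ^ \<mu> j * d p ^ M)"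
        proof (rule prod.cong[OF refl])
          fix j assume "j \<in> {..k}"
          then have "\<mu> j \<le> M" using that unfolding V_def by auto
          then show "Y j p ^ \<mu> j * d p ^ (M - \<mu> j) = y j (W p) ^ \<mu> j * d p ^ M"
            unfolding y(3)[OF dp, symmetric] power_mult_distrib
            by (simp add: mult.assoc power_add[symmetric])
        qed
        then show ?thesis by (simp only: prod.distrib prod_constant card_atMost power_mult)
      qed
      then show ?thesis unfolding P_def by (simp add: sum_distrib_right mult.assoc)
    qed
    have "P (W p) = 0" if "p \<in> \<Omega> k" for p
    proof -
      have "\<forall>i. i \<notin> {..<k} \<longrightarrow> p i = p0 i" using that unfolding \<Omega>_def grid_def by auto
      then show ?thesis using q0 PW[OF \<Omega>d[OF that]] \<Omega>d[OF that] unfolding V_def by simp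
    qed
    \<comment> \<open>Once coordinate \<open>k\<close> is released the relation must fail, because
      the leading coefficients have become independent. For \<open>k = 0\<close> the released
      coordinate is s itself.\<close>
    moreover have "\<exists>p\<in>\<Omega> (Suc k). P (W p) \<noteq> 0"
    proof -
      have "\<beta> p0 \<noteq> 0" using d by auto
      have "\<exists>p. (\<forall>i\<le>k. p i \<in> K) \<and> (\<forall>i>k. p i = p0 i) \<and> d p \<noteq> 0 \<and>
        (\<Sum>\<mu>\<in>PiE {..k} (\<lambda>_. {..M}). q \<mu> * (\<Prod>j\<le>k. Y j p ^ \<mu> j * d p ^ (M - \<mu> j))) \<noteq> 0"
      proof (rule leading_terms_independent[where l = l and \<beta> = \<beta> and \<kappa> = \<kappa> and c = c])
        show "has_lead (\<lambda>s. Y j (p(0 := s))) (2 * l) (\<kappa> p * (if j = 0 then c else p j))" if "j \<le> k" for j p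
          using Y k that by simp
      qed (fact K l d(1) \<beta>(2) \<kappa>(2,3) c \<mu>0 \<open>\<beta> p0 \<noteq> 0\<close>
          mpoly_fun_subset[OF \<beta>(1) subset_UNIV] mpoly_fun_subset[OF \<kappa>(1) subset_UNIV])+
      then obtain p where p: "\<forall>i\<le>k. p i \<in> K" "\<forall>i>k. p i = p0 i" "d p \<noteq> 0"
        "(\<Sum>\<mu>\<in>PiE {..k} (\<lambda>_. {..M}). q \<mu> * (\<Prod>j\<le>k. Y j p ^ \<mu> j * d p ^ (M - \<mu> j))) \<noteq> 0"
        by blast
      then have "P (W p) \<noteq> 0" using PW[OF p(3)] unfolding V_def by auto
      moreover have "p \<in> \<Omega> (Suc k)" using p unfolding \<Omega>_def grid_def by auto
      ultimately show ?thesis by blast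
    qed
    ultimately show "\<exists>P\<in>poly_functions n. (\<forall>x\<in>W ` \<Omega> k. P x = 0) \<and> (\<exists>x\<in>W ` \<Omega> (Suc k). P x \<noteq> 0)"
      using Ppoly by blast
  qed (rule T)
qed

section \<open>The symplectic form\<close>

text \<open>The form of the matrix \<open>symplectic_form m\<close>, written as an explicit sum so
  that bilinearity and polynomial dependence on coordinates are immediate.\<close>

definition sform :: "nat \<Rightarrow> 'a::Fields.field Matrix.vec \<Rightarrow> 'a Matrix.vec \<Rightarrow> 'a" where
  "sform m x y = (\<Sum>i<m. x $ i * y $ (m + i) - x $ (m + i) * y $ i)"

lemma sform_add_left:
  "x \<in> carrier_vec (2 * m) \<Longrightarrow> y \<in> carrier_vec (2 * m) \<Longrightarrow>
    sform m (x + y) z = sform m x z + sform m y z"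
  unfolding sform_def sum.distrib[symmetric] by (intro sum.cong) (auto simp: algebra_simps)

lemma sform_smult_left:
  "x \<in> carrier_vec (2 * m) \<Longrightarrow> sform m (c \<cdot>\<^sub>v x) z = c * sform m x z"
  unfolding sform_def sum_distrib_left by (intro sum.cong) (auto simp: algebra_simps)

lemma sform_swap: "sform m x y = - sform m y x"
  unfolding sform_def sum_negf[symmetric] by (intro sum.cong) (auto simp: algebra_simps)

lemma sform_self [simp]: "sform m x x = 0"
  unfolding sform_def by (simp add: mult.commute)

lemma sform_add_right:
  "x \<in> carrier_vec (2 * m) \<Longrightarrow> y \<in> carrier_vec (2 * m) \<Longrightarrow>
    sform m z (x + y) = sform m z x + sform m z y"
  by (subst (1 2 3) sform_swap) (simp add: sform_add_left)

lemma sform_smult_right: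
  "x \<in> carrier_vec (2 * m) \<Longrightarrow> sform m z (c \<cdot>\<^sub>v x) = c * sform m z x"
  by (subst (1 2) sform_swap) (simp add: sform_smult_left)

lemma sform_unit_low: "i < m \<Longrightarrow> sform m x (unit_vec (2 * m) i) = - x $ (m + i)"
proof -
  assume i: "i < m"
  have "sform m x (unit_vec (2 * m) i) = (\<Sum>j<m. if j = i then - x $ (m + i) else 0)"
    unfolding sform_def using i by (intro sum.cong) auto
  then show ?thesis using i by simp
qed

lemma sform_unit_high: "i < m \<Longrightarrow> sform m x (unit_vec (2 * m) (m + i)) = x $ i"
proof -
  assume i: "i < m"
  have "sform m x (unit_vec (2 * m) (m + i)) = (\<Sum>j<m. if j = i then x $ i else 0)"
    unfolding sform_def using i by (intro sum.cong) auto
  then show ?thesis using i by simp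
qed

text \<open>Pairing with the partner basis vector picks out any nonzero coordinate, up to
  sign.\<close>

lemma sform_nondegenerate:
  assumes "x \<in> carrier_vec (2 * m)" "x \<noteq> 0\<^sub>v (2 * m)"
  shows "\<exists>y\<in>carrier_vec (2 * m). sform m x y \<noteq> 0"
proof -
  obtain i where i: "i < 2 * m" "x $ i \<noteq> 0"
    using assms by (metis carrier_vecD eq_vecI index_zero_vec)
  show ?thesis
  proof (cases "i < m")
    case True
    then show ?thesis using sform_unit_high[of i m x] i by (intro bexI[of _ "unit_vec (2 * m) (m + i)"]) auto
  next
    case False
    then show ?thesis using sform_unit_low[of "i - m" m x] i by (intro bexI[of _ "unit_vec (2 * m) (i - m)"]) auto
  qed
qed

lemma symplectic_form_carrier [simp]: "symplectic_form m \<in> carrier_mat (2 * m) (2 * m)"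
  unfolding symplectic_form_def mult_2 by (intro four_block_carrier_mat) auto

lemma symplectic_form_dim [simp]:
  "dim_row (symplectic_form m) = 2 * m" "dim_col (symplectic_form m) = 2 * m"
  using symplectic_form_carrier by blast+

lemma symplectic_form_index:
  "i < 2 * m \<Longrightarrow> j < 2 * m \<Longrightarrow> symplectic_form m $$ (i, j) =
    (if i < m then if j = m + i then 1 else 0 else if i = m + j then -1 else 0)"
  unfolding symplectic_form_def by (subst index_mat_four_block) auto

lemma symplectic_form_mult_vec:
  fixes y :: "'a::Fields.field Matrix.vec"
  assumes y: "y \<in> carrier_vec (2 * m)" and i: "i < 2 * m"
  shows "(symplectic_form m *\<^sub>v y) $ i = (if i < m then y $ (m + i) else - y $ (i - m))"
proof -
  have "(symplectic_form m *\<^sub>v y) $ i = (\<Sum>j<2 * m. symplectic_form m $$ (i, j) * y $ j)"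
    using y i by (auto simp: scalar_prod_def lessThan_atLeast0 intro!: sum.cong)
  also have "\<dots> = (\<Sum>j<2 * m. if j = (if i < m then m + i else i - m)
      then (if i < m then y $ (m + i) else - y $ (i - m)) else 0)"
    using i by (intro sum.cong refl) (auto simp: symplectic_form_index)
  also have "\<dots> = (if i < m then y $ (m + i) else - y $ (i - m))"
    using i by (subst sum.delta) auto
  finally show ?thesis .
qed

lemma sum_double: "(\<Sum>i = 0..<2 * m. f i) = (\<Sum>i<m. f i) + (\<Sum>i<m. f (m + i))" for m :: nat
  using sum.atLeastLessThan_concat[of 0 m "m + m" f] sum.shift_bounds_nat_ivl[of f 0 m m]
  by (simp add: mult_2 lessThan_atLeast0 add.commute)

lemma sform_eq_scalar_prod:
  fixes x y :: "'a::Fields.field Matrix.vec"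
  assumes "x \<in> carrier_vec (2 * m)" "y \<in> carrier_vec (2 * m)"
  shows "sform m x y = scalar_prod x (symplectic_form m *\<^sub>v y)"
proof -
  have "scalar_prod x (symplectic_form m *\<^sub>v y) =
    (\<Sum>i<m. x $ i * (symplectic_form m *\<^sub>v y) $ i) + (\<Sum>i<m. x $ (m + i) * (symplectic_form m *\<^sub>v y) $ (m + i))"
    by (simp add: scalar_prod_def sum_double del: index_mult_mat_vec)
  also have "\<dots> = (\<Sum>i<m. x $ i * y $ (m + i)) + (\<Sum>i<m. x $ (m + i) * - y $ i)"
    using assms by (intro arg_cong2[of _ _ _ _ "(+)"] sum.cong) (auto simp: symplectic_form_mult_vec simp del: index_mult_mat_vec)
  also have "\<dots> = sform m x y" unfolding sform_def by (simp add: sum_subtractf sum_negf)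
  finally show ?thesis by simp
qed

section \<open>The row action and symplectic matrices\<close>

lemma row_act_carrier [simp]: "A \<in> carrier_mat k n \<Longrightarrow> row_act v A \<in> carrier_vec n"
  unfolding row_act_def by (metis carrier_matD(2) carrier_vec_dim_vec dim_mult_mat_vec index_transpose_mat(2))

lemma row_act_index:
  "A \<in> carrier_mat k n \<Longrightarrow> v \<in> carrier_vec k \<Longrightarrow> j < n \<Longrightarrow> row_act v A $ j = (\<Sum>i<k. v $ i * A $$ (i, j))"
  unfolding row_act_def
  by (auto simp: scalar_prod_def lessThan_atLeast0 mult.commute intro!: sum.cong)

lemma row_act_mult:
  assumes "A \<in> carrier_mat k n" "B \<in> carrier_mat n l" "v \<in> carrier_vec k"
  shows "row_act v (A * B) = row_act (row_act v A) B"
  unfolding row_act_def using assms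
  by (simp add: transpose_mult assoc_mult_mat_vec[of _ l n _ k])

lemma row_act_one [simp]: "v \<in> carrier_vec n \<Longrightarrow> row_act v (1\<^sub>m n) = v"
  unfolding row_act_def by simp

lemma row_act_smult_mat:
  "A \<in> carrier_mat k n \<Longrightarrow> v \<in> carrier_vec k \<Longrightarrow> row_act v (c \<cdot>\<^sub>m A) = c \<cdot>\<^sub>v row_act v A"
  by (intro eq_vecI) (auto simp: row_act_index[of _ k n] sum_distrib_left row_act_def[of _ "c \<cdot>\<^sub>m A"] mult.left_commute
      scalar_prod_def lessThan_atLeast0 mult.commute row_act_def intro!: sum.cong)

lemma row_act_smult:
  "A \<in> carrier_mat k n \<Longrightarrow> v \<in> carrier_vec k \<Longrightarrow> row_act (c \<cdot>\<^sub>v v) A = c \<cdot>\<^sub>v row_act v A"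
  unfolding row_act_def by (simp add: mult_mat_vec[of _ n k])

lemma row_act_add:
  "A \<in> carrier_mat k n \<Longrightarrow> v \<in> carrier_vec k \<Longrightarrow> w \<in> carrier_vec k \<Longrightarrow>
    row_act (v + w) A = row_act v A + row_act w A"
  unfolding row_act_def by (simp add: mult_add_distrib_mat_vec[of _ n k])

lemma row_act_unit:
  "A \<in> carrier_mat k n \<Longrightarrow> i < k \<Longrightarrow> row_act (unit_vec k i) A = Matrix.row A i"
  unfolding row_act_def by (intro eq_vecI) auto

lemma mat_eq_row_act:
  assumes "A \<in> carrier_mat k n" "B \<in> carrier_mat k n"
    and "\<And>v. v \<in> carrier_vec k \<Longrightarrow> row_act v A = row_act v B"
  shows "A = B"
proof (rule eq_matI)
  fix i j assume ij: "i < dim_row B" "j < dim_col B"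
  have "Matrix.row A i = Matrix.row B i"
    using assms ij row_act_unit[of A k n i] row_act_unit[of B k n i] by auto
  then show "A $$ (i, j) = B $$ (i, j)" using assms ij by (metis carrier_matD index_row(1))
qed (use assms in auto)

lemma transpose_scalar_prod:
  fixes A :: "'a::Fields.field mat"
  assumes "A \<in> carrier_mat k n" "x \<in> carrier_vec k" "y \<in> carrier_vec n"
  shows "scalar_prod (row_act x A) y = scalar_prod x (A *\<^sub>v y)"
  unfolding row_act_def using transpose_vec_mult_scalar[OF assms(1,3,2)] by simp

lemma sform_row_act:
  fixes A :: "'a::Fields.field mat"
  assumes "A \<in> carrier_mat (2 * m) (2 * m)" "x \<in> carrier_vec (2 * m)" "y \<in> carrier_vec (2 * m)"
  shows "sform m (row_act x A) (row_act y A) =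
    scalar_prod x ((A * symplectic_form m * transpose_mat A) *\<^sub>v y)"
proof -
  let ?J = "symplectic_form m :: 'a mat" and ?n = "2 * m"
  have [simp]: "?J \<in> carrier_mat ?n ?n" "transpose_mat A \<in> carrier_mat ?n ?n" using assms by auto
  have "sform m (row_act x A) (row_act y A) = scalar_prod (row_act x A) (?J *\<^sub>v (transpose_mat A *\<^sub>v y))"
    using assms row_act_carrier[OF assms(1)] by (subst sform_eq_scalar_prod) (simp_all add: row_act_def)
  also have "\<dots> = scalar_prod x (A *\<^sub>v (?J *\<^sub>v (transpose_mat A *\<^sub>v y)))"
    using assms mult_mat_vec_carrier[of ?J ?n ?n "transpose_mat A *\<^sub>v y"]
    by (intro transpose_scalar_prod[of A ?n ?n]) simp_all
  also have "A *\<^sub>v (?J *\<^sub>v (transpose_mat A *\<^sub>v y)) = (A * ?J * transpose_mat A) *\<^sub>v y"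
    using assms by (simp add: assoc_mult_mat_vec[of _ ?n ?n _ ?n])
  finally show ?thesis .
qed

text \<open>Evaluation at pairs of unit vectors reads off the entries of the defining matrix
  equation. Invariance is the form in which membership is checked for hyperbolic and diagonal
  elements.\<close>

lemma Sp_iff_preserves:
  fixes A :: "'a::Fields.field mat"
  shows "A \<in> Sp m F \<longleftrightarrow> A \<in> carrier_mat (2 * m) (2 * m) \<and> elements_mat A \<subseteq> F \<and>
    (\<forall>x\<in>carrier_vec (2 * m). \<forall>y\<in>carrier_vec (2 * m). sform m (row_act x A) (row_act y A) = sform m x y)"
proof -
  let ?J = "symplectic_form m :: 'a mat" and ?n = "2 * m"
  have "A * ?J * transpose_mat A = ?J" if A: "A \<in> carrier_mat ?n ?n" and
    pres: "\<forall>x\<in>carrier_vec ?n. \<forall>y\<in>carrier_vec ?n. sform m (row_act x A) (row_act y A) = sform m x y"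
  proof (rule eq_matI)
    let ?M = "A * ?J * transpose_mat A"
    have M: "?M \<in> carrier_mat ?n ?n" using A by (intro mult_carrier_mat) auto
    have J: "?J \<in> carrier_mat ?n ?n" by simp
    fix i j assume "i < dim_row (symplectic_form m :: 'a mat)" "j < dim_col (symplectic_form m :: 'a mat)"
    then have ij: "i < ?n" "j < ?n" using J by auto
    let ?e = "unit_vec ?n :: nat \<Rightarrow> 'a Matrix.vec"
    have *: "scalar_prod (?e i) (B *\<^sub>v ?e j) = B $$ (i, j)" if "B \<in> carrier_mat ?n ?n" for B
      using that ij by simp
    have "scalar_prod (?e i) (?M *\<^sub>v ?e j) = scalar_prod (?e i) (?J *\<^sub>v ?e j)"
      using pres sform_row_act[OF A, of "?e i" "?e j"] sform_eq_scalar_prod[of "?e i" m "?e j"] by simp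
    then show "?M $$ (i, j) = ?J $$ (i, j)" unfolding *[OF M] *[OF J] .
  qed (use A in simp_all)
  then show ?thesis unfolding Sp_def
    using sform_row_act[of A m] sform_eq_scalar_prod[of "_ :: 'a Matrix.vec" m] by auto
qed

section \<open>The group of invertible matrices\<close>

lemma GL_simps:
  "carrier (GL n) = {A \<in> carrier_mat n n. \<exists>B\<in>carrier_mat n n. B * A = 1\<^sub>m n \<and> A * B = 1\<^sub>m n}"
  "A \<otimes>\<^bsub>GL n\<^esub> B = A * B" "\<one>\<^bsub>GL n\<^esub> = 1\<^sub>m n"
  unfolding GL_def units_of_def Units_def by (auto simp: ring_mat_simps)

lemma group_GL: "group (GL n :: 'a::Fields.field mat monoid)"
proof -
  interpret ring "ring_mat TYPE('a) n ()" by (rule ring_mat)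
  show ?thesis unfolding GL_def by (rule units_group)
qed

lemma GL_carrier_mat: "A \<in> carrier (GL n) \<Longrightarrow> A \<in> carrier_mat n n"
  by (simp add: GL_simps)

lemma GL_inv:
  assumes "A \<in> carrier (GL n)"
  shows "inv\<^bsub>GL n\<^esub> A \<in> carrier (GL n)" "inv\<^bsub>GL n\<^esub> A \<in> carrier_mat n n"
    "A * inv\<^bsub>GL n\<^esub> A = 1\<^sub>m n" "inv\<^bsub>GL n\<^esub> A * A = 1\<^sub>m n"
proof -
  interpret group "GL n :: 'a mat monoid" by (rule group_GL)
  show "inv\<^bsub>GL n\<^esub> A \<in> carrier (GL n)" using assms by simp
  then show "inv\<^bsub>GL n\<^esub> A \<in> carrier_mat n n" by (rule GL_carrier_mat)
  show "A * inv\<^bsub>GL n\<^esub> A = 1\<^sub>m n" "inv\<^bsub>GL n\<^esub> A * A = 1\<^sub>m n"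
    using r_inv[OF assms] l_inv[OF assms] by (simp_all add: GL_simps)
qed

lemma GL_I:
  assumes "A \<in> carrier_mat n n" "B \<in> carrier_mat n n" "A * B = 1\<^sub>m n"
  shows "A \<in> carrier (GL n :: 'a::Fields.field mat monoid)" "inv\<^bsub>GL n\<^esub> A = (B :: 'a mat)"
proof -
  interpret group "GL n :: 'a mat monoid" by (rule group_GL)
  have BA: "B * A = 1\<^sub>m n" using mat_mult_left_right_inverse[OF assms] .
  show A: "A \<in> carrier (GL n)" using assms BA by (auto simp: GL_simps)
  have "B \<in> carrier (GL n)" using assms BA by (auto simp: GL_simps)
  then show "inv\<^bsub>GL n\<^esub> A = B" using A BA by (intro inv_equality) (simp_all add: GL_simps)
qed

lemma row_act_GL_nonzero:
  assumes "A \<in> carrier (GL n)" "v \<in> carrier_vec n" "v \<noteq> 0\<^sub>v n"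
  shows "row_act v A \<noteq> 0\<^sub>v n"
proof
  assume 0: "row_act v A = 0\<^sub>v n"
  have "v = row_act (row_act v A) (inv\<^bsub>GL n\<^esub> A)"
    using assms GL_inv[OF assms(1)] GL_carrier_mat[OF assms(1)] row_act_mult[of A n n "inv\<^bsub>GL n\<^esub> A" n v]
    by simp
  also have "\<dots> = 0\<^sub>v n"
    unfolding 0 using row_act_smult[OF GL_inv(2)[OF assms(1)], of "0\<^sub>v n" 0]
      GL_inv(2)[OF assms(1)] by (intro eq_vecI) (auto simp: row_act_index[of _ n n] row_act_def[of _ "inv\<^bsub>GL n\<^esub> A"] scalar_prod_def)
  finally show False using assms by simp
qed

text \<open>With \<beta> = B(a, b), this is s \<beta> times the map sending x to x + ((s -
  1)/\<beta>) B(x, b) a + ((s - 1)/(s \<beta>)) B(x, a) b. As B(b, a) = -\<beta>, that map sends b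
  to b - ((s - 1)/s) b = b/s. Clearing the denominator makes the entries polynomial in s, a and
  b.\<close>

definition hyp_num :: "nat \<Rightarrow> 'a::Fields.field Matrix.vec \<Rightarrow> 'a Matrix.vec \<Rightarrow> 'a \<Rightarrow> 'a mat" where
  "hyp_num m a b s = Matrix.mat (2 * m) (2 * m) (\<lambda>(i, j).
     s * sform m a b * (if i = j then 1 else 0)
     + s * (s - 1) * (symplectic_form m *\<^sub>v b) $ i * a $ j
     + (s - 1) * (symplectic_form m *\<^sub>v a) $ i * b $ j)"

text \<open>For a hyperbolic pair \<open>a, b\<close> this is the element of the symplectic group which scales \<open>a\<close>
  by \<open>s\<close> and \<open>b\<close> by \<open>1/s\<close> and fixes the orthogonal complement of both.\<close>

definition hyp :: "nat \<Rightarrow> 'a::Fields.field Matrix.vec \<Rightarrow> 'a Matrix.vec \<Rightarrow> 'a \<Rightarrow> 'a mat" where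
  "hyp m a b s = inverse (s * sform m a b) \<cdot>\<^sub>m hyp_num m a b s"

lemma hyp_num_carrier [simp]: "hyp_num m a b s \<in> carrier_mat (2 * m) (2 * m)"
  unfolding hyp_num_def by simp

lemma hyp_carrier [simp]: "hyp m a b s \<in> carrier_mat (2 * m) (2 * m)"
  unfolding hyp_def by simp

lemma row_act_hyp_num:
  fixes a b x :: "'a::Fields.field Matrix.vec"
  assumes "a \<in> carrier_vec (2 * m)" "b \<in> carrier_vec (2 * m)" "x \<in> carrier_vec (2 * m)"
  shows "row_act x (hyp_num m a b s) =
    (s * sform m a b) \<cdot>\<^sub>v x + ((s * (s - 1) * sform m x b) \<cdot>\<^sub>v a + ((s - 1) * sform m x a) \<cdot>\<^sub>v b)"
proof (rule eq_vecI)
  let ?n = "2 * m"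
  fix j assume "j < dim_vec ((s * sform m a b) \<cdot>\<^sub>v x + ((s * (s - 1) * sform m x b) \<cdot>\<^sub>v a + ((s - 1) * sform m x a) \<cdot>\<^sub>v b))"
  then have j: "j < ?n" using assms by simp
  have sp: "(\<Sum>i<?n. x $ i * (symplectic_form m *\<^sub>v y) $ i) = sform m x y" if "y \<in> carrier_vec ?n" for y
    using sform_eq_scalar_prod[OF assms(3) that]
    by (simp add: scalar_prod_def lessThan_atLeast0 del: index_mult_mat_vec)
  have "row_act x (hyp_num m a b s) $ j = (\<Sum>i<?n. x $ i * (s * sform m a b * (if i = j then 1 else 0)
     + s * (s - 1) * (symplectic_form m *\<^sub>v b) $ i * a $ j
     + (s - 1) * (symplectic_form m *\<^sub>v a) $ i * b $ j))"
    using j assms by (simp add: row_act_index[of _ ?n ?n] hyp_num_def del: index_mult_mat_vec)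
  also have "\<dots> = (\<Sum>i<?n. (if i = j then s * sform m a b * x $ j else 0)
      + s * (s - 1) * a $ j * (x $ i * (symplectic_form m *\<^sub>v b) $ i)
      + (s - 1) * b $ j * (x $ i * (symplectic_form m *\<^sub>v a) $ i))"
    by (intro sum.cong refl) (simp add: algebra_simps del: index_mult_mat_vec)
  also have "\<dots> = s * sform m a b * x $ j + s * (s - 1) * a $ j * sform m x b + (s - 1) * b $ j * sform m x a"
    using j by (simp only: sum.distrib sum_distrib_left[symmetric] sp assms) simp
  also have "\<dots> = ((s * sform m a b) \<cdot>\<^sub>v x + ((s * (s - 1) * sform m x b) \<cdot>\<^sub>v a + ((s - 1) * sform m x a) \<cdot>\<^sub>v b)) $ j"
    using j assms by simp
  finally show "row_act x (hyp_num m a b s) $ j = \<dots>" .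
qed (use assms carrier_matD[OF hyp_num_carrier[of m a b s]] in \<open>simp add: row_act_def\<close>)

text \<open>Expanding by bilinearity, the contributions along a and b cancel. The result is a
  similitude identity valid without any nonvanishing condition, so the division is postponed to
  \<open>hyp_Sp\<close>.\<close>

lemma sform_hyp_num:
  fixes a b x y :: "'a::Fields.field Matrix.vec"
  assumes "a \<in> carrier_vec (2 * m)" "b \<in> carrier_vec (2 * m)" "x \<in> carrier_vec (2 * m)" "y \<in> carrier_vec (2 * m)"
  shows "sform m (row_act x (hyp_num m a b s)) (row_act y (hyp_num m a b s)) = (s * sform m a b)\<^sup>2 * sform m x y"
  unfolding row_act_hyp_num[OF assms(1,2,3)] row_act_hyp_num[OF assms(1,2,4)]
  using assms
  by (simp add: sform_add_left sform_add_right sform_smult_left sform_smult_right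
      sform_swap[of m b a] sform_swap[of m a y] sform_swap[of m b y])
    (simp add: algebra_simps power2_eq_square)

text \<open>Exchanging a and b exchanges the eigenvalues s and 1/s, hence inverts the map. The
  scalar is minus the square of s B(a, b).\<close>

lemma hyp_num_mult_swap:
  fixes a b :: "'a::Fields.field Matrix.vec"
  assumes a: "a \<in> carrier_vec (2 * m)" and b: "b \<in> carrier_vec (2 * m)"
  shows "hyp_num m a b s * hyp_num m b a s = ((s * sform m a b) * (s * sform m b a)) \<cdot>\<^sub>m 1\<^sub>m (2 * m)"
proof (rule mat_eq_row_act[where n = "2 * m"])
  fix x :: "'a Matrix.vec" assume x: "x \<in> carrier_vec (2 * m)"
  let ?z = "(s * sform m a b) \<cdot>\<^sub>v x + ((s * (s - 1) * sform m x b) \<cdot>\<^sub>v a + ((s - 1) * sform m x a) \<cdot>\<^sub>v b)"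
  have z: "?z \<in> carrier_vec (2 * m)" using a b x by simp
  have "row_act x (hyp_num m a b s * hyp_num m b a s) = row_act ?z (hyp_num m b a s)"
    using row_act_mult[OF hyp_num_carrier hyp_num_carrier x] row_act_hyp_num[OF a b x] by simp
  also have "\<dots> = (s * sform m b a) \<cdot>\<^sub>v ?z + ((s * (s - 1) * sform m ?z a) \<cdot>\<^sub>v b + ((s - 1) * sform m ?z b) \<cdot>\<^sub>v a)"
    by (rule row_act_hyp_num[OF b a z])
  also have "\<dots> = ((s * sform m a b) * (s * sform m b a)) \<cdot>\<^sub>v x"
    using a b x
    by (intro eq_vecI) (simp_all add: sform_add_left sform_smult_left sform_swap[of m b a] algebra_simps)
  finally show "row_act x (hyp_num m a b s * hyp_num m b a s) =
    row_act x (((s * sform m a b) * (s * sform m b a)) \<cdot>\<^sub>m 1\<^sub>m (2 * m))"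
    using x by (simp add: row_act_smult_mat[of _ "2 * m" "2 * m"])
qed (simp_all add: mult_carrier_mat[OF hyp_num_carrier hyp_num_carrier])

lemma smult_smult_mat: "(c :: 'a::Fields.field) \<cdot>\<^sub>m (d \<cdot>\<^sub>m A) = (c * d) \<cdot>\<^sub>m A"
  by (intro eq_matI) (auto simp: mult.assoc)

lemma hyp_mult_swap:
  fixes a b :: "'a::Fields.field Matrix.vec"
  assumes "a \<in> carrier_vec (2 * m)" "b \<in> carrier_vec (2 * m)" "sform m a b \<noteq> 0" "s \<noteq> 0"
  shows "hyp m a b s * hyp m b a s = 1\<^sub>m (2 * m)"
proof -
  have nz: "s * sform m a b \<noteq> 0" "s * sform m b a \<noteq> 0" using assms sform_swap[of m a b] by auto
  have "hyp m a b s * hyp m b a s =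
    (inverse (s * sform m a b) * inverse (s * sform m b a)) \<cdot>\<^sub>m (hyp_num m a b s * hyp_num m b a s)"
    unfolding hyp_def
    by (simp only: mult_smult_distrib[OF smult_carrier_mat[OF hyp_num_carrier] hyp_num_carrier]
       mult_smult_assoc_mat[OF hyp_num_carrier hyp_num_carrier] smult_smult_mat mult.commute)
  also have "\<dots> = (inverse (s * sform m a b) * inverse (s * sform m b a) * ((s * sform m a b) * (s * sform m b a))) \<cdot>\<^sub>m 1\<^sub>m (2 * m)"
    unfolding hyp_num_mult_swap[OF assms(1,2)] by (simp only: smult_smult_mat)
  also have "inverse (s * sform m a b) * inverse (s * sform m b a) * ((s * sform m a b) * (s * sform m b a)) = 1"
    using nz by (simp add: field_simps)
  finally show ?thesis by (auto intro!: eq_matI)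
qed

lemma hyp_GL:
  fixes a b :: "'a::Fields.field Matrix.vec"
  assumes "a \<in> carrier_vec (2 * m)" "b \<in> carrier_vec (2 * m)" "sform m a b \<noteq> 0" "s \<noteq> 0"
  shows "hyp m a b s \<in> carrier (GL (2 * m))" "inv\<^bsub>GL (2 * m)\<^esub> hyp m a b s = hyp m b a s"
  using GL_I[OF hyp_carrier hyp_carrier hyp_mult_swap[OF assms]] by auto

text \<open>Subfields in terms of the type class operations; with \<open>inverse 0 = 0\<close>,
  closure under inverses needs no exception at zero.\<close>

definition subfield_set :: "'a::Fields.field set \<Rightarrow> bool" where
  "subfield_set K \<longleftrightarrow> 0 \<in> K \<and> 1 \<in> K \<and> (\<forall>x\<in>K. - x \<in> K \<and> inverse x \<in> K) \<and>
     (\<forall>x\<in>K. \<forall>y\<in>K. x + y \<in> K \<and> x * y \<in> K)"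

lemma subfield_setD:
  assumes "subfield_set K"
  shows "0 \<in> K" "1 \<in> K" "x \<in> K \<Longrightarrow> - x \<in> K" "x \<in> K \<Longrightarrow> inverse x \<in> K"
    "x \<in> K \<Longrightarrow> y \<in> K \<Longrightarrow> x + y \<in> K" "x \<in> K \<Longrightarrow> y \<in> K \<Longrightarrow> x * y \<in> K"
    "x \<in> K \<Longrightarrow> y \<in> K \<Longrightarrow> x - y \<in> K"
  using assms unfolding subfield_set_def by (auto, metis add_uminus_conv_diff)

lemma subfield_set_sum:
  "subfield_set K \<Longrightarrow> (\<And>i. i \<in> A \<Longrightarrow> f i \<in> K) \<Longrightarrow> (\<Sum>i\<in>A. f i) \<in> K"
  by (induction A rule: infinite_finite_induct) (auto simp: subfield_setD)

lemma elements_mat_subset_iff: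
  "A \<in> carrier_mat k n \<Longrightarrow> elements_mat A \<subseteq> F \<longleftrightarrow> (\<forall>i<k. \<forall>j<n. A $$ (i, j) \<in> F)"
  unfolding elements_mat_def by (auto simp: UN_subset_iff image_subset_iff)

lemma hyp_Sp:
  fixes a b :: "'a::Fields.field Matrix.vec"
  assumes K: "subfield_set K" and a: "a \<in> carrier_vec (2 * m)" and b: "b \<in> carrier_vec (2 * m)"
    and nz: "sform m a b \<noteq> 0" "s \<noteq> 0"
    and mem: "\<And>i. i < 2 * m \<Longrightarrow> a $ i \<in> K" "\<And>i. i < 2 * m \<Longrightarrow> b $ i \<in> K" "s \<in> K"
  shows "hyp m a b s \<in> Sp m K"
  unfolding Sp_iff_preserves
proof (intro conjI ballI)
  note [intro] = subfield_setD[OF K]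
  have sf: "sform m a b \<in> K" unfolding sform_def
    by (rule subfield_set_sum[OF K]) (auto intro!: subfield_setD[OF K] mem)
  have J: "(symplectic_form m *\<^sub>v y) $ i \<in> K" if "y \<in> carrier_vec (2 * m)" "\<And>i. i < 2 * m \<Longrightarrow> y $ i \<in> K" "i < 2 * m" for y i
    unfolding symplectic_form_mult_vec[OF that(1,3)] using that by (auto intro!: subfield_setD[OF K])
  show "elements_mat (hyp m a b s) \<subseteq> K"
    unfolding elements_mat_subset_iff[OF hyp_carrier]
  proof (intro allI impI)
    fix i j assume "i < 2 * m" "j < 2 * m"
    then show "hyp m a b s $$ (i, j) \<in> K"
      using J[OF a mem(1)] J[OF b mem(2)] sf mem
      by (auto simp: hyp_def hyp_num_def simp del: index_mult_mat_vec inverse_mult_distrib intro!: subfield_setD[OF K])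
  qed
  fix x y :: "'a Matrix.vec" assume xy: "x \<in> carrier_vec (2 * m)" "y \<in> carrier_vec (2 * m)"
  show "sform m (row_act x (hyp m a b s)) (row_act y (hyp m a b s)) = sform m x y"
    unfolding hyp_def row_act_smult_mat[OF hyp_num_carrier xy(1)] row_act_smult_mat[OF hyp_num_carrier xy(2)]
      sform_smult_left[OF row_act_carrier[OF hyp_num_carrier]] sform_smult_right[OF row_act_carrier[OF hyp_num_carrier]]
      sform_hyp_num[OF a b xy]
    using nz by (simp add: field_simps power2_eq_square)
qed auto

section \<open>Words in hyperbolic elements\<close>

text \<open>\<open>u i \<epsilon>\<close> is the vector scaled by \<open>s\<close> under the element substituted for \<open>x i^\<epsilon>\<close>. The value of the word is
  \<open>word_num / word_den\<close>, and \<open>lead_vec\<close> is the coefficient of the highest power of \<open>s\<close> in the image of a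
  vector under \<open>word_num\<close>.\<close>

definition word_num where
  "word_num m c0 xs u s =
     foldl (\<lambda>A (i :: nat, \<epsilon> :: int, c). A * hyp_num m (u i \<epsilon>) (u i (- \<epsilon>)) s * c) c0 xs"

definition word_den where
  "word_den m xs u s = (\<Prod>(i :: nat, \<epsilon> :: int, c)\<leftarrow>xs. s * sform m (u i \<epsilon>) (u i (- \<epsilon>)))"

definition lead_vec where
  "lead_vec m v xs u =
     foldl (\<lambda>v (i :: nat, \<epsilon> :: int, c). sform m v (u i (- \<epsilon>)) \<cdot>\<^sub>v row_act (u i \<epsilon>) c) v xs"

text \<open>The identity as default keeps every substituted matrix in the symplectic group over
  \<open>K\<close>. A nonzero \<open>word_den\<close> controls only the variables that occur in the
  word, so pairs attached to other variables may degenerate.\<close>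

definition hyp_subst where
  "hyp_subst m u s i =
     (if sform m (u i 1) (u i (-1)) \<noteq> 0 \<and> s \<noteq> 0 then hyp m (u i 1) (u i (-1 :: int)) s else 1\<^sub>m (2 * m))"

lemma word_num_snoc:
  "word_num m c0 (xs @ [(i, \<epsilon>, c)]) u s = word_num m c0 xs u s * hyp_num m (u i \<epsilon>) (u i (- \<epsilon>)) s * c"
  by (simp add: word_num_def)

lemma word_den_snoc:
  "word_den m (xs @ [(i, \<epsilon>, c)]) u s = word_den m xs u s * (s * sform m (u i \<epsilon>) (u i (- \<epsilon>)))"
  by (simp add: word_den_def)

lemma lead_vec_snoc:
  "lead_vec m v (xs @ [(i, \<epsilon>, c)]) u = sform m (lead_vec m v xs u) (u i (- \<epsilon>)) \<cdot>\<^sub>v row_act (u i \<epsilon>) c"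
  by (simp add: lead_vec_def)

lemma word_num_carrier:
  assumes "c0 \<in> carrier_mat (2 * m) (2 * m)"
    "\<And>i \<epsilon> c. (i, \<epsilon>, c) \<in> set xs \<Longrightarrow> c \<in> carrier_mat (2 * m) (2 * m)"
  shows "word_num m c0 xs u s \<in> carrier_mat (2 * m) (2 * m)"
  using assms(2)
proof (induction xs rule: rev_induct)
  case (snoc x xs)
  obtain i \<epsilon> c where x: "x = (i, \<epsilon>, c)" by (cases x) auto
  have "c \<in> carrier_mat (2 * m) (2 * m)" using snoc.prems[of i \<epsilon> c] x by simp
  moreover have "word_num m c0 xs u s \<in> carrier_mat (2 * m) (2 * m)"
    using snoc.prems by (intro snoc.IH) (metis Un_iff set_append)
  ultimately show ?case unfolding x word_num_snoc
    by (intro mult_carrier_mat[where n = "2 * m"] hyp_num_carrier)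
qed (simp add: word_num_def assms(1))

lemma lead_vec_carrier:
  assumes "v \<in> carrier_vec n"
    "\<And>i \<epsilon> c. (i, \<epsilon>, c) \<in> set xs \<Longrightarrow> c \<in> carrier_mat n n"
  shows "lead_vec m v xs u \<in> carrier_vec n"
  using assms(2)
proof (induction xs rule: rev_induct)
  case (snoc x xs)
  obtain i \<epsilon> c where x: "x = (i, \<epsilon>, c)" by (cases x) auto
  have "c \<in> carrier_mat n n" using snoc.prems[of i \<epsilon> c] x by simp
  then show ?case unfolding x lead_vec_snoc by (intro smult_carrier_vec[THEN iffD2] row_act_carrier)
qed (simp add: lead_vec_def assms(1))

text \<open>Inversion exchanges the two vectors, so one formula covers both signs:
  \<open>u i \<epsilon>\<close> is scaled by s and \<open>u i (- \<epsilon>)\<close> by 1/s.\<close>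

lemma hyp_subst_pow:
  fixes u :: "nat \<Rightarrow> int \<Rightarrow> 'a::Fields.field Matrix.vec"
  assumes u: "\<And>i \<epsilon>. u i \<epsilon> \<in> carrier_vec (2 * m)" and "\<epsilon> \<in> {1, -1}"
    and nz: "sform m (u i \<epsilon>) (u i (- \<epsilon>)) \<noteq> 0" "s \<noteq> 0"
  shows "hyp_subst m u s i [^]\<^bsub>GL (2 * m)\<^esub> \<epsilon> = hyp m (u i \<epsilon>) (u i (- \<epsilon>)) s"
proof -
  interpret group "GL (2 * m) :: 'a mat monoid" by (rule group_GL)
  have nz': "sform m (u i 1) (u i (-1)) \<noteq> 0"
    using nz assms(2) sform_swap[of m "u i 1" "u i (-1)"] by auto
  then have h: "hyp_subst m u s i = hyp m (u i 1) (u i (-1)) s" using nz by (simp add: hyp_subst_def)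
  have g: "hyp m (u i 1) (u i (-1)) s \<in> carrier (GL (2 * m))"
    "inv\<^bsub>GL (2 * m)\<^esub> hyp m (u i 1) (u i (-1)) s = hyp m (u i (-1)) (u i 1) s"
    using hyp_GL[OF u u nz' nz(2)] by auto
  show ?thesis
  proof (cases "\<epsilon> = 1")
    case True
    then show ?thesis using g h by (simp add: int_pow_1)
  next
    case False
    then have "\<epsilon> = - 1" using assms(2) by auto
    then show ?thesis using g h int_pow_neg[OF g(1), of 1] by (simp add: int_pow_1)
  qed
qed

text \<open>Scalars commute with matrices, so the denominators of all letters collect in front of
  the product.\<close>

lemma word_eval_hyp_subst:
  fixes u :: "nat \<Rightarrow> int \<Rightarrow> 'a::Fields.field Matrix.vec"
  assumes u: "\<And>i \<epsilon>. u i \<epsilon> \<in> carrier_vec (2 * m)" and c0: "c0 \<in> carrier (GL (2 * m))"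
    and xs: "\<And>i \<epsilon> c. (i, \<epsilon>, c) \<in> set xs \<Longrightarrow> \<epsilon> \<in> {1, -1} \<and> c \<in> carrier (GL (2 * m))"
    and den: "word_den m xs u s \<noteq> 0"
  shows "word_eval (GL (2 * m)) (c0, xs) (hyp_subst m u s) \<in> carrier_mat (2 * m) (2 * m) \<and>
    word_den m xs u s \<cdot>\<^sub>m word_eval (GL (2 * m)) (c0, xs) (hyp_subst m u s) = word_num m c0 xs u s"
  using xs den
proof (induction xs rule: rev_induct)
  case Nil
  then show ?case using GL_carrier_mat[OF c0]
    by (auto simp: word_eval_def word_den_def word_num_def intro!: eq_matI)
next
  case (snoc x xs)
  let ?n = "2 * m"
  obtain i \<epsilon> c where x: "x = (i, \<epsilon>, c)" by (cases x) auto
  have e: "\<epsilon> \<in> {1, -1}" and c: "c \<in> carrier_mat ?n ?n"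
    using snoc.prems(1)[of i \<epsilon> c] GL_carrier_mat x by auto
  have nz: "word_den m xs u s \<noteq> 0" "s \<noteq> 0" "sform m (u i \<epsilon>) (u i (- \<epsilon>)) \<noteq> 0"
    using snoc.prems(2) unfolding x word_den_snoc by auto
  let ?E = "word_eval (GL ?n) (c0, xs) (hyp_subst m u s)"
  let ?N = "hyp_num m (u i \<epsilon>) (u i (- \<epsilon>)) s" and ?b = "s * sform m (u i \<epsilon>) (u i (- \<epsilon>))"
  have IH: "?E \<in> carrier_mat ?n ?n" "word_den m xs u s \<cdot>\<^sub>m ?E = word_num m c0 xs u s"
    using snoc.IH snoc.prems(1) nz(1) by auto
  have N: "?N \<in> carrier_mat ?n ?n" by simp
  have EN: "?E * ?N \<in> carrier_mat ?n ?n" using IH(1) N by (rule mult_carrier_mat)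
  have ENc: "?E * ?N * c \<in> carrier_mat ?n ?n" using EN c by (rule mult_carrier_mat)
  have "word_eval (GL ?n) (c0, xs @ [x]) (hyp_subst m u s) =
    ?E * (hyp_subst m u s i [^]\<^bsub>GL ?n\<^esub> \<epsilon>) * c"
    by (simp add: x word_eval_def GL_simps(2))
  also have "\<dots> = inverse ?b \<cdot>\<^sub>m (?E * ?N * c)"
    unfolding hyp_subst_pow[of u, OF u e nz(3,2)] hyp_def
    using mult_smult_distrib[OF IH(1) N, of "inverse ?b"] mult_smult_assoc_mat[OF EN c, of "inverse ?b"]
    by (simp only:)
  finally have eval: "word_eval (GL ?n) (c0, xs @ [x]) (hyp_subst m u s) = inverse ?b \<cdot>\<^sub>m (?E * ?N * c)" .
  have "word_den m (xs @ [x]) u s \<cdot>\<^sub>m (inverse ?b \<cdot>\<^sub>m (?E * ?N * c)) = word_den m xs u s \<cdot>\<^sub>m (?E * ?N * c)"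
  proof -
    have "word_den m (xs @ [x]) u s * inverse ?b = word_den m xs u s"
      using nz unfolding x word_den_snoc by (simp add: field_simps)
    then show ?thesis unfolding smult_smult_mat by (simp only:)
  qed
  also have "\<dots> = word_num m c0 xs u s * ?N * c"
    unfolding IH(2)[symmetric]
    using mult_smult_assoc_mat[OF IH(1) N, of "word_den m xs u s"]
      mult_smult_assoc_mat[OF EN c, of "word_den m xs u s"] by simp
  also have "\<dots> = word_num m c0 (xs @ [x]) u s" unfolding x word_num_snoc ..
  finally show ?case unfolding eval using ENc by simp
qed

section \<open>Polynomial dependence on the parameters and leading coefficients in s\<close>

lemma mpoly_fun_sform:
  assumes "\<And>k. k < 2 * m \<Longrightarrow> mpoly_fun I (\<lambda>p. x p $ k)" "\<And>k. k < 2 * m \<Longrightarrow> mpoly_fun I (\<lambda>p. y p $ k)"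
  shows "mpoly_fun I (\<lambda>p. sform m (x p) (y p))"
  unfolding sform_def by (intro mpoly_fun_sum mpoly_fun_diff mpoly_fun_mult assms) auto

lemma mpoly_fun_hyp_num:
  assumes "\<And>p. a p \<in> carrier_vec (2 * m)" "\<And>p. b p \<in> carrier_vec (2 * m)"
    and "\<And>k. k < 2 * m \<Longrightarrow> mpoly_fun I (\<lambda>p. a p $ k)" "\<And>k. k < 2 * m \<Longrightarrow> mpoly_fun I (\<lambda>p. b p $ k)"
    and "mpoly_fun I s" and ij: "i < 2 * m" "j < 2 * m"
  shows "mpoly_fun I (\<lambda>p. hyp_num m (a p) (b p) (s p) $$ (i, j))"
proof -
  have J: "mpoly_fun I (\<lambda>p. (symplectic_form m *\<^sub>v y p) $ i)"
    if "\<And>p. y p \<in> carrier_vec (2 * m)" "\<And>k. k < 2 * m \<Longrightarrow> mpoly_fun I (\<lambda>p. y p $ k)" for y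
    unfolding symplectic_form_mult_vec[OF that(1) ij(1)]
    using that(2)[of "m + i"] mpoly_fun_uminus[OF that(2)[of "i - m"]] ij by (cases "i < m") auto
  have "mpoly_fun I (\<lambda>p. s p * sform m (a p) (b p) * (if i = j then 1 else 0)
     + s p * (s p - 1) * (symplectic_form m *\<^sub>v b p) $ i * a p $ j
     + (s p - 1) * (symplectic_form m *\<^sub>v a p) $ i * b p $ j)"
    by (intro mpoly_fun_add mpoly_fun_mult mpoly_fun_diff mpoly_fun_const mpoly_fun_sform J assms)
  then show ?thesis using ij by (simp add: hyp_num_def del: index_mult_mat_vec)
qed

lemma mat_mult_index:
  assumes "A \<in> carrier_mat k n" "B \<in> carrier_mat n l" "i < k" "j < l"
  shows "(A * B) $$ (i, j) = (\<Sum>t<n. A $$ (i, t) * B $$ (t, j))"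
  using assms by (auto simp: scalar_prod_def lessThan_atLeast0 intro!: sum.cong)

lemma mpoly_fun_word_num:
  assumes u: "\<And>p i \<epsilon>. u p i \<epsilon> \<in> carrier_vec (2 * m)"
    "\<And>i \<epsilon> k. k < 2 * m \<Longrightarrow> mpoly_fun I (\<lambda>p. u p i \<epsilon> $ k)" and s: "mpoly_fun I s"
    and c0: "c0 \<in> carrier_mat (2 * m) (2 * m)"
    and xs: "\<And>i \<epsilon> c. (i, \<epsilon>, c) \<in> set xs \<Longrightarrow> c \<in> carrier_mat (2 * m) (2 * m)"
    and ij: "i < 2 * m" "j < 2 * m"
  shows "mpoly_fun I (\<lambda>p. word_num m c0 xs (u p) (s p) $$ (i, j))"
  using xs ij
proof (induction xs arbitrary: i j rule: rev_induct)
  case Nil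
  then show ?case by (simp add: word_num_def)
next
  case (snoc x xs)
  obtain l \<epsilon> c where x: "x = (l, \<epsilon>, c)" by (cases x) auto
  have c: "c \<in> carrier_mat (2 * m) (2 * m)" using snoc.prems(1)[of l \<epsilon> c] x by simp
  have W: "word_num m c0 xs (u p) (s p) \<in> carrier_mat (2 * m) (2 * m)" for p
    using snoc.prems(1) by (intro word_num_carrier c0) auto
  have *: "word_num m c0 (xs @ [x]) (u p) (s p) $$ (i, j) =
    (\<Sum>t<2 * m. (\<Sum>r<2 * m. word_num m c0 xs (u p) (s p) $$ (i, r) *
       hyp_num m (u p l \<epsilon>) (u p l (- \<epsilon>)) (s p) $$ (r, t)) * c $$ (t, j))" for p
    unfolding x word_num_snoc
    using mat_mult_index[OF mult_carrier_mat[OF W hyp_num_carrier] c snoc.prems(2,3)]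
      mat_mult_index[OF W hyp_num_carrier snoc.prems(2)] by simp
  have "mpoly_fun I (\<lambda>p. word_num m c0 xs (u p) (s p) $$ (i, r))" if "r < 2 * m" for r
    using snoc.prems that by (intro snoc.IH) auto
  then show ?case unfolding *
    by (intro mpoly_fun_sum mpoly_fun_mult mpoly_fun_const mpoly_fun_hyp_num u s snoc.prems) auto
qed

lemma mpoly_fun_lead_vec:
  assumes u: "\<And>p i \<epsilon>. u p i \<epsilon> \<in> carrier_vec (2 * m)"
    "\<And>i \<epsilon> k. k < 2 * m \<Longrightarrow> mpoly_fun I (\<lambda>p. u p i \<epsilon> $ k)"
    and v: "v \<in> carrier_vec (2 * m)"
    and xs: "\<And>i \<epsilon> c. (i, \<epsilon>, c) \<in> set xs \<Longrightarrow> c \<in> carrier_mat (2 * m) (2 * m)"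
    and k: "k < 2 * m"
  shows "mpoly_fun I (\<lambda>p. lead_vec m v xs (u p) $ k)"
  using xs k
proof (induction xs arbitrary: k rule: rev_induct)
  case Nil
  then show ?case by (simp add: lead_vec_def)
next
  case (snoc x xs)
  obtain l \<epsilon> c where x: "x = (l, \<epsilon>, c)" by (cases x) auto
  have c: "c \<in> carrier_mat (2 * m) (2 * m)" using snoc.prems(1)[of l \<epsilon> c] x by simp
  have *: "lead_vec m v (xs @ [x]) (u p) $ k = sform m (lead_vec m v xs (u p)) (u p l (- \<epsilon>)) *
    (\<Sum>t<2 * m. u p l \<epsilon> $ t * c $$ (t, k))" for p
    unfolding x lead_vec_snoc using row_act_index[OF c u(1) snoc.prems(2)] row_act_carrier[OF c, of "u p l \<epsilon>"] snoc.prems(2)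
    by simp
  have "mpoly_fun I (\<lambda>p. lead_vec m v xs (u p) $ r)" if "r < 2 * m" for r
    using snoc.prems that by (intro snoc.IH) auto
  then show ?case unfolding *
    by (intro mpoly_fun_sum mpoly_fun_mult mpoly_fun_const mpoly_fun_sform u) auto
qed

lemma has_lead_sform:
  assumes "\<And>k. k < 2 * m \<Longrightarrow> has_lead (\<lambda>s. x s $ k) d (x' $ k)"
  shows "has_lead (\<lambda>s. sform m (x s) y) d (sform m x' y)"
proof -
  have "has_lead (\<lambda>s. \<Sum>i<m. x s $ i * y $ (m + i) + x s $ (m + i) * - y $ i) d
    (\<Sum>i<m. x' $ i * y $ (m + i) + x' $ (m + i) * - y $ i)"
  proof (intro has_lead_sum has_lead_add)
    fix i assume "i \<in> {..<m}"
    then show "has_lead (\<lambda>s. x s $ i * y $ (m + i)) d (x' $ i * y $ (m + i))"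
      "has_lead (\<lambda>s. x s $ (m + i) * - y $ i) d (x' $ (m + i) * - y $ i)"
      using has_lead_mult[OF assms has_lead_const] by (metis add_0_right lessThan_iff mult_2 nat_add_left_cancel_less trans_less_add1)+
  qed
  then show ?thesis by (simp add: sform_def)
qed

text \<open>Of the three summands only the one along \<open>a\<close> carries a factor s^2. Those
  along x and along \<open>b\<close> have degree at most \<open>d + 1\<close> and enter with top
  coefficient 0.\<close>

lemma has_lead_hyp_num:
  assumes a: "a \<in> carrier_vec (2 * m)" and b: "b \<in> carrier_vec (2 * m)"
    and x: "\<And>s. x s \<in> carrier_vec (2 * m)" "\<And>k. k < 2 * m \<Longrightarrow> has_lead (\<lambda>s. x s $ k) d (x' $ k)"
    and j: "j < 2 * m"
  shows "has_lead (\<lambda>s. row_act (x s) (hyp_num m a b s) $ j) (d + 2) (sform m x' b * a $ j)"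
proof -
  have s1: "has_lead (\<lambda>s::'a. s + -1) 1 (1 + 0)"
    by (rule has_lead_add[OF has_lead_var has_lead_raise[OF has_lead_const]]) simp
  have "has_lead (\<lambda>s. s * sform m a b * x s $ j) (1 + 0 + d) (1 * sform m a b * x' $ j)"
    by (intro has_lead_mult has_lead_var has_lead_const x j)
  then have 1: "has_lead (\<lambda>s. s * sform m a b * x s $ j) (d + 2) 0" by (rule has_lead_raise) simp
  have 2: "has_lead (\<lambda>s. s * (s + -1) * sform m (x s) b * a $ j) (1 + 1 + d + 0) (1 * (1 + 0) * sform m x' b * a $ j)"
    by (intro has_lead_mult has_lead_var has_lead_const s1 has_lead_sform x)
  have "has_lead (\<lambda>s. (s + -1) * sform m (x s) a * b $ j) (1 + d + 0) ((1 + 0) * sform m x' a * b $ j)"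
    by (intro has_lead_mult has_lead_var has_lead_const s1 has_lead_sform x)
  then have 3: "has_lead (\<lambda>s. (s + -1) * sform m (x s) a * b $ j) (d + 2) 0" by (rule has_lead_raise) simp
  have "has_lead (\<lambda>s. s * sform m a b * x s $ j + (s * (s + -1) * sform m (x s) b * a $ j + (s + -1) * sform m (x s) a * b $ j))
    (d + 2) (0 + (sform m x' b * a $ j + 0))"
    using 2 by (intro has_lead_add 1 3) (simp add: add.commute)
  then show ?thesis unfolding row_act_hyp_num[OF a b x(1)] using a b carrier_vecD[OF x(1)] j by simp
qed

text \<open>Leading coefficients multiply letter by letter. No cancellation has to be excluded here,
  since a zero top coefficient is allowed; nonvanishing is the business of
  \<open>lead_vec_sform_nonzero\<close>.\<close>

lemma has_lead_word_num:
  assumes u: "\<And>i \<epsilon>. u i \<epsilon> \<in> carrier_vec (2 * m)"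
    and c0: "c0 \<in> carrier_mat (2 * m) (2 * m)" and v: "v \<in> carrier_vec (2 * m)"
    and xs: "\<And>i \<epsilon> c. (i, \<epsilon>, c) \<in> set xs \<Longrightarrow> c \<in> carrier_mat (2 * m) (2 * m)"
    and j: "j < 2 * m"
  shows "has_lead (\<lambda>s. row_act v (word_num m c0 xs u s) $ j) (2 * length xs)
    (lead_vec m (row_act v c0) xs u $ j)"
  using xs j
proof (induction xs arbitrary: j rule: rev_induct)
  case Nil
  then show ?case by (simp add: word_num_def lead_vec_def has_lead_const)
next
  case (snoc x xs)
  obtain l \<epsilon> c where x: "x = (l, \<epsilon>, c)" by (cases x) auto
  let ?a = "u l \<epsilon>" and ?b = "u l (- \<epsilon>)" and ?n = "2 * m"
  have c: "c \<in> carrier_mat ?n ?n" using snoc.prems(1)[of l \<epsilon> c] x by simp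
  define Z where "Z s = row_act v (word_num m c0 xs u s)" for s
  define Z' where "Z' = lead_vec m (row_act v c0) xs u"
  have W: "word_num m c0 xs u s \<in> carrier_mat ?n ?n" for s
    using snoc.prems(1) by (intro word_num_carrier c0) auto
  then have Z: "Z s \<in> carrier_vec ?n" for s unfolding Z_def by (rule row_act_carrier)
  have lZ: "has_lead (\<lambda>s. Z s $ k) (2 * length xs) (Z' $ k)" if "k < ?n" for k
    unfolding Z_def Z'_def using snoc.prems(1) that by (intro snoc.IH) auto
  have "row_act v (word_num m c0 (xs @ [x]) u s) $ j =
    (\<Sum>t<?n. row_act (Z s) (hyp_num m ?a ?b s) $ t * c $$ (t, j))" for s
    unfolding x word_num_snoc Z_def
    using row_act_mult[OF mult_carrier_mat[OF W hyp_num_carrier] c v] row_act_mult[OF W hyp_num_carrier v]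
      row_act_index[OF c row_act_carrier[OF hyp_num_carrier] snoc.prems(2)] by simp
  moreover have "has_lead (\<lambda>s. \<Sum>t<?n. row_act (Z s) (hyp_num m ?a ?b s) $ t * c $$ (t, j)) (2 * length xs + 2 + 0)
    (\<Sum>t<?n. sform m Z' ?b * ?a $ t * c $$ (t, j))"
    by (intro has_lead_sum has_lead_mult has_lead_const has_lead_hyp_num u Z lZ) auto
  moreover have "(\<Sum>t<?n. sform m Z' ?b * ?a $ t * c $$ (t, j)) = lead_vec m (row_act v c0) (xs @ [x]) u $ j"
    unfolding x lead_vec_snoc Z'_def
    using row_act_index[OF c u snoc.prems(2)] row_act_carrier[OF c, of "u l \<epsilon>"] snoc.prems(2)
    by (simp add: sum_distrib_left mult.assoc)
  ultimately show ?case by simp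
qed

text \<open>After each letter the leading vector is a multiple of that letter's vector moved by its
  constant. Hence each new factor is the previous one times the pairing of two adjacent
  letters.\<close>

lemma lead_vec_sform_nonzero:
  assumes u: "\<And>i \<epsilon>. u i \<epsilon> \<in> carrier_vec (2 * m)"
    and xs: "\<And>i \<epsilon> c. (i, \<epsilon>, c) \<in> set xs \<Longrightarrow> c \<in> carrier_mat (2 * m) (2 * m)"
    and first: "xs \<noteq> [] \<Longrightarrow> sform m v (u (fst (xs ! 0)) (- fst (snd (xs ! 0)))) \<noteq> 0"
    and adj: "\<And>j. Suc j < length xs \<Longrightarrow>
      sform m (row_act (u (fst (xs ! j)) (fst (snd (xs ! j)))) (snd (snd (xs ! j))))
        (u (fst (xs ! Suc j)) (- fst (snd (xs ! Suc j)))) \<noteq> 0"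
  shows "j < length xs \<Longrightarrow> sform m (lead_vec m v (take j xs) u) (u (fst (xs ! j)) (- fst (snd (xs ! j)))) \<noteq> 0"
proof (induction j)
  case 0
  then show ?case using first by (simp add: lead_vec_def)
next
  case (Suc j)
  obtain i \<epsilon> c where x: "xs ! j = (i, \<epsilon>, c)" by (cases "xs ! j") auto
  have c: "c \<in> carrier_mat (2 * m) (2 * m)" using xs[of i \<epsilon> c] x Suc.prems nth_mem[of j xs] by simp
  have *: "take (Suc j) xs = take j xs @ [(i, \<epsilon>, c)]" using Suc.prems x by (simp add: take_Suc_conv_app_nth)
  have "sform m (lead_vec m v (take j xs) u) (u i (- \<epsilon>)) \<noteq> 0" using Suc x by simp
  then show ?case unfolding * lead_vec_snoc sform_smult_left[OF row_act_carrier[OF c]]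
    using adj[OF Suc.prems] x by simp
qed

lemma word_den_factor: "word_den m xs u s = s ^ length xs * word_den m xs u 1"
proof (induction xs rule: rev_induct)
  case (snoc x xs)
  obtain i \<epsilon> c where x: "x = (i, \<epsilon>, c)" by (cases x) auto
  show ?case unfolding x word_den_snoc by (simp add: snoc.IH)
qed (simp add: word_den_def)

lemma word_den_nonzero:
  "word_den m xs u s \<noteq> 0 \<longleftrightarrow> (\<forall>(i, \<epsilon>, c)\<in>set xs. s \<noteq> 0 \<and> sform m (u i \<epsilon>) (u i (- \<epsilon>)) \<noteq> 0)"
  unfolding word_den_def by (induction xs) auto

lemma mpoly_fun_word_den:
  assumes "\<And>i \<epsilon> k. k < 2 * m \<Longrightarrow> mpoly_fun I (\<lambda>p. u p i \<epsilon> $ k)"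
  shows "mpoly_fun I (\<lambda>p. word_den m xs (u p) s)"
proof (induction xs rule: rev_induct)
  case (snoc x xs)
  obtain i \<epsilon> c where x: "x = (i, \<epsilon>, c)" by (cases x) auto
  show ?case unfolding x word_den_snoc
    by (intro mpoly_fun_mult mpoly_fun_const mpoly_fun_sform snoc.IH assms)
qed (simp add: word_den_def)

section \<open>Word values on the symplectic group and the dimension bound\<close>

lemma word_eval_closed:
  fixes xs :: "(nat \<times> int \<times> 'a::Fields.field mat) list"
  assumes c0: "c0 \<in> carrier (GL n)"
    and "\<And>i \<epsilon> c. (i, \<epsilon>, c) \<in> set xs \<Longrightarrow> c \<in> carrier (GL n) \<and> g i \<in> carrier (GL n)"
  shows "word_eval (GL n) (c0, xs) g \<in> carrier (GL n)"
  using assms(2)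
proof (induction xs rule: rev_induct)
  case (snoc x xs)
  interpret group "GL n :: 'a mat monoid" by (rule group_GL)
  obtain i \<epsilon> c where x: "x = (i, \<epsilon>, c)" by (cases x) auto
  have "c \<in> carrier (GL n)" "g i \<in> carrier (GL n)" using snoc.prems[of i \<epsilon> c] x by auto
  moreover have "word_eval (GL n) (c0, xs) g \<in> carrier (GL n)"
    using snoc.prems by (intro snoc.IH) (metis Un_iff set_append)
  ultimately have "word_eval (GL n) (c0, xs) g \<otimes>\<^bsub>GL n\<^esub> (g i [^]\<^bsub>GL n\<^esub> \<epsilon>) \<otimes>\<^bsub>GL n\<^esub> c \<in> carrier (GL n)"
    by (intro m_closed int_pow_closed)
  then show ?case by (simp add: x word_eval_def)
qed (simp add: word_eval_def c0)

text \<open>A row vector killed by the matrix would be orthogonal to every vector, by invariance of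
  the form.\<close>

lemma Sp_subset_GL: "Sp m F \<subseteq> carrier (GL (2 * m))"
proof
  fix A :: "'a mat" assume "A \<in> Sp m F"
  then have A: "A \<in> carrier_mat (2 * m) (2 * m)" and pres: "\<And>x y. x \<in> carrier_vec (2 * m) \<Longrightarrow>
      y \<in> carrier_vec (2 * m) \<Longrightarrow> sform m (row_act x A) (row_act y A) = sform m x y"
    unfolding Sp_iff_preserves by auto
  have "Determinant.det (transpose_mat A) \<noteq> 0"
  proof
    assume "Determinant.det (transpose_mat A) = 0"
    then obtain v where v: "v \<in> carrier_vec (2 * m)" "v \<noteq> 0\<^sub>v (2 * m)" "row_act v A = 0\<^sub>v (2 * m)"
      unfolding row_act_def det_0_iff_vec_prod_zero_field[OF transpose_carrier_mat[THEN iffD2, OF A]] by blast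
    have "sform m v y = 0" if "y \<in> carrier_vec (2 * m)" for y
      using pres[OF v(1) that] v(3) row_act_carrier[OF A, of y] by (simp add: sform_def)
    then show False using sform_nondegenerate[OF v(1,2)] by blast
  qed
  then show "A \<in> carrier (GL (2 * m))"
    using det_non_zero_imp_unit[OF A, of "()"] det_transpose[OF A] by (simp add: GL_def units_of_def)
qed

lemma one_in_Sp: "subfield_set K \<Longrightarrow> 1\<^sub>m (2 * m) \<in> Sp m K"
  unfolding Sp_iff_preserves by (auto simp: elements_mat_subset_iff[of _ "2 * m" "2 * m"] subfield_setD)

text \<open>The smallness condition enters through \<open>crit\<close> alone. Generic vectors over
  \<open>K\<close> are fixed, and then just the vector of the last letter varies. Its last
  coordinate stays a nonzero constant, so that the other n - 1 are affine coordinates on the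
  projective space of lines.\<close>

lemma zariski_dim_word_image:
  fixes K :: "'a::Fields.field set" and xs :: "(nat \<times> int \<times> 'a mat) list"
  assumes K: "infinite K" "subfield_set K" and m: "m \<ge> 1" and n: "n = 2 * m"
    and c0: "c0 \<in> carrier (GL n)"
    and xs: "xs \<noteq> []" "\<And>i \<epsilon> c. (i, \<epsilon>, c) \<in> set xs \<Longrightarrow> i \<in> {1..r} \<and> \<epsilon> \<in> {1, -1} \<and> c \<in> carrier (GL n)"
    and crit: "\<And>j. Suc j < length xs \<Longrightarrow> fst (xs ! j) = fst (xs ! Suc j) \<Longrightarrow>
      fst (snd (xs ! j)) = - fst (snd (xs ! Suc j)) \<Longrightarrow>
      \<exists>v\<in>carrier_vec n. sform m (row_act v (snd (snd (xs ! j)))) v \<noteq> 0"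
  shows "zariski_dim n (word_image (GL n) (c0, xs) r (Sp m K)) \<ge> enat n"
proof -
  define L where "L = length xs"
  have L: "L > 0" using xs by (simp add: L_def)
  define vi where "vi j = fst (xs ! j)" for j
  define ve where "ve j = fst (snd (xs ! j))" for j
  define vc where "vc j = snd (snd (xs ! j))" for j
  have xs_nth: "xs ! j = (vi j, ve j, vc j)" for j by (simp add: vi_def ve_def vc_def)
  have mem: "vi j \<in> {1..r}" "ve j \<in> {1, -1}" "vc j \<in> carrier (GL n)" "vc j \<in> carrier_mat n n" if "j < L" for j
    using xs(2)[of "vi j" "ve j" "vc j"] nth_mem[of j xs] that xs_nth[of j] GL_carrier_mat
    by (auto simp: L_def)
  define N where "N = L - 1"
  have N: "N < L" "L = Suc N" using L by (auto simp: N_def)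
  define I where "I = {1..r} \<times> {1, -1 :: int} \<times> {..<n}"
  define U where "U z i \<epsilon> = Matrix.vec n (\<lambda>k. z (i, \<epsilon>, k))" for z :: "nat \<times> int \<times> nat \<Rightarrow> 'a" and i \<epsilon>
  have U: "U z i \<epsilon> \<in> carrier_vec n" for z i \<epsilon> by (simp add: U_def)
  define adj where "adj j z = sform m (row_act (U z (vi j) (ve j)) (vc j)) (U z (vi (Suc j)) (- ve (Suc j)))" for j z
  define bet where "bet i z = sform m (U z i 1) (U z i (-1))" for i z
  define las where "las z = z (vi N, ve N, n - 1)" for z :: "nat \<times> int \<times> nat \<Rightarrow> 'a"
  \<comment> \<open>Genericity means nonvanishing of three kinds of polynomials: the pairings of
    adjacent letters, the pairing of the two vectors attached to one variable, and the coordinate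
    that will remain constant.\<close>
  define \<F> where "\<F> = adj ` {j. Suc j < L} \<union> bet ` {1..r} \<union> {las}"
  have Uk: "mpoly_fun I (\<lambda>z. U z i \<epsilon> $ k)" if "k < 2 * m" for i \<epsilon> k using that n by (simp add: U_def)
  define Z where "Z v x = (if x \<in> I then v (fst x) (fst (snd x)) $ snd (snd x) else 0)"
    for v :: "nat \<Rightarrow> int \<Rightarrow> 'a Matrix.vec" and x
  have UZ: "U (Z v) i \<epsilon> = v i \<epsilon>" if "i \<in> {1..r}" "\<epsilon> \<in> {1, -1}" "v i \<epsilon> \<in> carrier_vec n" for v i \<epsilon>
    using that by (intro eq_vecI) (auto simp: U_def Z_def I_def)
  have "\<exists>z. (\<forall>x\<in>I. z x \<in> K) \<and> (\<forall>x. x \<notin> I \<longrightarrow> z x = (\<lambda>_. 0) x) \<and> (\<forall>f\<in>\<F>. (\<lambda>f. f) f z \<noteq> 0)"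
  proof (rule mpoly_fun_family_nonzero)
    show "finite I" by (simp add: I_def)
    show "finite \<F>" 
    proof -
      have "{j. Suc j < L} \<subseteq> {..<L}" by auto
      then have "finite {j. Suc j < L}" using finite_subset by blast
      then show ?thesis unfolding \<F>_def by simp
    qed
    fix f assume "f \<in> \<F>"
    then consider j where "f = adj j" "Suc j < L" | i where "f = bet i" "i \<in> {1..r}" | "f = las"
      unfolding \<F>_def by blast
    then have "mpoly_fun I f \<and> (\<exists>v. f (Z v) \<noteq> 0)"
    proof cases
      case (1 j)
      have c: "vc j \<in> carrier_mat n n" using 1 mem by simp
      have "mpoly_fun I (\<lambda>z. row_act (U z (vi j) (ve j)) (vc j) $ k)" if "k < 2 * m" for k
      proof -
        have "mpoly_fun I (\<lambda>z. \<Sum>i<n. U z (vi j) (ve j) $ i * vc j $$ (i, k))"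
          by (intro mpoly_fun_sum mpoly_fun_mult mpoly_fun_const Uk) (simp add: n)
        then show ?thesis using row_act_index[OF c U] that n by simp
      qed
      then have "mpoly_fun I f" unfolding 1 adj_def[abs_def] by (intro mpoly_fun_sform Uk) auto
      \<comment> \<open>At a critical index both slots of the pairing hold the same unknown vector,
        and a quadratic form in it must be shown nonzero. At any other index the two vectors can be
        chosen independently.\<close>
      moreover have "\<exists>v. adj j (Z v) \<noteq> 0"
      proof (cases "vi j = vi (Suc j) \<and> ve j = - ve (Suc j)")
        case True
        then obtain v where v: "v \<in> carrier_vec n" "sform m (row_act v (vc j)) v \<noteq> 0"
          using crit[of j] 1 unfolding L_def vi_def ve_def vc_def by blast
        then have "adj j (Z (\<lambda>_ _. v)) \<noteq> 0"
          unfolding adj_def using UZ[of _ _ "\<lambda>_ _. v"] mem[of j] mem[of "Suc j"] 1 by auto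
        then show ?thesis by blast
      next
        case False
        have "unit_vec n 0 \<noteq> (0\<^sub>v n :: 'a Matrix.vec)" using m n
          by (metis index_unit_vec(1) index_zero_vec(1) mult_pos_pos not_one_le_zero zero_less_numeral zero_less_iff_neq_zero zero_neq_one)
        then have "row_act (unit_vec n 0) (vc j) \<noteq> 0\<^sub>v n" using mem(3)[of j] 1
          by (intro row_act_GL_nonzero) auto
        then obtain y where y: "y \<in> carrier_vec n" "sform m (row_act (unit_vec n 0) (vc j)) y \<noteq> 0"
          using sform_nondegenerate[of "row_act (unit_vec n 0) (vc j)" m] row_act_carrier[OF c] n by blast
        let ?v = "\<lambda>i \<epsilon>. if (i, \<epsilon>) = (vi j, ve j) then unit_vec n 0 else y"
        have "adj j (Z ?v) \<noteq> 0"
          unfolding adj_def using UZ[of _ _ ?v] mem[of j] mem[of "Suc j"] 1 y False by auto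
        then show ?thesis by blast
      qed
      ultimately show ?thesis using 1 by simp
    next
      case (2 i)
      have "mpoly_fun I f" unfolding 2 bet_def[abs_def] by (intro mpoly_fun_sform Uk)
      moreover have "bet i (Z (\<lambda>_ \<epsilon>. if \<epsilon> = 1 then unit_vec n 0 else unit_vec n m)) \<noteq> 0"
        unfolding bet_def using UZ[of i _ "\<lambda>_ \<epsilon>. if \<epsilon> = 1 then unit_vec n 0 else unit_vec n m"] 2(2) m
          sform_unit_high[of 0 m "unit_vec n 0 :: 'a Matrix.vec"] n by simp
      ultimately show ?thesis using 2(1) by blast
    next
      case 3
      have "las (Z (\<lambda>_ _. unit_vec n (n - 1))) \<noteq> 0"
        using mem[OF N(1)] m n by (simp add: las_def Z_def I_def)
      then show ?thesis using 3 by (auto simp: las_def[abs_def])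
    qed
    then obtain v where v: "mpoly_fun I f" "f (Z v) \<noteq> 0" by blast
    then show "mpoly_fun I ((\<lambda>f. f) f)" by simp
    show "\<exists>p. (\<forall>i. i \<notin> I \<longrightarrow> p i = (\<lambda>_. 0) i) \<and> (\<lambda>f. f) f p \<noteq> 0"
      using v by (intro exI[of _ "Z v"]) (simp add: Z_def)
  qed (rule K(1))
  then obtain z where z: "\<And>x. z x \<in> K" "\<And>f. f \<in> \<F> \<Longrightarrow> f z \<noteq> 0"
    using subfield_setD(1)[OF K(2)] by metis
  have z_adj: "adj j z \<noteq> 0" if "Suc j < L" for j using z(2)[of "adj j"] that by (auto simp: \<F>_def)
  have z_bet: "bet i z \<noteq> 0" if "i \<in> {1..r}" for i using z(2)[of "bet i"] that by (auto simp: \<F>_def)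
  have z_las: "las z \<noteq> 0" using z(2)[of las] by (auto simp: \<F>_def)
  have z_pm: "sform m (U z i \<epsilon>) (U z i (- \<epsilon>)) \<noteq> 0" if "i \<in> {1..r}" "\<epsilon> \<in> {1, -1}" for i \<epsilon>
    using z_bet[OF that(1)] that(2) sform_swap[of m "U z i 1" "U z i (-1)"] by (auto simp: bet_def)

  \<comment> \<open>Entry 0 of \<open>p\<close> is reserved for s; entries 1 to n - 1 are
    coordinates of the last letter's vector. The replacement takes effect wherever this letter or
    its inverse recurs in the word.\<close>
  define u where "u p i \<epsilon> = (if (i, \<epsilon>) = (vi N, ve N)
      then Matrix.vec n (\<lambda>k. if k < n - 1 then p (Suc k) else las z) else U z i \<epsilon>)" for p :: "nat \<Rightarrow> 'a" and i \<epsilon>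
  have u: "u p i \<epsilon> \<in> carrier_vec (2 * m)" for p i \<epsilon> using U n by (simp add: u_def)
  have u_upd: "u (p(0 := s)) = u p" for p s
    by (intro ext) (simp add: u_def cong: if_cong)
  have u_mpoly: "mpoly_fun UNIV (\<lambda>p. u p i \<epsilon> $ k)" if "k < 2 * m" for i \<epsilon> k
    using that n by (cases "(i, \<epsilon>) = (vi N, ve N)"; cases "k < n - 1") (auto simp: u_def)
  have u_K: "u p i \<epsilon> $ k \<in> K" if "\<And>i. p i \<in> K" "k < 2 * m" for p i \<epsilon> k
    using that z(1) n by (auto simp: u_def U_def las_def)
  define p0 where "p0 i = (if i = 0 then 1 else z (vi N, ve N, i - 1))" for i
  have u_p0: "u p0 = U z"
  proof (intro ext)
    fix i \<epsilon>
    have "Matrix.vec n (\<lambda>k. if k < n - 1 then p0 (Suc k) else las z) = U z (vi N) (ve N)"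
      unfolding U_def p0_def las_def by (intro eq_vecI) (auto, metis One_nat_def Suc_leI Suc_pred bot_nat_0.not_eq_extremum le_antisym less_Suc_eq_le not_less0 not_less_eq)
    then show "u p0 i \<epsilon> = U z i \<epsilon>" by (auto simp: u_def)
  qed
  define d where "d p = word_den m xs (u p) (p 0)" for p
  define W where "W p = word_eval (GL n) (c0, xs) (hyp_subst m (u p) (p 0))" for p
  have c0': "c0 \<in> carrier_mat (2 * m) (2 * m)" using GL_carrier_mat[OF c0] n by simp
  have xs': "c \<in> carrier_mat (2 * m) (2 * m)" if "(i, \<epsilon>, c) \<in> set xs" for i \<epsilon> c
    using xs(2)[OF that] GL_carrier_mat n by blast
  have W: "W p \<in> carrier_mat n n" "d p \<cdot>\<^sub>m W p = word_num m c0 xs (u p) (p 0)" if "d p \<noteq> 0" for p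
    using word_eval_hyp_subst[of "u p" m c0 xs "p 0"] u c0 xs(2) that unfolding d_def W_def n by blast+
  have W_index: "W p $$ (i, j) * d p = word_num m c0 xs (u p) (p 0) $$ (i, j)" if "d p \<noteq> 0" "i < n" "j < n" for p i j
    using W[OF that(1)] that(2,3) by (metis carrier_matD index_smult_mat(1) mult.commute)
  have num: "mpoly_fun UNIV (\<lambda>p. word_num m c0 xs (u p) (p 0) $$ (i, j))" if "i < n" "j < n" for i j
    using that n by (intro mpoly_fun_word_num u u_mpoly mpoly_fun_var c0' xs') auto
  have cN: "vc N \<in> carrier (GL n)" "vc N \<in> carrier_mat n n" using mem[OF N(1)] by auto
  define C where "C = inv\<^bsub>GL n\<^esub> vc N"
  have C: "C \<in> carrier_mat n n" "vc N * C = 1\<^sub>m n" unfolding C_def using GL_inv[OF cN(1)] by auto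

  \<comment> \<open>The first factor of the leading coefficient must not vanish. The other vector of
    the first letter pairs nontrivially with the required one, and it is pulled back through
    \<open>c0\<close>.\<close>
  obtain v where v: "v \<in> carrier_vec n" "sform m (row_act v c0) (U z (vi 0) (- ve 0)) \<noteq> 0"
  proof -
    have "- ve 0 \<in> {1, -1}" using mem(2)[of 0] L by auto
    then have "sform m (U z (vi 0) (- ve 0)) (U z (vi 0) (- (- ve 0))) \<noteq> 0"
      using z_pm mem(1)[of 0] L by blast
    then obtain y where y: "y \<in> carrier_vec n" "sform m y (U z (vi 0) (- ve 0)) \<noteq> 0"
      using U sform_swap by (metis neg_0_equal_iff_equal)
    have i: "inv\<^bsub>GL n\<^esub> c0 \<in> carrier_mat n n" "inv\<^bsub>GL n\<^esub> c0 * c0 = 1\<^sub>m n"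
      using GL_inv[OF c0] by auto
    have "row_act (row_act y (inv\<^bsub>GL n\<^esub> c0)) c0 = y"
      using row_act_mult[OF i(1) GL_carrier_mat[OF c0] y(1)] i y by simp
    then show ?thesis using that[of "row_act y (inv\<^bsub>GL n\<^esub> c0)"] y row_act_carrier[OF i(1)] by simp
  qed
  define ys where "ys = take N xs"
  have xs_snoc: "xs = ys @ [(vi N, ve N, vc N)]"
    using take_Suc_conv_app_nth[of N xs] N xs_nth[of N] by (simp add: ys_def L_def)
  have ys': "c \<in> carrier_mat (2 * m) (2 * m)" if "(i, \<epsilon>, c) \<in> set ys" for i \<epsilon> c
    using xs'[of i \<epsilon> c] that xs_snoc by (metis Un_iff set_append)
  \<comment> \<open>The product of all scalar factors of the leading coefficient. It depends on
    \<open>p\<close>, because the varied vector may recur in the word, but not on coordinate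
    0.\<close>
  define \<kappa> where "\<kappa> p = sform m (lead_vec m (row_act v c0) ys (u p)) (u p (vi N) (- ve N))" for p
  have v0: "row_act v c0 \<in> carrier_vec (2 * m)" using row_act_carrier[OF c0'] .
  have \<kappa>: "mpoly_fun UNIV \<kappa>" unfolding \<kappa>_def[abs_def]
    by (intro mpoly_fun_sform mpoly_fun_lead_vec u u_mpoly v0 ys')
  have \<kappa>0: "\<kappa> p0 \<noteq> 0"
    unfolding \<kappa>_def u_p0 ys_def
    using lead_vec_sform_nonzero[of "U z" m xs "row_act v c0" N] U n xs' v(2) z_adj N
    by (simp add: adj_def vi_def ve_def vc_def L_def)
  have lead: "lead_vec m (row_act v c0) xs (u p) = \<kappa> p \<cdot>\<^sub>v row_act (u p (vi N) (ve N)) (vc N)" for p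
    by (subst xs_snoc) (simp add: lead_vec_snoc \<kappa>_def)

  \<comment> \<open>Index 0 selects the constant coordinate \<open>n - 1\<close>, and index
    \<open>j > 0\<close> the coordinate holding \<open>p j\<close>. In \<open>y\<close> below,
    \<open>C\<close> cancels the last constant of the word, so the leading coefficients are \<kappa>
    times the coordinates of the last letter's vector itself.\<close>
  define idx where "idx j = (if j = 0 then n - 1 else j - 1)" for j :: nat
  define y where "y j A = (\<Sum>k<n. (\<Sum>i<n. v $ i * A $$ (i, k)) * C $$ (k, idx j))" for j and A :: "'a mat"
  define Y where "Y j p = y j (word_num m c0 xs (u p) (p 0))" for j p
  have \<beta>: "word_den m xs (u (p(0 := s))) 1 = word_den m xs (u p) 1" for p s by (simp add: u_upd)
  show ?thesis
  proof (rule zariski_dim_ge_leading_terms[where l = L and d = d and \<beta> = "\<lambda>p. word_den m xs (u p) 1"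
        and K = K and W = W and y = y and Y = Y and \<kappa> = \<kappa> and c = "las z" and ?p0.0 = p0])
    show "word_image (GL n) (c0, xs) r (Sp m K) \<subseteq> carrier_mat n n"
    proof
      fix A assume "A \<in> word_image (GL n) (c0, xs) r (Sp m K)"
      then obtain g where g: "A = word_eval (GL n) (c0, xs) g" "g \<in> {1..r} \<rightarrow> Sp m K"
        unfolding word_image_def by blast
      have "c \<in> carrier (GL n) \<and> g i \<in> carrier (GL n)" if "(i, \<epsilon>, c) \<in> set xs" for i \<epsilon> c
        using xs(2)[OF that] g(2) Sp_subset_GL[of m K] n by blast
      then show "A \<in> carrier_mat n n" using g(1) word_eval_closed[OF c0] GL_carrier_mat by blast
    qed
    show "d p = p 0 ^ L * word_den m xs (u p) 1" for p
      unfolding d_def L_def by (rule word_den_factor)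
    show "d p0 \<noteq> 0" unfolding d_def word_den_nonzero u_p0 using z_pm xs(2) by (auto simp: p0_def)
    show "p0 i \<in> K" for i using z(1) subfield_setD(2)[OF K(2)] by (simp add: p0_def)
    show "W p \<in> word_image (GL n) (c0, xs) r (Sp m K)" if p: "\<And>i. p i \<in> K" "d p \<noteq> 0" for p
    proof -
      have "hyp_subst m (u p) (p 0) i \<in> Sp m K" for i
        unfolding hyp_subst_def using hyp_Sp[OF K(2) u u _ _ u_K[of p] u_K[of p] p(1)] one_in_Sp[OF K(2)] p(1) by simp
      then show ?thesis unfolding W_def word_image_def by blast
    qed
    show "rat_fun UNIV d (\<lambda>p. W p $$ (i, j))" if "i < n" "j < n" for i j
      unfolding rat_fun_def using num[OF that] W_index[OF _ that]
      by (intro exI[of _ 1] exI[of _ "\<lambda>p. word_num m c0 xs (u p) (p 0) $$ (i, j)"]) simp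
    show "y j \<in> poly_functions n" for j unfolding y_def[abs_def]
      by (intro poly_functions_sum poly_functions.mult poly_functions.const poly_functions.coord) auto
    show "mpoly_fun UNIV (Y j)" for j unfolding Y_def[abs_def] y_def
      by (intro mpoly_fun_sum mpoly_fun_mult mpoly_fun_const num) auto
    show "y j (W p) * d p = Y j p" if "d p \<noteq> 0" for j p
    proof -
      have summand: "v $ i * W p $$ (i, k) * d p = v $ i * word_num m c0 xs (u p) (p 0) $$ (i, k)"
        if "i < n" "k < n" for i k
        using W_index[OF \<open>d p \<noteq> 0\<close> that] by (simp only: mult.assoc)
      have row: "(\<Sum>i<n. v $ i * W p $$ (i, k)) * d p = (\<Sum>i<n. v $ i * word_num m c0 xs (u p) (p 0) $$ (i, k))"
        if "k < n" for k
        unfolding sum_distrib_right by (rule sum.cong[OF refl]) (rule summand[OF _ that], simp)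
      have col: "(\<Sum>i<n. v $ i * W p $$ (i, k)) * C $$ (k, idx j) * d p =
        (\<Sum>i<n. v $ i * word_num m c0 xs (u p) (p 0) $$ (i, k)) * C $$ (k, idx j)" if "k < n" for k
        unfolding row[OF that, symmetric] by (simp only: mult_ac)
      show ?thesis unfolding Y_def y_def sum_distrib_right[of _ _ "d p"]
        by (rule sum.cong[OF refl]) (rule col, simp)
    qed
    show "has_lead (\<lambda>s. Y j (p(0 := s))) (2 * L) (\<kappa> p * (if j = 0 then las z else p j))" if j: "j < n" for j p
    proof -
      let ?M = "word_num m c0 xs (u p)" and ?l = "lead_vec m (row_act v c0) xs (u p)"
      have M: "?M s \<in> carrier_mat n n" for s using word_num_carrier[OF c0' xs'] n by simp
      have ij: "idx j < n" using j by (auto simp: idx_def)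
      have "has_lead (\<lambda>s. \<Sum>k<n. row_act v (?M s) $ k * C $$ (k, idx j)) (2 * L + 0) (\<Sum>k<n. ?l $ k * C $$ (k, idx j))"
        unfolding L_def using v(1) n
        by (intro has_lead_sum has_lead_mult has_lead_const has_lead_word_num u c0' xs') auto
      moreover have "(\<Sum>k<n. row_act v (?M s) $ k * C $$ (k, idx j)) = Y j (p(0 := s))" for s
        unfolding Y_def y_def u_upd using row_act_index[OF M v(1)] by simp
      moreover have "(\<Sum>k<n. ?l $ k * C $$ (k, idx j)) = \<kappa> p * (if j = 0 then las z else p j)"
      proof -
        have un: "u p (vi N) (ve N) \<in> carrier_vec n" using u n by simp
        have "(\<Sum>k<n. ?l $ k * C $$ (k, idx j)) = row_act ?l C $ idx j"
          using lead_vec_carrier[OF v0 xs'] n row_act_index[OF C(1) _ ij] by simp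
        also have "row_act ?l C = \<kappa> p \<cdot>\<^sub>v row_act (row_act (u p (vi N) (ve N)) (vc N)) C"
          unfolding lead by (intro row_act_smult[OF C(1)] row_act_carrier[OF cN(2)])
        also have "row_act (row_act (u p (vi N) (ve N)) (vc N)) C = u p (vi N) (ve N)"
          using row_act_mult[OF cN(2) C(1) un] C(2) un by simp
        also have "(\<kappa> p \<cdot>\<^sub>v u p (vi N) (ve N)) $ idx j = \<kappa> p * (if j = 0 then las z else p j)"
          using ij un j by (auto simp: u_def idx_def)
        finally show ?thesis .
      qed
      ultimately show ?thesis by simp
    qed
    show "mpoly_fun UNIV (\<lambda>p. word_den m xs (u p) 1)" by (intro mpoly_fun_word_den u_mpoly)
    show "\<kappa> (p(0 := s)) = \<kappa> p" for p s by (simp add: \<kappa>_def u_upd)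
  qed (use K L \<kappa> \<kappa>0 z_las \<beta> in auto)
qed

section \<open>Maximal tori of the symplectic group\<close>

lemma Sp_D:
  assumes "A \<in> Sp m F"
  shows "A \<in> carrier_mat (2 * m) (2 * m)"
    "x \<in> carrier_vec (2 * m) \<Longrightarrow> y \<in> carrier_vec (2 * m) \<Longrightarrow> sform m (row_act x A) (row_act y A) = sform m x y"
  using assms unfolding Sp_iff_preserves by auto

lemma Sp_UNIV_mult:
  assumes "A \<in> Sp m UNIV" "B \<in> Sp m UNIV"
  shows "A * B \<in> Sp m (UNIV :: 'a::Fields.field set)"
proof -
  note A = Sp_D[OF assms(1)] and B = Sp_D[OF assms(2)]
  show ?thesis unfolding Sp_iff_preserves
    using mult_carrier_mat[OF A(1) B(1)] row_act_carrier[OF A(1)]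
    by (simp add: row_act_mult[OF A(1) B(1)] A(2) B(2))
qed

lemma Sp_UNIV_inv:
  assumes "A \<in> Sp m (UNIV :: 'a::Fields.field set)"
  shows "inv\<^bsub>GL (2 * m)\<^esub> A \<in> Sp m UNIV"
proof -
  have G: "A \<in> carrier (GL (2 * m))" using assms Sp_subset_GL by blast
  note A = Sp_D[OF assms] and I = GL_inv[OF G]
  have *: "row_act (row_act x (inv\<^bsub>GL (2 * m)\<^esub> A)) A = x" if "x \<in> carrier_vec (2 * m)" for x
    using row_act_mult[OF I(2) A(1) that] I(4) that by simp
  have "sform m (row_act x (inv\<^bsub>GL (2 * m)\<^esub> A)) (row_act y (inv\<^bsub>GL (2 * m)\<^esub> A)) = sform m x y"
    if "x \<in> carrier_vec (2 * m)" "y \<in> carrier_vec (2 * m)" for x y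
    using A(2)[OF row_act_carrier[OF I(2)] row_act_carrier[OF I(2)], of x y] *[OF that(1)] *[OF that(2)] by simp
  then show ?thesis unfolding Sp_iff_preserves using I(2) by simp
qed

definition eigenvector :: "nat \<Rightarrow> 'a::Fields.field mat set \<Rightarrow> 'a Matrix.vec \<Rightarrow> ('a mat \<Rightarrow> 'a) \<Rightarrow> bool" where
  "eigenvector n T v \<chi> \<longleftrightarrow> v \<in> carrier_vec n \<and> (\<forall>t\<in>T. row_act v t = \<chi> t \<cdot>\<^sub>v v)"

text \<open>Applying \<open>t\<close> multiplies \<open>sform m x y\<close> by the product of the
  two weights, yet leaves it unchanged.\<close>

lemma eigenvector_weights_inverse:
  assumes T: "T \<subseteq> Sp m UNIV" and "eigenvector (2 * m) T x \<chi>" "eigenvector (2 * m) T y \<psi>"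
    and "sform m x y \<noteq> 0" "t \<in> T"
  shows "\<chi> t * \<psi> t = 1"
proof -
  have xy: "x \<in> carrier_vec (2 * m)" "y \<in> carrier_vec (2 * m)"
    "row_act x t = \<chi> t \<cdot>\<^sub>v x" "row_act y t = \<psi> t \<cdot>\<^sub>v y"
    using assms unfolding eigenvector_def by auto
  have "sform m x y = sform m (row_act x t) (row_act y t)"
    using Sp_D(2)[of t m UNIV x y] T assms(5) xy by auto
  also have "\<dots> = \<chi> t * \<psi> t * sform m x y"
    unfolding xy(3,4) using xy by (simp add: sform_smult_left sform_smult_right)
  finally show ?thesis using assms(4) by simp
qed

text \<open>One step of the symplectic Gram-Schmidt process.\<close>

lemma eigenvector_project:
  assumes T: "T \<subseteq> Sp m UNIV" and a: "eigenvector (2 * m) T a \<alpha>" and b: "eigenvector (2 * m) T b \<beta>"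
    and ab: "sform m a b = 1" and e: "eigenvector (2 * m) T e \<chi>"
  shows "eigenvector (2 * m) T (e + ((- sform m e b) \<cdot>\<^sub>v a + sform m e a \<cdot>\<^sub>v b)) \<chi>"
  unfolding eigenvector_def
proof (intro conjI ballI)
  have c: "a \<in> carrier_vec (2 * m)" "b \<in> carrier_vec (2 * m)" "e \<in> carrier_vec (2 * m)"
    using a b e by (auto simp: eigenvector_def)
  then show "e + ((- sform m e b) \<cdot>\<^sub>v a + sform m e a \<cdot>\<^sub>v b) \<in> carrier_vec (2 * m)" by simp
  fix t assume t: "t \<in> T"
  have tc: "t \<in> carrier_mat (2 * m) (2 * m)" using T t Sp_D(1) by blast
  have \<alpha>\<beta>: "\<alpha> t * \<beta> t = 1" using eigenvector_weights_inverse[OF T a b _ t] ab by simp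
  \<comment> \<open>Where the coefficient is nonzero, \<open>e\<close> and \<open>b\<close> have
    inverse weights at \<open>t\<close>, as do \<open>a\<close> and \<open>b\<close>; so
    \<open>a\<close> is scaled by the same factor as \<open>e\<close>. The same holds for
    \<open>b\<close> in the next step.\<close>
  have p: "sform m e b * \<alpha> t = sform m e b * \<chi> t"
    using eigenvector_weights_inverse[OF T e b _ t] \<alpha>\<beta> by (cases "sform m e b = 0") (auto, metis mult.commute mult_cancel_left zero_neq_one mult_zero_left)
  have q: "sform m e a * \<beta> t = sform m e a * \<chi> t"
    using eigenvector_weights_inverse[OF T e a _ t] \<alpha>\<beta> by (cases "sform m e a = 0") (auto, metis mult.commute mult_cancel_left zero_neq_one mult_zero_left)
  have r: "row_act a t = \<alpha> t \<cdot>\<^sub>v a" "row_act b t = \<beta> t \<cdot>\<^sub>v b" "row_act e t = \<chi> t \<cdot>\<^sub>v e"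
    using a b e t by (auto simp: eigenvector_def)
  have "row_act (e + ((- sform m e b) \<cdot>\<^sub>v a + sform m e a \<cdot>\<^sub>v b)) t =
    \<chi> t \<cdot>\<^sub>v e + ((- sform m e b) \<cdot>\<^sub>v (\<alpha> t \<cdot>\<^sub>v a) + sform m e a \<cdot>\<^sub>v (\<beta> t \<cdot>\<^sub>v b))"
    using c by (simp add: row_act_add[OF tc] row_act_smult[OF tc] r)
  also have "\<dots> = \<chi> t \<cdot>\<^sub>v (e + ((- sform m e b) \<cdot>\<^sub>v a + sform m e a \<cdot>\<^sub>v b))"
    using c by (intro eq_vecI) (auto simp: distrib_left p q mult.assoc[symmetric] mult.commute[of "\<chi> t"],
        simp add: algebra_simps)
  finally show "row_act (e + ((- sform m e b) \<cdot>\<^sub>v a + sform m e a \<cdot>\<^sub>v b)) t =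
    \<chi> t \<cdot>\<^sub>v (e + ((- sform m e b) \<cdot>\<^sub>v a + sform m e a \<cdot>\<^sub>v b))" .
qed

text \<open>The \<open>2 * k\<close> orthogonality conditions are linear equations in more than
  \<open>2 * k\<close> coordinates.\<close>

lemma exists_common_orthogonal:
  fixes a b :: "nat \<Rightarrow> 'a::Fields.field Matrix.vec"
  assumes "k < m" and ab: "\<And>i. i < k \<Longrightarrow> a i \<in> carrier_vec (2 * m) \<and> b i \<in> carrier_vec (2 * m)"
  shows "\<exists>x\<in>carrier_vec (2 * m). x \<noteq> 0\<^sub>v (2 * m) \<and> (\<forall>i<k. sform m x (a i) = 0 \<and> sform m x (b i) = 0)"
proof -
  define c where "c i = (if i < k then a i else b (i - k))" for i
  have c: "c i \<in> carrier_vec (2 * m)" if "i < 2 * k" for i using ab that by (auto simp: c_def)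
  obtain q where q: "\<exists>j\<in>{..<2 * m}. q j \<noteq> 0"
    "\<forall>i\<in>{..<2 * k}. (\<Sum>j\<in>{..<2 * m}. q j * (symplectic_form m *\<^sub>v c i) $ j) = 0"
    using homogeneous_system_nontrivial[of "{..<2 * k}" "{..<2 * m}" "\<lambda>i j. (symplectic_form m *\<^sub>v c i) $ j"] assms(1) by auto
  define x where "x = Matrix.vec (2 * m) q"
  have x: "x \<in> carrier_vec (2 * m)" by (simp add: x_def)
  have "sform m x (c i) = 0" if "i < 2 * k" for i
    using q(2) that sform_eq_scalar_prod[OF x c[OF that]]
    by (simp add: x_def scalar_prod_def lessThan_atLeast0 del: index_mult_mat_vec)
  then have "sform m x (c i) = 0 \<and> sform m x (c (k + i)) = 0" if "i < k" for i using that by simp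
  then have "\<forall>i<k. sform m x (a i) = 0 \<and> sform m x (b i) = 0" by (auto simp: c_def)
  moreover have "x \<noteq> 0\<^sub>v (2 * m)" using q(1) unfolding x_def by (metis index_vec index_zero_vec(1) lessThan_iff)
  ultimately show ?thesis using x by blast
qed

text \<open>Symplectic Gram-Schmidt among common eigenvectors. Besides \<open>k\<close> hyperbolic
  pairs, the induction carries the projections \<open>E j\<close> of the given eigenvectors to the
  orthogonal complement of these pairs, and the fact that they still detect every nonzero vector of
  the complement; this is what supplies the next pair.\<close>

lemma symplectic_eigenbasis:
  fixes e :: "nat \<Rightarrow> 'a::Fields.field Matrix.vec"
  assumes T: "T \<subseteq> Sp m UNIV"
    and e: "\<And>j. j \<in> J \<Longrightarrow> \<exists>\<chi>. eigenvector (2 * m) T (e j) \<chi>"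
    and detect: "\<And>x. x \<in> carrier_vec (2 * m) \<Longrightarrow> x \<noteq> 0\<^sub>v (2 * m) \<Longrightarrow> \<exists>j\<in>J. sform m x (e j) \<noteq> 0"
  shows "k \<le> m \<Longrightarrow> \<exists>a b E.
    (\<forall>i<k. (\<exists>\<chi>. eigenvector (2 * m) T (a i) \<chi>) \<and> (\<exists>\<chi>. eigenvector (2 * m) T (b i) \<chi>)) \<and>
    (\<forall>i<k. \<forall>j<k. sform m (a i) (b j) = (if i = j then 1 else 0) \<and> sform m (a i) (a j) = 0 \<and> sform m (b i) (b j) = 0) \<and>
    (\<forall>j\<in>J. (\<exists>\<chi>. eigenvector (2 * m) T (E j) \<chi>) \<and> (\<forall>i<k. sform m (E j) (a i) = 0 \<and> sform m (E j) (b i) = 0)) \<and>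
    (\<forall>x\<in>carrier_vec (2 * m). x \<noteq> 0\<^sub>v (2 * m) \<longrightarrow> (\<forall>i<k. sform m x (a i) = 0 \<and> sform m x (b i) = 0) \<longrightarrow>
       (\<exists>j\<in>J. sform m x (E j) \<noteq> 0))"
proof (induction k)
  case 0
  then show ?case using e detect by (intro exI[of _ e]) auto
next
  case (Suc k)
  from Suc.IH[OF Suc_leD[OF Suc.prems]] obtain a b E where IH:
    "\<forall>i<k. (\<exists>\<chi>. eigenvector (2 * m) T (a i) \<chi>) \<and> (\<exists>\<chi>. eigenvector (2 * m) T (b i) \<chi>)"
    "\<forall>i<k. \<forall>j<k. sform m (a i) (b j) = (if i = j then 1 else 0) \<and> sform m (a i) (a j) = 0 \<and> sform m (b i) (b j) = 0"
    "\<forall>j\<in>J. (\<exists>\<chi>. eigenvector (2 * m) T (E j) \<chi>) \<and> (\<forall>i<k. sform m (E j) (a i) = 0 \<and> sform m (E j) (b i) = 0)"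
    "\<forall>x\<in>carrier_vec (2 * m). x \<noteq> 0\<^sub>v (2 * m) \<longrightarrow> (\<forall>i<k. sform m x (a i) = 0 \<and> sform m x (b i) = 0) \<longrightarrow>
       (\<exists>j\<in>J. sform m x (E j) \<noteq> 0)"
    by (elim exE conjE) (rule that)
  note ab = IH(1)[rule_format] and rel = IH(2)[rule_format] and det = IH(4)[rule_format]
  have E: "\<exists>\<chi>. eigenvector (2 * m) T (E j) \<chi>" if "j \<in> J" for j using IH(3) that by blast
  have orth: "sform m (E j) (a i) = 0 \<and> sform m (E j) (b i) = 0" if "j \<in> J" "i < k" for i j
    using IH(3) that by blast
  have abc: "a i \<in> carrier_vec (2 * m) \<and> b i \<in> carrier_vec (2 * m)" if "i < k" for i
    using ab[OF that] by (auto simp: eigenvector_def)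
  have Ec: "E j \<in> carrier_vec (2 * m)" if "j \<in> J" for j using E[OF that] by (auto simp: eigenvector_def)
  \<comment> \<open>As k < m, the complement contains a nonzero vector, so some \<open>E j\<close>
    is nonzero. Since \<open>E j\<close> lies in the complement itself, it pairs nontrivially with
    some \<open>E j'\<close>, and rescaling gives the new pair.\<close>
  obtain x where "x \<in> carrier_vec (2 * m)" "x \<noteq> 0\<^sub>v (2 * m)" "\<forall>i<k. sform m x (a i) = 0 \<and> sform m x (b i) = 0"
    using exists_common_orthogonal[of k m a b] abc Suc.prems by auto
  then obtain j where j: "j \<in> J" "sform m x (E j) \<noteq> 0" using det by blast
  have "sform m x (0\<^sub>v (2 * m)) = 0" by (simp add: sform_def)
  then have "E j \<noteq> 0\<^sub>v (2 * m)" using j by auto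
  then obtain j' where j': "j' \<in> J" "sform m (E j) (E j') \<noteq> 0" using det[OF Ec[OF j(1)]] orth[OF j(1)] by blast
  define a' where "a' = E j"
  define b' where "b' = inverse (sform m (E j) (E j')) \<cdot>\<^sub>v E j'"
  obtain \<alpha> where \<alpha>: "eigenvector (2 * m) T a' \<alpha>" using E[OF j(1)] by (auto simp: a'_def)
  have c': "a' \<in> carrier_vec (2 * m)" "b' \<in> carrier_vec (2 * m)" using Ec j j' by (auto simp: a'_def b'_def)
  obtain \<beta> where \<beta>: "eigenvector (2 * m) T b' \<beta>"
  proof -
    obtain \<chi> where \<chi>: "eigenvector (2 * m) T (E j') \<chi>" using E[OF j'(1)] by blast
    have "row_act b' t = \<chi> t \<cdot>\<^sub>v b'" if "t \<in> T" for t
    proof -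
      have "t \<in> carrier_mat (2 * m) (2 * m)" using T that Sp_D(1) by blast
      then show ?thesis using \<chi> that Ec[OF j'(1)]
        by (auto simp: b'_def row_act_smult[of t "2 * m" "2 * m"] eigenvector_def smult_smult_assoc mult.commute)
    qed
    then show ?thesis using that c' by (auto simp: eigenvector_def)
  qed
  have ab': "sform m a' b' = 1" using j' Ec by (simp add: a'_def b'_def sform_smult_right)
  have orth': "sform m a' (a i) = 0" "sform m a' (b i) = 0" "sform m b' (a i) = 0" "sform m b' (b i) = 0" if "i < k" for i
    using orth[OF j(1) that] orth[OF j'(1) that] Ec j j' by (auto simp: a'_def b'_def sform_smult_left)
  then have orth'': "sform m (a i) a' = 0" "sform m (b i) a' = 0" "sform m (a i) b' = 0" "sform m (b i) b' = 0" if "i < k" for i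
    using that sform_swap[of m _ a'] sform_swap[of m _ b'] by auto
  define E' where "E' j = E j + ((- sform m (E j) b') \<cdot>\<^sub>v a' + sform m (E j) a' \<cdot>\<^sub>v b')" for j
  have pr: "sform m (E' l) x = sform m (E l) x - sform m (E l) b' * sform m a' x + sform m (E l) a' * sform m b' x"
    if "l \<in> J" for l x
    using c' Ec[OF that] by (simp add: E'_def sform_add_left sform_smult_left)
  define A where "A = a(k := a')"
  define B where "B = b(k := b')"
  have "\<forall>i<Suc k. (\<exists>\<chi>. eigenvector (2 * m) T (A i) \<chi>) \<and> (\<exists>\<chi>. eigenvector (2 * m) T (B i) \<chi>)"
    using ab \<alpha> \<beta> by (auto simp: A_def B_def less_Suc_eq)
  moreover have "\<forall>i<Suc k. \<forall>j<Suc k. sform m (A i) (B j) = (if i = j then 1 else 0) \<and>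
      sform m (A i) (A j) = 0 \<and> sform m (B i) (B j) = 0"
    using rel ab' orth' orth'' by (auto simp: A_def B_def less_Suc_eq)
  moreover have "\<forall>j\<in>J. (\<exists>\<chi>. eigenvector (2 * m) T (E' j) \<chi>) \<and>
      (\<forall>i<Suc k. sform m (E' j) (A i) = 0 \<and> sform m (E' j) (B i) = 0)"
  proof (intro ballI conjI allI impI)
    fix l assume l: "l \<in> J"
    show "\<exists>\<chi>. eigenvector (2 * m) T (E' l) \<chi>"
      unfolding E'_def using eigenvector_project[OF T \<alpha> \<beta> ab'] E[OF l] by blast
    fix i assume i: "i < Suc k"
    show "sform m (E' l) (A i) = 0" "sform m (E' l) (B i) = 0"
      using i orth[OF l] orth' ab' sform_swap[of m b' a'] unfolding pr[OF l]
      by (auto simp: A_def B_def less_Suc_eq)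
  qed
  moreover have "\<exists>j\<in>J. sform m x (E' j) \<noteq> 0"
    if x: "x \<in> carrier_vec (2 * m)" "x \<noteq> 0\<^sub>v (2 * m)" "\<forall>i<Suc k. sform m x (A i) = 0 \<and> sform m x (B i) = 0" for x
  proof -
    have "\<forall>i<k. sform m x (a i) = 0 \<and> sform m x (b i) = 0"
      using x(3) by (auto simp: A_def B_def less_Suc_eq split: if_splits)
    then obtain l where l: "l \<in> J" "sform m x (E l) \<noteq> 0" using det x by blast
    have "sform m x a' = 0" "sform m x b' = 0" using x(3) by (auto simp: A_def B_def)
    then have "sform m x (E' l) = sform m x (E l)"
      using c' Ec[OF l(1)] by (simp add: E'_def sform_add_right sform_smult_right)
    then show ?thesis using l by (intro bexI[of _ l]) simp_all
  qed
  ultimately show ?case by (intro exI[of _ A] exI[of _ B] exI[of _ E']) auto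
qed

lemma symplectic_rows_Sp:
  fixes a b :: "nat \<Rightarrow> 'a::Fields.field Matrix.vec"
  assumes ab: "\<And>i. i < m \<Longrightarrow> a i \<in> carrier_vec (2 * m) \<and> b i \<in> carrier_vec (2 * m)"
    and rel: "\<And>i j. i < m \<Longrightarrow> j < m \<Longrightarrow> sform m (a i) (b j) = (if i = j then 1 else 0) \<and>
      sform m (a i) (a j) = 0 \<and> sform m (b i) (b j) = 0"
  shows "\<exists>E\<in>Sp m UNIV. (\<forall>i<m. Matrix.row E i = a i \<and> Matrix.row E (m + i) = b i)"
proof -
  define c where "c i = (if i < m then a i else b (i - m))" for i
  define E where "E = Matrix.mat (2 * m) (2 * m) (\<lambda>(i, j). c i $ j)"
  have Ec: "E \<in> carrier_mat (2 * m) (2 * m)" by (simp add: E_def)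
  have cc: "c i \<in> carrier_vec (2 * m)" if "i < 2 * m" for i using ab that by (auto simp: c_def)
  have row: "Matrix.row E i = c i" if "i < 2 * m" for i
    using that cc[OF that] unfolding E_def by (intro eq_vecI) auto
  have "E * symplectic_form m * transpose_mat E = symplectic_form m"
  proof (rule eq_matI)
    fix i j assume "i < dim_row (symplectic_form m :: 'a mat)" "j < dim_col (symplectic_form m :: 'a mat)"
    then have ij: "i < 2 * m" "j < 2 * m" by auto
    have M: "E * symplectic_form m * transpose_mat E \<in> carrier_mat (2 * m) (2 * m)"
      using Ec by (intro mult_carrier_mat[of _ _ "2 * m"]) auto
    have "(E * symplectic_form m * transpose_mat E) $$ (i, j) =
      scalar_prod (unit_vec (2 * m) i) ((E * symplectic_form m * transpose_mat E) *\<^sub>v unit_vec (2 * m) j)"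
      using ij carrier_matD[OF M] mult_mat_vec_carrier[OF M, of "unit_vec (2 * m) j"]
      by (simp del: index_mult_mat(2,3))
    also have "\<dots> = sform m (c i) (c j)"
      using sform_row_act[OF Ec, of "unit_vec (2 * m) i" "unit_vec (2 * m) j"] row ij
      by (simp add: row_act_unit[OF Ec])
    also have "\<dots> = symplectic_form m $$ (i, j)"
      using ij rel sform_swap[of m "b (i - m)" "a j"]
      by (auto simp: symplectic_form_index c_def)
    finally show "(E * symplectic_form m * transpose_mat E) $$ (i, j) = symplectic_form m $$ (i, j)" .
  qed (use Ec in auto)
  then have "E \<in> Sp m UNIV" using Ec by (simp add: Sp_def)
  then show ?thesis using row by (intro bexI[of _ E]) (auto simp: c_def)
qed

section \<open>The diagonal symplectic torus and its conjugates\<close>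

definition sp_diag :: "nat \<Rightarrow> (nat \<Rightarrow> 'a::Fields.field) \<Rightarrow> 'a mat" where
  "sp_diag m x = Matrix.mat (2 * m) (2 * m)
     (\<lambda>(i, j). if i = j then if i < m then x i else inverse (x (i - m)) else 0)"

definition sp_torus :: "nat \<Rightarrow> 'a::Fields.field mat \<Rightarrow> 'a mat set" where
  "sp_torus m E = {inv\<^bsub>GL (2 * m)\<^esub> E * sp_diag m x * E | x. \<forall>i<m. x i \<noteq> 0}"

lemma sp_diag_carrier [simp]: "sp_diag m x \<in> carrier_mat (2 * m) (2 * m)"
  by (simp add: sp_diag_def)

lemma row_act_sp_diag_carrier [simp]:
  "row_act v (sp_diag m x) \<in> carrier_vec (2 * m)" "dim_vec (row_act v (sp_diag m x)) = 2 * m"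
  using row_act_carrier[OF sp_diag_carrier[of m x], of v] by auto

lemma row_act_sp_diag:
  assumes "v \<in> carrier_vec (2 * m)" "j < 2 * m"
  shows "row_act v (sp_diag m x) $ j = v $ j * (if j < m then x j else inverse (x (j - m)))"
proof -
  have "row_act v (sp_diag m x) $ j = (\<Sum>i<2 * m. v $ i * sp_diag m x $$ (i, j))"
    using assms by (simp add: row_act_index[of _ "2 * m" "2 * m"])
  also have "\<dots> = (\<Sum>i<2 * m. if i = j then v $ j * (if j < m then x j else inverse (x (j - m))) else 0)"
    using assms by (intro sum.cong) (auto simp: sp_diag_def)
  finally show ?thesis using assms by simp
qed

lemma sp_diag_Sp:
  assumes "\<forall>i<m. x i \<noteq> 0"
  shows "sp_diag m x \<in> Sp m UNIV"
  unfolding Sp_iff_preserves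
proof (intro conjI ballI)
  fix v w :: "'a Matrix.vec" assume "v \<in> carrier_vec (2 * m)" "w \<in> carrier_vec (2 * m)"
  then show "sform m (row_act v (sp_diag m x)) (row_act w (sp_diag m x)) = sform m v w"
    unfolding sform_def using assms
    by (intro sum.cong) (auto simp: row_act_sp_diag field_simps)
qed auto

lemma sp_diag_mult: "sp_diag m x * sp_diag m y = sp_diag m (\<lambda>i. x i * y i)"
proof (rule mat_eq_row_act[where n = "2 * m"])
  fix v :: "'a Matrix.vec" assume v: "v \<in> carrier_vec (2 * m)"
  show "row_act v (sp_diag m x * sp_diag m y) = row_act v (sp_diag m (\<lambda>i. x i * y i))"
    using v by (intro eq_vecI) (auto simp: row_act_mult[OF sp_diag_carrier sp_diag_carrier] row_act_sp_diag)
qed (auto intro: mult_carrier_mat[OF sp_diag_carrier sp_diag_carrier])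

lemma sp_diag_one: "sp_diag m (\<lambda>_. 1) = 1\<^sub>m (2 * m)"
  by (rule eq_matI) (auto simp: sp_diag_def)

lemma diagonal_sp_diag: "diagonal_mat (sp_diag m x)"
  by (auto simp: diagonal_mat_def sp_diag_def)

lemma mult_cancel_inner:
  fixes A B C D F :: "'a::Fields.field mat"
  assumes "A \<in> carrier_mat n n" "B \<in> carrier_mat n n" "C \<in> carrier_mat n n" "D \<in> carrier_mat n n" "F \<in> carrier_mat n n"
    and "C * D = 1\<^sub>m n"
  shows "(A * B * C) * (D * F) = A * B * F"
proof -
  have AB: "A * B \<in> carrier_mat n n" using assms by simp
  have "(A * B * C) * (D * F) = A * B * (C * (D * F))"
    using assoc_mult_mat[OF AB assms(3) mult_carrier_mat[OF assms(4,5)]] .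
  also have "C * (D * F) = F" using assoc_mult_mat[OF assms(3,4,5)] assms(5,6) by simp
  finally show ?thesis .
qed

lemma sp_torus_conj:
  assumes E: "E \<in> carrier (GL (2 * m))"
  shows "E * (inv\<^bsub>GL (2 * m)\<^esub> E * sp_diag m x * E) * inv\<^bsub>GL (2 * m)\<^esub> E = sp_diag m x"
    and "t \<in> carrier_mat (2 * m) (2 * m) \<Longrightarrow>
      inv\<^bsub>GL (2 * m)\<^esub> E * (E * t * inv\<^bsub>GL (2 * m)\<^esub> E) * E = t"
proof -
  let ?n = "2 * m" and ?I = "inv\<^bsub>GL (2 * m)\<^esub> E"
  note I = GL_inv[OF E] and Ec = GL_carrier_mat[OF E]
  have conj: "A * (B * t * A) * B = t"
    if "A \<in> carrier_mat ?n ?n" "B \<in> carrier_mat ?n ?n" "t \<in> carrier_mat ?n ?n" "A * B = 1\<^sub>m ?n"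
    for A B t :: "'a mat"
  proof -
    have Bt: "B * t \<in> carrier_mat ?n ?n" using that by simp
    have "A * (B * t * A) * B = A * (B * t) * A * B" using assoc_mult_mat[OF that(1) Bt that(1)] by simp
    also have "A * (B * t) = t" using assoc_mult_mat[OF that(1-3)] that by simp
    also have "t * A * B = t" using assoc_mult_mat[OF that(3,1,2)] that by simp
    finally show ?thesis .
  qed
  show "E * (?I * sp_diag m x * E) * ?I = sp_diag m x" using conj[OF Ec I(2) _ I(3)] by simp
  show "?I * (E * t * ?I) * E = t" if "t \<in> carrier_mat ?n ?n" using conj[OF I(2) Ec that I(4)] .
qed

lemma sp_torus_subset_Sp:
  assumes "E \<in> Sp m UNIV"
  shows "sp_torus m E \<subseteq> Sp m UNIV"
proof
  fix t assume "t \<in> sp_torus m E"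
  then obtain x where x: "\<forall>i<m. x i \<noteq> 0" "t = inv\<^bsub>GL (2 * m)\<^esub> E * sp_diag m x * E"
    unfolding sp_torus_def by blast
  show "t \<in> Sp m UNIV" unfolding x(2)
    by (intro Sp_UNIV_mult Sp_UNIV_inv assms sp_diag_Sp x(1))
qed

lemma poly_functions_conj_index:
  assumes "A \<in> carrier_mat n n" "B \<in> carrier_mat n n" "i < n" "j < n"
  shows "\<exists>p\<in>poly_functions n. \<forall>t\<in>carrier_mat n n. (A * t * B) $$ (i, j) = p t"
proof (rule bexI)
  let ?p = "\<lambda>t. \<Sum>k<n. (\<Sum>l<n. A $$ (i, l) * t $$ (l, k)) * B $$ (k, j)"
  show "?p \<in> poly_functions n"
    by (intro poly_functions_sum poly_functions.mult poly_functions.const poly_functions.coord) auto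
  show "\<forall>t\<in>carrier_mat n n. (A * t * B) $$ (i, j) = ?p t"
  proof
    fix t :: "'a mat" assume t: "t \<in> carrier_mat n n"
    show "(A * t * B) $$ (i, j) = ?p t"
      unfolding mat_mult_index[OF mult_carrier_mat[OF assms(1) t] assms(2-4)]
      by (intro sum.cong refl) (simp add: mat_mult_index[OF assms(1) t assms(3)])
  qed
qed

text \<open>After conjugation by \<open>E\<close>, the torus is cut out of the invertible matrices
  by the vanishing of the off-diagonal entries and by the equations making diagonal entries i and m
  + i inverse to each other.\<close>

lemma sp_torus_closedin:
  fixes E :: "'a::Fields.field mat"
  assumes E: "E \<in> Sp m UNIV"
  shows "closedin (subtopology (zariski (2 * m)) (carrier (GL (2 * m)))) (sp_torus m E)"
proof -
  let ?n = "2 * m" and ?I = "inv\<^bsub>GL (2 * m)\<^esub> E"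
  have EG: "E \<in> carrier (GL ?n)" using E Sp_subset_GL by blast
  note I = GL_inv[OF EG] and Ec = GL_carrier_mat[OF EG]
  have "\<forall>ij\<in>{..<?n} \<times> {..<?n}. \<exists>p\<in>poly_functions ?n. \<forall>t\<in>carrier_mat ?n ?n. (E * t * ?I) $$ ij = p t"
    using poly_functions_conj_index[OF Ec I(2)] by auto
  then obtain P where "\<forall>ij\<in>{..<?n} \<times> {..<?n}. P ij \<in> poly_functions ?n \<and> (\<forall>t\<in>carrier_mat ?n ?n. (E * t * ?I) $$ ij = P ij t)"
    by metis
  then have P: "\<And>i j. i < ?n \<Longrightarrow> j < ?n \<Longrightarrow> P (i, j) \<in> poly_functions ?n"
    "\<And>i j t. i < ?n \<Longrightarrow> j < ?n \<Longrightarrow> t \<in> carrier_mat ?n ?n \<Longrightarrow> (E * t * ?I) $$ (i, j) = P (i, j) t" by auto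
  define Q where "Q = (\<lambda>(i, j). P (i, j)) ` {(i, j). i < ?n \<and> j < ?n \<and> i \<noteq> j} \<union>
    (\<lambda>i t. P (i, i) t * P (m + i, m + i) t + - 1) ` {..<m}"
  have Q: "q \<in> poly_functions ?n" if qQ: "q \<in> Q" for q
  proof -
    consider i j where "q = P (i, j)" "i < ?n" "j < ?n"
      | i where "q = (\<lambda>t. P (i, i) t * P (m + i, m + i) t + - 1)" "i < m"
      using qQ unfolding Q_def by auto
    then show ?thesis
    proof cases
      case (2 i)
      show ?thesis unfolding 2(1)
        by (intro poly_functions.add poly_functions.mult poly_functions.const P(1)) (use 2(2) in auto)
    qed (simp add: P(1))
  qed
  define C where "C = \<Inter> (insert (carrier_mat ?n ?n) ((\<lambda>q. {t \<in> carrier_mat ?n ?n. q t = 0}) ` Q))"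
  have "closedin (zariski ?n) C" unfolding C_def
  proof (rule closedin_Inter)
    fix S assume "S \<in> insert (carrier_mat ?n ?n) ((\<lambda>q. {t \<in> carrier_mat ?n ?n. q t = 0}) ` Q)"
    then show "closedin (zariski ?n) S"
      using closedin_zeros[OF Q] closedin_topspace[of "zariski ?n :: 'a mat topology"] by auto
  qed simp
  moreover have "sp_torus m E = C \<inter> carrier (GL ?n)"
  proof (intro subset_antisym subsetI)
    fix t assume t: "t \<in> sp_torus m E"
    then have tG: "t \<in> carrier (GL ?n)" using sp_torus_subset_Sp[OF E] Sp_subset_GL by blast
    then have tc: "t \<in> carrier_mat ?n ?n" by (rule GL_carrier_mat)
    obtain x where x: "\<forall>i<m. x i \<noteq> 0" "t = ?I * sp_diag m x * E" using t unfolding sp_torus_def by blast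
    then have D: "E * t * ?I = sp_diag m x" using sp_torus_conj(1)[OF EG] by simp
    have Pd: "P (i, j) t = sp_diag m x $$ (i, j)" if "i < ?n" "j < ?n" for i j
      using P(2)[OF that tc] D by simp
    have "q t = 0" if "q \<in> Q" for q
      using that x(1) unfolding Q_def by (auto simp: Pd sp_diag_def)
    then show "t \<in> C \<inter> carrier (GL ?n)" using tc tG unfolding C_def by auto
  next
    fix t assume t: "t \<in> C \<inter> carrier (GL ?n)"
    then have tc: "t \<in> carrier_mat ?n ?n" using GL_carrier_mat by blast
    have Q0: "q t = 0" if "q \<in> Q" for q using t that unfolding C_def by auto
    define x where "x i = P (i, i) t" for i
    have off: "P (i, j) t = 0" if "i < ?n" "j < ?n" "i \<noteq> j" for i j
      using Q0[of "P (i, j)"] that unfolding Q_def by force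
    have dia: "x i * P (m + i, m + i) t = 1" if "i < m" for i
      using Q0[of "\<lambda>t. P (i, i) t * P (m + i, m + i) t + - 1"] that unfolding Q_def x_def by auto
    then have x: "\<forall>i<m. x i \<noteq> 0" by force
    have dia': "P (i, i) t = inverse (x (i - m))" if "m \<le> i" "i < ?n" for i
      using inverse_unique[OF dia[of "i - m"]] that by simp
    have Etc: "E * t * ?I \<in> carrier_mat ?n ?n" by (intro mult_carrier_mat[of _ _ ?n] Ec tc I)
    have "E * t * ?I = sp_diag m x"
    proof (rule eq_matI)
      fix i j assume "i < dim_row (sp_diag m x)" "j < dim_col (sp_diag m x)"
      then have ij: "i < ?n" "j < ?n" by (auto simp: sp_diag_def)
      show "(E * t * ?I) $$ (i, j) = sp_diag m x $$ (i, j)"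
        using ij off[OF ij] dia'[of i] P(2)[OF ij tc] by (auto simp: sp_diag_def x_def)
    qed (use Ec I in \<open>auto simp: sp_diag_def\<close>)
    then have "t = ?I * sp_diag m x * E" using sp_torus_conj(2)[OF EG tc] by simp
    then show "t \<in> sp_torus m E" using x unfolding sp_torus_def by blast
  qed
  ultimately show ?thesis by (auto simp: closedin_subtopology)
qed

text \<open>The torus is the image of a rational parametrisation, hence even irreducible. The
  product of all parameters serves as the single denominator: it becomes polynomial after
  multiplication by any of the inverses.\<close>

lemma sp_torus_connected:
  fixes E :: "'a::Fields.field mat"
  assumes inf: "infinite (UNIV :: 'a set)" and E: "E \<in> Sp m UNIV"
  shows "connectedin (zariski (2 * m)) (sp_torus m E)"
proof -
  let ?n = "2 * m" and ?I = "inv\<^bsub>GL (2 * m)\<^esub> E"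
  have EG: "E \<in> carrier (GL ?n)" using E Sp_subset_GL by blast
  note I = GL_inv[OF EG] and Ec = GL_carrier_mat[OF EG]
  define W where "W x = ?I * sp_diag m x * E" for x
  define d where "d x = (\<Prod>i<m. x i)" for x :: "nat \<Rightarrow> 'a"
  let ?G = "grid {..<m} (UNIV :: 'a set) (\<lambda>_. 1) d"
  have dpoly: "mpoly_fun {..<m} d" unfolding d_def[abs_def] by (intro mpoly_fun_prod mpoly_fun_var)
  have inv: "rat_fun {..<m} d (\<lambda>x. inverse (x i))" if "i < m" for i
    unfolding rat_fun_def
  proof (intro exI[of _ 1] exI[of _ "\<lambda>x. \<Prod>j\<in>{..<m} - {i}. x j"] conjI allI impI)
    fix x assume "d x \<noteq> 0"
    then have "x i \<noteq> 0" using that by (auto simp: d_def)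
    moreover have "d x = x i * (\<Prod>j\<in>{..<m} - {i}. x j)"
      unfolding d_def using that by (simp add: prod.remove)
    ultimately show "inverse (x i) * d x ^ 1 = (\<Prod>j\<in>{..<m} - {i}. x j)" by simp
  qed (intro mpoly_fun_prod mpoly_fun_var)
  have diag: "rat_fun {..<m} d (\<lambda>x. sp_diag m x $$ (i, j))" if "i < ?n" "j < ?n" for i j
    using that inv[of "i - m"] rat_fun_poly[OF mpoly_fun_var] rat_fun_poly[OF mpoly_fun_const]
    by (cases "i = j"; cases "i < m") (auto simp: sp_diag_def)
  have "rat_fun {..<m} d (\<lambda>x. W x $$ (i, j))" if ij: "i < ?n" "j < ?n" for i j
  proof -
    obtain p where p: "p \<in> poly_functions ?n" "\<forall>t\<in>carrier_mat ?n ?n. (?I * t * E) $$ (i, j) = p t"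
      using poly_functions_conj_index[OF I(2) Ec ij] by blast
    have "rat_fun {..<m} d (\<lambda>x. p (sp_diag m x))"
      by (rule rat_fun_poly_function[OF p(1) dpoly diag])
    then show ?thesis using p(2) unfolding W_def by simp
  qed
  moreover have "W x \<in> carrier_mat ?n ?n" for x
    unfolding W_def by (intro mult_carrier_mat[of _ _ ?n] I Ec sp_diag_carrier)
  moreover have "(\<lambda>_. 1) \<in> ?G" by (simp add: grid_def d_def)
  ultimately have "poly_irreducible ?n (W ` ?G)"
    using inf dpoly by (intro poly_irreducible_image) auto
  moreover have "W ` ?G = sp_torus m E"
  proof (intro subset_antisym subsetI)
    fix t assume "t \<in> sp_torus m E"
    then obtain x where x: "\<forall>i<m. x i \<noteq> 0" "t = W x" unfolding sp_torus_def W_def by blast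
    \<comment> \<open>Parameters from \<open>m\<close> on do not affect the matrix, so they can be
      reset to the base value 1 required by \<open>grid\<close>.\<close>
    have "sp_diag m x = sp_diag m (\<lambda>i. if i < m then x i else 1)"
      unfolding sp_diag_def by (intro cong_mat) auto
    then have "t = W (\<lambda>i. if i < m then x i else 1)" using x(2) by (simp add: W_def)
    then show "t \<in> W ` ?G" using x(1) by (auto simp: grid_def d_def)
  qed (auto simp: sp_torus_def W_def grid_def d_def)
  ultimately show ?thesis using poly_irreducible_connected by metis
qed

lemma torus_sp_torus:
  fixes E :: "'a::Fields.field mat"
  assumes inf: "infinite (UNIV :: 'a set)" and E: "E \<in> Sp m UNIV"
  shows "torus (2 * m) (sp_torus m E)"
proof -
  let ?n = "2 * m" and ?I = "inv\<^bsub>GL (2 * m)\<^esub> E"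
  have EG: "E \<in> carrier (GL ?n)" using E Sp_subset_GL by blast
  note I = GL_inv[OF EG] and Ec = GL_carrier_mat[OF EG]
  have c: "?I * sp_diag m x * E \<in> carrier_mat ?n ?n" for x
    by (intro mult_carrier_mat[of _ _ ?n] I Ec sp_diag_carrier)
  have sub: "sp_torus m E \<subseteq> carrier (GL ?n)" using sp_torus_subset_Sp[OF E] Sp_subset_GL by blast
  have prod: "(?I * sp_diag m x * E) * (?I * sp_diag m y * E) = ?I * sp_diag m (\<lambda>i. x i * y i) * E" for x y
  proof -
    have "(?I * sp_diag m x * E) * (?I * (sp_diag m y * E)) = ?I * sp_diag m x * (sp_diag m y * E)"
      by (rule mult_cancel_inner[OF I(2) sp_diag_carrier Ec I(2) _ I(3)]) (intro mult_carrier_mat[of _ _ ?n] sp_diag_carrier Ec)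
    also have "\<dots> = ?I * (sp_diag m x * sp_diag m y) * E"
      using assoc_mult_mat[OF mult_carrier_mat[OF I(2) sp_diag_carrier] sp_diag_carrier Ec]
        assoc_mult_mat[OF I(2) sp_diag_carrier sp_diag_carrier] by simp
    finally show ?thesis using assoc_mult_mat[OF I(2) sp_diag_carrier Ec] by (simp add: sp_diag_mult)
  qed
  have one: "?I * sp_diag m (\<lambda>_. 1) * E = 1\<^sub>m ?n" using I by (simp add: sp_diag_one)
  interpret group "GL ?n :: 'a mat monoid" by (rule group_GL)
  have "subgroup (sp_torus m E) (GL ?n)"
  proof
    show "sp_torus m E \<subseteq> carrier (GL ?n)" by (rule sub)
    fix s t assume "s \<in> sp_torus m E" "t \<in> sp_torus m E"
    then obtain x y where "\<forall>i<m. x i \<noteq> 0" "s = ?I * sp_diag m x * E" "\<forall>i<m. y i \<noteq> 0" "t = ?I * sp_diag m y * E"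
      unfolding sp_torus_def by blast
    then show "s \<otimes>\<^bsub>GL ?n\<^esub> t \<in> sp_torus m E"
      unfolding sp_torus_def by (auto simp: GL_simps(2) prod intro!: exI[of _ "\<lambda>i. x i * y i"])
  next
    show "\<one>\<^bsub>GL ?n\<^esub> \<in> sp_torus m E" unfolding sp_torus_def GL_simps(3) one[symmetric] by auto
  next
    fix t assume "t \<in> sp_torus m E"
    then obtain x where x: "\<forall>i<m. x i \<noteq> 0" "t = ?I * sp_diag m x * E" unfolding sp_torus_def by blast
    have "sp_diag m (\<lambda>i. x i * inverse (x i)) = sp_diag m (\<lambda>_. 1)"
      unfolding sp_diag_def using x(1) by (intro cong_mat) auto
    then have "t * (?I * sp_diag m (\<lambda>i. inverse (x i)) * E) = 1\<^sub>m ?n"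
      unfolding x(2) prod using one by simp
    then have "inv\<^bsub>GL ?n\<^esub> t = ?I * sp_diag m (\<lambda>i. inverse (x i)) * E"
      using GL_I(2) c x(2) by blast
    then show "inv\<^bsub>GL ?n\<^esub> t \<in> sp_torus m E"
      unfolding sp_torus_def using x(1) by (auto intro!: exI[of _ "\<lambda>i. inverse (x i)"])
  qed
  moreover have "diagonalizable_set ?n (sp_torus m E)"
    unfolding diagonalizable_set_def
  proof (intro bexI[OF _ EG] ballI)
    fix t assume "t \<in> sp_torus m E"
    then show "diagonal_mat (E * t * ?I)"
      unfolding sp_torus_def using sp_torus_conj(1)[OF EG] diagonal_sp_diag by auto
  qed
  ultimately show ?thesis
    unfolding torus_def using sp_torus_closedin[OF E] sp_torus_connected[OF inf E] by blast
qed

text \<open>The rows of \<open>E\<close> are a symplectic basis of common eigenvectors. Paired rows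
  have inverse weights, which forces the shape \<open>sp_diag\<close> on every conjugated element of
  \<open>T\<close>; maximality turns the inclusion into an equality.\<close>

lemma maximal_torus_eq_sp_torus:
  fixes T :: "'a::Fields.field mat set" and e :: "nat \<Rightarrow> 'a Matrix.vec"
  assumes inf: "infinite (UNIV :: 'a set)" and T: "maximal_torus (2 * m) (Sp m UNIV) T"
    and e: "\<And>j. j \<in> J \<Longrightarrow> \<exists>\<chi>. eigenvector (2 * m) T (e j) \<chi>"
    and detect: "\<And>x. x \<in> carrier_vec (2 * m) \<Longrightarrow> x \<noteq> 0\<^sub>v (2 * m) \<Longrightarrow> \<exists>j\<in>J. sform m x (e j) \<noteq> 0"
  shows "\<exists>E\<in>Sp m UNIV. T = sp_torus m E"
proof -
  let ?n = "2 * m"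
  have TS: "T \<subseteq> Sp m UNIV" using T by (simp add: maximal_torus_def)
  obtain a b where ab: "\<And>i. i < m \<Longrightarrow> (\<exists>\<chi>. eigenvector ?n T (a i) \<chi>) \<and> (\<exists>\<chi>. eigenvector ?n T (b i) \<chi>)"
    and rel: "\<And>i j. i < m \<Longrightarrow> j < m \<Longrightarrow> sform m (a i) (b j) = (if i = j then 1 else 0) \<and>
      sform m (a i) (a j) = 0 \<and> sform m (b i) (b j) = 0"
    using symplectic_eigenbasis[OF TS e detect order_refl] by blast
  have "\<forall>i\<in>{..<m}. \<exists>\<chi> \<psi>. eigenvector ?n T (a i) \<chi> \<and> eigenvector ?n T (b i) \<psi>" using ab by blast
  then obtain \<chi> \<psi> where \<chi>: "\<And>i. i < m \<Longrightarrow> eigenvector ?n T (a i) (\<chi> i)" and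
    \<psi>: "\<And>i. i < m \<Longrightarrow> eigenvector ?n T (b i) (\<psi> i)" by (metis lessThan_iff)
  obtain E where E: "E \<in> Sp m UNIV" "\<And>i. i < m \<Longrightarrow> Matrix.row E i = a i" "\<And>i. i < m \<Longrightarrow> Matrix.row E (m + i) = b i"
    using symplectic_rows_Sp[of m a b] \<chi> \<psi> rel unfolding eigenvector_def by blast
  have EG: "E \<in> carrier (GL ?n)" using E Sp_subset_GL by blast
  note I = GL_inv[OF EG] and Ec = GL_carrier_mat[OF EG]
  have "T \<subseteq> sp_torus m E"
  proof
    fix t assume t: "t \<in> T"
    then have tc: "t \<in> carrier_mat ?n ?n" using TS Sp_D(1) by blast
    define x where "x i = \<chi> i t" for i
    have x1: "x i * \<psi> i t = 1" if "i < m" for i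
      unfolding x_def using eigenvector_weights_inverse[OF TS \<chi>[OF that] \<psi>[OF that] _ t] rel[OF that that] by simp
    then have nz: "\<forall>i<m. x i \<noteq> 0" by force
    have \<psi>x: "\<psi> i t = inverse (x i)" if "i < m" for i using x1[OF that] by (simp add: inverse_unique)
    have "E * t = sp_diag m x * E"
    proof (rule eq_matI)
      fix i j assume "i < dim_row (sp_diag m x * E)" "j < dim_col (sp_diag m x * E)"
      then have ij: "i < ?n" "j < ?n" using Ec by (auto simp: sp_diag_def)
      define c where "c = (if i < m then x i else inverse (x (i - m)))"
      have row: "row_act (Matrix.row E i) t = c \<cdot>\<^sub>v Matrix.row E i"
      proof (cases "i < m")
        case True
        then show ?thesis using \<chi>[OF True] E(2)[OF True] t by (simp add: eigenvector_def c_def x_def)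
      next
        case False
        then have i: "i - m < m" using ij by simp
        then show ?thesis using \<psi>[OF i] E(3)[OF i] t False \<psi>x[OF i] by (simp add: eigenvector_def c_def)
      qed
      have "(E * t) $$ (i, j) = row_act (Matrix.row E i) t $ j"
        using ij Ec tc by (simp add: mat_mult_index[OF Ec tc ij] row_act_index[OF tc _ ij(2)])
      also have "\<dots> = c * E $$ (i, j)" unfolding row using ij Ec by simp
      also have "\<dots> = (\<Sum>k<?n. if k = i then c * E $$ (i, j) else 0)" using ij by simp
      also have "\<dots> = (sp_diag m x * E) $$ (i, j)"
        unfolding mat_mult_index[OF sp_diag_carrier Ec ij] using ij
        by (intro sum.cong) (auto simp: sp_diag_def c_def)
      finally show "(E * t) $$ (i, j) = (sp_diag m x * E) $$ (i, j)" .
    qed (use Ec tc in \<open>auto simp: sp_diag_def\<close>)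
    then have "inv\<^bsub>GL ?n\<^esub> E * (E * t) = inv\<^bsub>GL ?n\<^esub> E * sp_diag m x * E"
      using assoc_mult_mat[OF I(2) sp_diag_carrier Ec] by simp
    moreover have "inv\<^bsub>GL ?n\<^esub> E * (E * t) = t"
      using assoc_mult_mat[OF I(2) Ec tc] I(4) tc by simp
    ultimately show "t \<in> sp_torus m E" unfolding sp_torus_def using nz by auto
  qed
  then have "sp_torus m E = T"
    using T torus_sp_torus[OF inf E(1)] sp_torus_subset_Sp[OF E(1)] unfolding maximal_torus_def by blast
  then show ?thesis using E(1) by blast
qed

section \<open>Weights of the diagonal torus\<close>

lemma exists_unit_not_self_inverse:
  assumes "infinite (UNIV :: 'a::Fields.field set)"
  shows "\<exists>g::'a. g \<noteq> 0 \<and> g \<noteq> 1 \<and> inverse g \<noteq> g \<and> inverse g \<noteq> 1"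
proof -
  obtain g :: 'a where g: "g \<noteq> 0" "g \<noteq> 1" "g \<noteq> -1"
    using ex_new_if_finite[OF assms, of "{0, 1, -1}"] by auto
  have "inverse g \<noteq> g"
  proof
    assume "inverse g = g"
    then have "g * g = 1" using right_inverse[OF g(1)] by simp
    then show False using g square_eq_1_iff by blast
  qed
  then show ?thesis using g by (intro exI[of _ g]) simp
qed

definition sp_entry :: "nat \<Rightarrow> (nat \<Rightarrow> 'a::Fields.field) \<Rightarrow> nat \<Rightarrow> 'a" where
  "sp_entry m x j = (if j < m then x j else inverse (x (j - m)))"

lemma sp_entry_separates:
  assumes inf: "infinite (UNIV :: 'a::Fields.field set)" and "p < 2 * m" "q < 2 * m"
    and same: "\<And>x :: nat \<Rightarrow> 'a. (\<forall>i<m. x i \<noteq> 0) \<Longrightarrow> sp_entry m x p = sp_entry m x q"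
  shows "p = q"
proof (rule ccontr)
  assume "p \<noteq> q"
  obtain g :: 'a where g: "g \<noteq> 0" "g \<noteq> 1" "inverse g \<noteq> g" "inverse g \<noteq> 1"
    using exists_unit_not_self_inverse[OF inf] by blast
  \<comment> \<open>A test element whose diagonal entries are \<open>g\<close>, its inverse and
    otherwise 1, three distinct values. The two disjuncts treat \<open>p < m\<close> and
    \<open>p \<ge> m\<close> together, and the value at \<open>p\<close> is taken nowhere
    else.\<close>
  define x where "x i = (if i = p \<or> i + m = p then g else 1)" for i
  have "sp_entry m x p = sp_entry m x q" using g by (intro same) (auto simp: x_def)
  then show False using \<open>p \<noteq> q\<close> assms(2,3) g by (auto simp: sp_entry_def x_def split: if_splits)
qed

text \<open>Moved by the inverse of \<open>E\<close>, a nonzero eigenvector becomes one of the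
  diagonal torus. Distinct coordinates carry distinct characters, so it is supported on one
  coordinate, which its weight determines.\<close>

lemma sp_torus_weight_multiplicity_one:
  fixes E :: "'a::Fields.field mat"
  assumes inf: "infinite (UNIV :: 'a set)" and E: "E \<in> Sp m UNIV"
    and v: "eigenvector (2 * m) (sp_torus m E) v \<chi>" "v \<noteq> 0\<^sub>v (2 * m)"
    and w: "eigenvector (2 * m) (sp_torus m E) w \<psi>" "w \<noteq> 0\<^sub>v (2 * m)"
    and eq: "\<And>t. t \<in> sp_torus m E \<Longrightarrow> \<chi> t = \<psi> t"
  shows "\<exists>c. w = c \<cdot>\<^sub>v v"
proof -
  let ?n = "2 * m" and ?I = "inv\<^bsub>GL (2 * m)\<^esub> E"
  have EG: "E \<in> carrier (GL ?n)" using E Sp_subset_GL by blast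
  note I = GL_inv[OF EG] and Ec = GL_carrier_mat[OF EG]
  have IG: "?I \<in> carrier (GL ?n)" by (rule I)
  define \<Phi> where "\<Phi> x = ?I * sp_diag m x * E" for x
  have restore: "row_act (row_act u ?I) E = u" if "u \<in> carrier_vec ?n" for u
    using row_act_mult[OF I(2) Ec that] I(4) that by simp
  have main: "\<exists>p<?n. row_act u ?I = (row_act u ?I $ p) \<cdot>\<^sub>v unit_vec ?n p \<and> row_act u ?I $ p \<noteq> 0 \<and>
      (\<forall>x. (\<forall>i<m. x i \<noteq> 0) \<longrightarrow> sp_entry m x p = \<mu> (\<Phi> x))"
    if u: "eigenvector ?n (sp_torus m E) u \<mu>" "u \<noteq> 0\<^sub>v ?n" for u \<mu>
  proof -
    have uc: "u \<in> carrier_vec ?n" using u by (simp add: eigenvector_def)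
    define y where "y = row_act u ?I"
    have y: "y \<in> carrier_vec ?n" "y \<noteq> 0\<^sub>v ?n"
      unfolding y_def using row_act_carrier[OF I(2)] row_act_GL_nonzero[OF IG uc u(2)] by auto
    have act: "y $ j * sp_entry m x j = \<mu> (\<Phi> x) * y $ j" if x: "\<forall>i<m. x i \<noteq> 0" and j: "j < ?n" for x j
    proof -
      have ID: "?I * sp_diag m x \<in> carrier_mat ?n ?n" using I(2) by (rule mult_carrier_mat) simp
      have "\<Phi> x \<in> sp_torus m E" unfolding \<Phi>_def sp_torus_def using x by blast
      then have "row_act u (\<Phi> x) = \<mu> (\<Phi> x) \<cdot>\<^sub>v u" using u(1) by (simp add: eigenvector_def)
      moreover have "row_act u (\<Phi> x) = row_act (row_act y (sp_diag m x)) E"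
        unfolding \<Phi>_def y_def row_act_mult[OF ID Ec uc] row_act_mult[OF I(2) sp_diag_carrier uc] ..
      ultimately have "row_act (row_act (row_act y (sp_diag m x)) E) ?I = row_act (\<mu> (\<Phi> x) \<cdot>\<^sub>v u) ?I" by simp
      moreover have "row_act (row_act (row_act y (sp_diag m x)) E) ?I = row_act y (sp_diag m x)"
        using row_act_mult[OF Ec I(2), of "row_act y (sp_diag m x)"] I(3) by simp
      moreover have "row_act (\<mu> (\<Phi> x) \<cdot>\<^sub>v u) ?I = \<mu> (\<Phi> x) \<cdot>\<^sub>v y"
        unfolding y_def by (rule row_act_smult[OF I(2) uc])
      ultimately have "row_act y (sp_diag m x) $ j = (\<mu> (\<Phi> x) \<cdot>\<^sub>v y) $ j" by simp
      then show ?thesis using row_act_sp_diag[OF y(1) j] j y(1) by (simp add: sp_entry_def)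
    qed
    obtain p where p: "p < ?n" "y $ p \<noteq> 0" using y by (metis carrier_vecD eq_vecI index_zero_vec)
    have "sp_entry m x p = \<mu> (\<Phi> x)" if "\<forall>i<m. x i \<noteq> 0" for x using act[OF that p(1)] p(2) by simp
    moreover have "y $ j = 0" if j: "j < ?n" "j \<noteq> p" for j
    proof (rule ccontr)
      assume yj: "y $ j \<noteq> 0"
      have "sp_entry m x j = sp_entry m x p" if "\<forall>i<m. x i \<noteq> 0" for x :: "nat \<Rightarrow> 'a"
        using act[OF that p(1)] act[OF that j(1)] p(2) yj by simp
      then show False using sp_entry_separates[OF inf j(1) p(1)] j(2) by blast
    qed
    then have "y = y $ p \<cdot>\<^sub>v unit_vec ?n p" using p y(1) by (intro eq_vecI) auto
    ultimately show ?thesis using p unfolding y_def by blast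
  qed
  obtain p where p: "p < ?n" "row_act v ?I = (row_act v ?I $ p) \<cdot>\<^sub>v unit_vec ?n p" "row_act v ?I $ p \<noteq> 0"
    "\<And>x. (\<forall>i<m. x i \<noteq> 0) \<Longrightarrow> sp_entry m x p = \<chi> (\<Phi> x)" using main[OF v] by blast
  obtain q where q: "q < ?n" "row_act w ?I = (row_act w ?I $ q) \<cdot>\<^sub>v unit_vec ?n q"
    "\<And>x. (\<forall>i<m. x i \<noteq> 0) \<Longrightarrow> sp_entry m x q = \<psi> (\<Phi> x)" using main[OF w] by blast
  have "p = q"
  proof (rule sp_entry_separates[OF inf p(1) q(1)])
    fix x :: "nat \<Rightarrow> 'a" assume x: "\<forall>i<m. x i \<noteq> 0"
    have "\<Phi> x \<in> sp_torus m E" unfolding \<Phi>_def sp_torus_def using x by blast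
    then show "sp_entry m x p = sp_entry m x q" using p(4)[OF x] q(3)[OF x] eq by simp
  qed
  define c where "c = row_act w ?I $ p / row_act v ?I $ p"
  have vw: "v \<in> carrier_vec ?n" "w \<in> carrier_vec ?n" using v w by (auto simp: eigenvector_def)
  have "row_act w ?I = c \<cdot>\<^sub>v ((row_act v ?I $ p) \<cdot>\<^sub>v unit_vec ?n p)"
    using q(2) p(3) unfolding \<open>p = q\<close>[symmetric] c_def by (simp add: smult_smult_assoc)
  then have "row_act w ?I = c \<cdot>\<^sub>v row_act v ?I" using p(2) by simp
  then have "row_act (row_act w ?I) E = c \<cdot>\<^sub>v row_act (row_act v ?I) E"
    using row_act_smult[OF Ec row_act_carrier[OF I(2)]] by simp
  then show ?thesis using restore vw by auto
qed

section \<open>Highest and lowest weights\<close>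

text \<open>The matrix with rows \<open>e i\<close> and the matrix with columns \<open>f j\<close>
  are inverse to each other on one side by duality, hence on both.\<close>

lemma dual_basis_detects:
  fixes e f :: "nat \<Rightarrow> 'a::Fields.field Matrix.vec"
  assumes e: "\<And>i. i \<in> {1..n} \<Longrightarrow> e i \<in> carrier_vec n" and dual: "dual_basis n e f"
    and z: "z \<in> carrier_vec n" "\<And>i. i \<in> {1..n} \<Longrightarrow> scalar_prod (e i) z = 0"
  shows "z = 0\<^sub>v n"
proof -
  define A where "A = Matrix.mat n n (\<lambda>(i, j). e (Suc i) $ j)"
  define B where "B = Matrix.mat n n (\<lambda>(i, j). f (Suc j) $ i)"
  have c: "A \<in> carrier_mat n n" "B \<in> carrier_mat n n" by (auto simp: A_def B_def)
  have row: "Matrix.row A i = e (Suc i)" if "i < n" for i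
    using that e[of "Suc i"] unfolding A_def by (intro eq_vecI) auto
  have col: "Matrix.col B i = f (Suc i)" if "i < n" for i
  proof -
    have "f (Suc i) \<in> carrier_vec n" using dual that by (simp add: dual_basis_def)
    then show ?thesis using that unfolding B_def by (intro eq_vecI) auto
  qed
  have "A * B = 1\<^sub>m n"
  proof (rule eq_matI)
    fix i j assume "i < dim_row (1\<^sub>m n :: 'a mat)" "j < dim_col (1\<^sub>m n :: 'a mat)"
    then show "(A * B) $$ (i, j) = 1\<^sub>m n $$ (i, j)"
      using c row col dual by (auto simp: dual_basis_def)
  qed (use c in auto)
  then have BA: "B * A = 1\<^sub>m n" using mat_mult_left_right_inverse[OF c] by simp
  have Az: "A *\<^sub>v z = 0\<^sub>v n"
    using c z row by (intro eq_vecI) auto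
  have "z = (B * A) *\<^sub>v z" using BA z by simp
  also have "\<dots> = B *\<^sub>v (A *\<^sub>v z)" using c z by simp
  also have "\<dots> = 0\<^sub>v n" unfolding Az using c by (intro eq_vecI) auto
  finally show ?thesis .
qed

lemma weight_eigenvector: "weight_vector n T \<alpha> v \<Longrightarrow> eigenvector n T v \<alpha>"
  by (simp add: weight_vector_def eigenvector_def)

text \<open>\<open>inv\<close> is a definite description, so uniqueness is verified directly:
  characters are extensional functions, determined by their values on \<open>T\<close>.\<close>

lemma char_group_inv:
  assumes a: "\<alpha> \<in> carrier (char_group n T)" and b: "\<beta> \<in> carrier (char_group n T)"
    and ab: "\<And>t. t \<in> T \<Longrightarrow> \<alpha> t * \<beta> t = 1"
  shows "inv\<^bsub>char_group n T\<^esub> \<alpha> = \<beta>"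
  unfolding m_inv_def
proof (rule the_equality)
  have "\<alpha> \<otimes>\<^bsub>char_group n T\<^esub> \<beta> = \<one>\<^bsub>char_group n T\<^esub>" "\<beta> \<otimes>\<^bsub>char_group n T\<^esub> \<alpha> = \<one>\<^bsub>char_group n T\<^esub>"
    unfolding char_group_def using ab by (auto simp: mult.commute intro!: restrict_ext)
  then show "\<beta> \<in> carrier (char_group n T) \<and> \<alpha> \<otimes>\<^bsub>char_group n T\<^esub> \<beta> = \<one>\<^bsub>char_group n T\<^esub> \<and>
    \<beta> \<otimes>\<^bsub>char_group n T\<^esub> \<alpha> = \<one>\<^bsub>char_group n T\<^esub>" using b by simp
next
  fix y assume y: "y \<in> carrier (char_group n T) \<and> \<alpha> \<otimes>\<^bsub>char_group n T\<^esub> y = \<one>\<^bsub>char_group n T\<^esub> \<and>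
    y \<otimes>\<^bsub>char_group n T\<^esub> \<alpha> = \<one>\<^bsub>char_group n T\<^esub>"
  have ext: "y \<in> T \<rightarrow>\<^sub>E UNIV" "\<beta> \<in> T \<rightarrow>\<^sub>E UNIV" using y b by (auto simp: char_group_def PiE_def)
  show "y = \<beta>"
  proof (rule PiE_ext[OF ext])
    fix t assume t: "t \<in> T"
    have "(\<lambda>t\<in>T. \<alpha> t * y t) t = (\<lambda>t\<in>T. 1) t" using y by (simp add: char_group_def)
    then have "\<alpha> t * y t = \<alpha> t * \<beta> t" using t ab by simp
    moreover have "\<alpha> t \<noteq> 0" using ab[OF t] by auto
    ultimately show "y t = \<beta> t" by simp
  qed
qed

text \<open>Vectors with nonzero pairing have inverse weights, and inversion matches the highest
  weight with the lowest. By multiplicity one, \<open>e n\<close> is then the only basis vector not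
  orthogonal to \<open>e 1\<close>, so pairing with \<open>e 1\<close> is proportional to the
  functional dual to \<open>e n\<close>.\<close>

lemma lowest_weight_dual:
  fixes T :: "'a::Fields.field mat set"
  assumes inf: "infinite (UNIV :: 'a set)" and m: "m \<ge> 1" and n: "n = 2 * m"
    and T: "maximal_torus n (Sp m UNIV) T" and P: "positive_cone (char_group n T) P"
    and e: "weight_basis n T e" and f: "dual_basis n e f"
    and hi: "highest_weight_vector n T P (e 1)" and lo: "lowest_weight_vector n T P (e n)"
  shows "\<exists>c\<noteq>0. \<forall>x\<in>carrier_vec n. c * sform m x (e 1) = scalar_prod x (f n)"
proof -
  let ?X = "char_group n T"
  have TS: "T \<subseteq> Sp m UNIV" using T by (simp add: maximal_torus_def)
  have "\<forall>i\<in>{1..n}. \<exists>\<alpha>. weight_vector n T \<alpha> (e i)" using e by (simp add: weight_basis_def)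
  then obtain wt where wt: "\<And>i. i \<in> {1..n} \<Longrightarrow> weight_vector n T (wt i) (e i)" by metis
  have ev: "eigenvector (2 * m) T (e i) (wt i)" if "i \<in> {1..n}" for i
    using weight_eigenvector[OF wt[OF that]] n by simp
  have ec: "e i \<in> carrier_vec n" "e i \<noteq> 0\<^sub>v n" if "i \<in> {1..n}" for i
    using wt[OF that] by (auto simp: weight_vector_def)
  have detect: "\<exists>j\<in>{1..n}. sform m x (e j) \<noteq> 0" if x: "x \<in> carrier_vec n" "x \<noteq> 0\<^sub>v n" for x
  proof (rule ccontr)
    assume neg: "\<not> ?thesis"
    let ?z = "symplectic_form m *\<^sub>v x"
    have z: "?z \<in> carrier_vec n" using mult_mat_vec_carrier[OF symplectic_form_carrier, of x m] x n by simp
    have "scalar_prod (e i) ?z = 0" if "i \<in> {1..n}" for i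
      using neg that sform_eq_scalar_prod[of "e i" m x] ec[OF that] x(1) n sform_swap[of m "e i" x] by auto
    then have z0: "?z = 0\<^sub>v n" using dual_basis_detects[OF ec(1) f z] by blast
    obtain y where y: "y \<in> carrier_vec n" "sform m x y \<noteq> 0" using sform_nondegenerate[of x m] x n by auto
    have "sform m y x = 0" using sform_eq_scalar_prod[of y m x] x(1) y(1) n z0 by simp
    then show False using y(2) sform_swap[of m x y] by simp
  qed
  obtain E where E: "E \<in> Sp m UNIV" "T = sp_torus m E"
    using maximal_torus_eq_sp_torus[OF inf, of m T "{1..n}" e] T ev detect n by blast
  have one_n: "1 \<in> {1..n}" "n \<in> {1..n}" using m n by auto
  have wt_unique: "\<alpha> t = wt i t" if \<alpha>: "weight_vector n T \<alpha> (e i)" and i: "i \<in> {1..n}" and t: "t \<in> T" for \<alpha> i t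
  proof -
    obtain k where k: "k < n" "e i $ k \<noteq> 0" using ec[OF i] by (metis carrier_vecD eq_vecI index_zero_vec)
    have "\<alpha> t \<cdot>\<^sub>v e i = wt i t \<cdot>\<^sub>v e i" using \<alpha> t wt[OF i] by (simp add: weight_vector_def)
    then have "(\<alpha> t \<cdot>\<^sub>v e i) $ k = (wt i t \<cdot>\<^sub>v e i) $ k" by simp
    then show ?thesis using ec(1)[OF i] k by simp
  qed
  have car: "\<alpha> \<in> carrier ?X" if "weight_vector n T \<alpha> v" for \<alpha> v using that by (simp add: weight_vector_def)
  have chars_eq: "\<alpha> = \<beta>" if "\<alpha> \<in> carrier ?X" "\<beta> \<in> carrier ?X" "\<And>t. t \<in> T \<Longrightarrow> \<alpha> t = \<beta> t" for \<alpha> \<beta>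
  proof (rule PiE_ext[of _ T "\<lambda>_. UNIV"])
    show "\<alpha> \<in> T \<rightarrow>\<^sub>E UNIV" "\<beta> \<in> T \<rightarrow>\<^sub>E UNIV" using that by (auto simp: char_group_def PiE_def)
  qed (rule that(3))
  obtain \<alpha> where \<alpha>: "weight_vector n T \<alpha> (e 1)"
    "\<And>\<beta>. \<beta> \<in> weights n T - {\<alpha>} \<Longrightarrow> \<alpha> \<otimes>\<^bsub>?X\<^esub> inv\<^bsub>?X\<^esub> \<beta> \<in> P"
    using hi unfolding highest_weight_vector_def by blast
  obtain \<omega> where \<omega>: "weight_vector n T \<omega> (e n)"
    "\<And>\<beta>. \<beta> \<in> weights n T - {\<omega>} \<Longrightarrow> \<beta> \<otimes>\<^bsub>?X\<^esub> inv\<^bsub>?X\<^esub> \<omega> \<in> P"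
    using lo unfolding lowest_weight_vector_def by blast
  have \<alpha>1: "\<alpha> = wt 1" using chars_eq car \<alpha>(1) wt[OF one_n(1)] wt_unique[OF \<alpha>(1) one_n(1)] by blast
  have \<omega>n: "\<omega> = wt n" using chars_eq car \<omega>(1) wt[OF one_n(2)] wt_unique[OF \<omega>(1) one_n(2)] by blast
  have pair: "wt i t * wt j t = 1" if "sform m (e i) (e j) \<noteq> 0" "i \<in> {1..n}" "j \<in> {1..n}" "t \<in> T" for i j t
    using eigenvector_weights_inverse[OF TS ev ev] that by blast
  have wX: "wt i \<in> carrier ?X" "wt i \<in> weights n T" if "i \<in> {1..n}" for i
    using wt[OF that] car by (auto simp: weights_def)
  have mult_one: "i = j" if ij: "i \<in> {1..n}" "j \<in> {1..n}" "wt i = wt j" for i j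
  proof (rule ccontr)
    assume "i \<noteq> j"
    obtain c where c: "e j = c \<cdot>\<^sub>v e i"
      using sp_torus_weight_multiplicity_one[OF inf E(1), of "e i" "wt i" "e j" "wt j"]
        ev[OF ij(1)] ev[OF ij(2)] ec[OF ij(1)] ec[OF ij(2)] ij(3) n unfolding E(2) by auto
    have fc: "f i \<in> carrier_vec n" "scalar_prod (e j) (f i) = 0" "scalar_prod (e i) (f i) = 1"
      using f ij \<open>i \<noteq> j\<close> unfolding dual_basis_def by auto
    have "c * scalar_prod (e i) (f i) = 0"
      using fc(1,2) ec(1)[OF ij(1)] unfolding c by simp
    then have "c = 0" using fc(3) by simp
    then show False using c ec[OF ij(1)] ec[OF ij(2)] by auto
  qed
  \<comment> \<open>Let \<open>e k\<close> pair nontrivially with \<open>e n\<close>. The weights of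
    \<open>e j\<close> and \<open>e k\<close> are the inverses of the highest and of the lowest
    weight. If \<open>wt j\<close> were not the lowest weight, the quotients \<open>wt 1\<close> by
    \<open>wt k\<close> and \<open>wt j\<close> by \<open>wt n\<close> would both be positive,
    although their product is trivial.\<close>
  have orth: "j = n" if j: "j \<in> {1..n}" "sform m (e 1) (e j) \<noteq> 0" for j
  proof (rule mult_one[OF j(1) one_n(2)], rule ccontr)
    assume ne: "wt j \<noteq> wt n"
    obtain k where k: "k \<in> {1..n}" "sform m (e n) (e k) \<noteq> 0" using detect ec one_n(2) by blast
    have p1: "wt 1 t * wt j t = 1" and p2: "wt n t * wt k t = 1" if "t \<in> T" for t
      using pair[OF j(2) one_n(1) j(1) that] pair[OF k(2) one_n(2) k(1) that] by auto
    have inv1: "inv\<^bsub>?X\<^esub> (wt k) = wt n"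
      using char_group_inv[OF wX(1)[OF k(1)] wX(1)[OF one_n(2)]] p2 by (simp add: mult.commute)
    have inv2: "inv\<^bsub>?X\<^esub> (wt n) = wt k"
      using char_group_inv[OF wX(1)[OF one_n(2)] wX(1)[OF k(1)]] p2 by simp
    have "wt 1 \<noteq> wt k"
    proof
      assume "wt 1 = wt k"
      then have "inv\<^bsub>?X\<^esub> (wt k) = wt j"
        using char_group_inv[OF wX(1)[OF one_n(1)] wX(1)[OF j(1)]] p1 by simp
      then show False using inv1 ne by simp
    qed
    then have "wt 1 \<otimes>\<^bsub>?X\<^esub> wt n \<in> P" using \<alpha>(2)[of "wt k"] wX(2)[OF k(1)] inv1 by (auto simp: \<alpha>1)
    moreover have "wt j \<otimes>\<^bsub>?X\<^esub> wt k \<in> P" using \<omega>(2)[of "wt j"] wX(2)[OF j(1)] inv2 ne by (auto simp: \<omega>n)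
    ultimately have "(wt 1 \<otimes>\<^bsub>?X\<^esub> wt n) \<otimes>\<^bsub>?X\<^esub> (wt j \<otimes>\<^bsub>?X\<^esub> wt k) \<in> P"
      using P unfolding positive_cone_def by blast
    moreover have "(wt 1 \<otimes>\<^bsub>?X\<^esub> wt n) \<otimes>\<^bsub>?X\<^esub> (wt j \<otimes>\<^bsub>?X\<^esub> wt k) = \<one>\<^bsub>?X\<^esub>"
    proof -
      have "wt 1 t * wt n t * (wt j t * wt k t) = 1" if "t \<in> T" for t
        using p1[OF that] p2[OF that] by (metis mult.assoc mult.commute mult_1)
      then show ?thesis unfolding char_group_def by (auto intro!: restrict_ext)
    qed
    ultimately show False using P unfolding positive_cone_def by simp
  qed
  have e1n: "sform m (e n) (e 1) \<noteq> 0"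
  proof -
    obtain j where "j \<in> {1..n}" "sform m (e 1) (e j) \<noteq> 0" using detect ec one_n(1) by blast
    then show ?thesis using orth sform_swap[of m "e n" "e 1"] by auto
  qed
  \<comment> \<open>Normalises the pairing with \<open>e 1\<close> to take the value 1 at
    \<open>e n\<close>; it vanishes at the other basis vectors, and so agrees with the dual
    functional on a basis.\<close>
  define c where "c = inverse (sform m (e n) (e 1))"
  let ?J1 = "symplectic_form m *\<^sub>v e 1"
  have e1: "e 1 \<in> carrier_vec n" using ec one_n by blast
  have J1: "?J1 \<in> carrier_vec n" using mult_mat_vec_carrier[OF symplectic_form_carrier, of "e 1" m] e1 n by simp
  have fn: "f n \<in> carrier_vec n" using f one_n by (simp add: dual_basis_def)
  have sJ: "scalar_prod x ?J1 = sform m x (e 1)" if "x \<in> carrier_vec n" for x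
    using sform_eq_scalar_prod[of x m "e 1"] that e1 n by simp
  have "f n - c \<cdot>\<^sub>v ?J1 = 0\<^sub>v n"
  proof (rule dual_basis_detects[OF ec(1) f])
    show "f n - c \<cdot>\<^sub>v ?J1 \<in> carrier_vec n" using fn J1 by simp
    fix i assume i: "i \<in> {1..n}"
    have "scalar_prod (e i) (f n - c \<cdot>\<^sub>v ?J1) = scalar_prod (e i) (f n) - c * scalar_prod (e i) ?J1"
      using ec(1)[OF i] fn J1 by (simp add: scalar_prod_minus_distrib del: mult_mat_vec_carrier)
    also have "\<dots> = (if i = n then 1 else 0) - c * sform m (e i) (e 1)"
      using f i one_n(2) sJ[OF ec(1)[OF i]] by (simp add: dual_basis_def)
    also have "\<dots> = 0"
      using orth[OF i] sform_swap[of m "e i" "e 1"] e1n by (cases "i = n") (auto simp: c_def)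
    finally show "scalar_prod (e i) (f n - c \<cdot>\<^sub>v ?J1) = 0" .
  qed
  then have "f n = c \<cdot>\<^sub>v ?J1" using fn J1 by (metis carrier_vecD eq_vecI index_minus_vec(1) index_smult_vec(2) index_zero_vec(1) eq_iff_diff_eq_0)
  then have "c * sform m x (e 1) = scalar_prod x (f n)" if "x \<in> carrier_vec n" for x
    using sJ[OF that] that J1 by simp
  moreover have "c \<noteq> 0" using e1n by (simp add: c_def)
  ultimately show ?thesis by blast
qed

text \<open>For x = v g^{-1}, the functional at v g^{-1} c g is \<kappa> B(x c g, x g), and
  invariance under \<open>g\<close> leaves \<kappa> B(x c, x).\<close>

lemma not_tomanov_small_sform:
  fixes v f :: "'a::Fields.field Matrix.vec"
  assumes v: "v \<in> carrier_vec (2 * m)" and f: "\<And>x. x \<in> carrier_vec (2 * m) \<Longrightarrow> \<kappa> * sform m x v = scalar_prod x f"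
    and c: "c \<in> carrier (GL (2 * m))" "c \<notin> tomanov_small (2 * m) (Sp m UNIV) v f"
  shows "\<exists>x\<in>carrier_vec (2 * m). sform m (row_act x c) x \<noteq> 0"
proof -
  let ?n = "2 * m"
  obtain g where g: "g \<in> Sp m UNIV" "scalar_prod (row_act v (inv\<^bsub>GL ?n\<^esub> g * c * g)) f \<noteq> 0"
    using c unfolding tomanov_small_def by blast
  have G: "g \<in> carrier (GL ?n)" using g(1) Sp_subset_GL by blast
  note I = GL_inv[OF G] and gc = GL_carrier_mat[OF G] and cc = GL_carrier_mat[OF c(1)]
  let ?x = "row_act v (inv\<^bsub>GL ?n\<^esub> g)"
  have x: "?x \<in> carrier_vec ?n" by (rule row_act_carrier[OF I(2)])
  have vx: "row_act ?x g = v" using row_act_mult[OF I(2) gc v] I(4) v by simp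
  have Ic: "inv\<^bsub>GL ?n\<^esub> g * c \<in> carrier_mat ?n ?n" using I(2) cc by (rule mult_carrier_mat)
  have "row_act v (inv\<^bsub>GL ?n\<^esub> g * c * g) = row_act (row_act ?x c) g"
    using row_act_mult[OF Ic gc v] row_act_mult[OF I(2) cc v] by simp
  then have "\<kappa> * sform m (row_act (row_act ?x c) g) (row_act ?x g) \<noteq> 0"
    using g(2) f[OF row_act_carrier[OF gc]] vx by simp
  then have "sform m (row_act ?x c) ?x \<noteq> 0"
    using Sp_D(2)[OF g(1) row_act_carrier[OF cc] x] by auto
  then show ?thesis using x by blast
qed

section \<open>Transfer to the algebraic closure and to the list form of words\<close>

lemma subfield_set_to_ac:
  fixes K :: "'l::Fields.field set"
  assumes "subfield K (ring_of_type_algebra :: 'l ring)"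
  shows "subfield_set (to_ac ` K)"
proof -
  let ?R = "ring_of_type_algebra :: 'l ring"
  have "ring ?R" by (rule ring_from_type_algebra)
  note sub = subringE[OF subfieldE(1)[OF assms]] and inv = ring.subfield_m_inv[OF this assms]
  have neg: "- x \<in> K" if "x \<in> K" for x
  proof -
    interpret ring ?R by (rule ring_from_type_algebra)
    have "\<ominus>\<^bsub>?R\<^esub> x \<oplus>\<^bsub>?R\<^esub> x = \<zero>\<^bsub>?R\<^esub>" using sub(1) that by (intro l_neg) auto
    then have "\<ominus>\<^bsub>?R\<^esub> x = - x" by (simp add: ring_of_type_algebra_def eq_neg_iff_add_eq_0)
    then show ?thesis using sub(5)[OF that] by simp
  qed
  have inverse: "inverse x \<in> K" if "x \<in> K" for x
  proof (cases "x = 0")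
    case True
    then show ?thesis using that by simp
  next
    case False
    then have x: "x \<in> K - {\<zero>\<^bsub>?R\<^esub>}" using that by (simp add: ring_of_type_algebra_def)
    have "x * inv\<^bsub>?R\<^esub> x = 1" using inv(2)[OF x] by (simp add: ring_of_type_algebra_def)
    then have "inverse x = inv\<^bsub>?R\<^esub> x" by (rule inverse_unique)
    then show ?thesis using inv(1)[OF x] by simp
  qed
  have K: "0 \<in> K" "1 \<in> K" "\<And>x y. x \<in> K \<Longrightarrow> y \<in> K \<Longrightarrow> x + y \<in> K \<and> x * y \<in> K"
    using sub(2,3,6,7) by (auto simp: ring_of_type_algebra_def)
  show ?thesis
    unfolding subfield_set_def
  proof (intro conjI ballI)
    show "0 \<in> to_ac ` K" "1 \<in> to_ac ` K" using K(1,2) to_ac_0 to_ac_1 by (metis imageI)+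
    fix x assume "x \<in> to_ac ` K"
    then obtain a where a: "a \<in> K" "x = to_ac a" by blast
    show "- x \<in> to_ac ` K" "inverse x \<in> to_ac ` K"
      using neg[OF a(1)] inverse[OF a(1)] a(2) by (metis imageI to_ac_minus, metis imageI to_ac_inverse)
    fix y assume "y \<in> to_ac ` K"
    then obtain b where b: "b \<in> K" "y = to_ac b" by blast
    show "x + y \<in> to_ac ` K" "x * y \<in> to_ac ` K"
      using K(3)[OF a(1) b(1)] a(2) b(2) by (metis imageI to_ac_add, metis imageI to_ac_mult)
  qed
qed

theorem theorem22:
  fixes m n r :: nat
    and K :: "'l::local_field set"
    and T :: "'l alg_closure mat set"
    and P :: "('l alg_closure mat \<Rightarrow> 'l alg_closure) set"
    and e f :: "nat \<Rightarrow> 'l alg_closure vec"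
    and w :: "'l alg_closure mat cword"
  assumes "m \<ge> 1" and "n = 2 * m" and "r \<ge> 1"
    and "subfield K (ring_of_type_algebra :: 'l ring)" and "infinite K"
    and "maximal_torus n (Sp m UNIV) T"
    and "positive_cone (char_group n T) P"
    and "weight_basis n T e" and "dual_basis n e f"
    and "highest_weight_vector n T P (e 1)" and "lowest_weight_vector n T P (e n)"
    and "reduced_word (GL n) r w" and "word_length w \<ge> 2"
    and "tomanov_small n (Sp m UNIV) (e 1) (f n) \<inter> critical_constants w = {}"
  shows "zariski_dim n (word_image (GL n) w r (Sp m (to_ac ` K))) \<ge> enat n"
proof -
  have infK: "infinite (to_ac ` K)"
    using \<open>infinite K\<close> finite_imageD[of to_ac K] inj_to_ac by (metis inj_on_subset subset_UNIV)
  then have infU: "infinite (UNIV :: 'l alg_closure set)" using finite_subset subset_UNIV by blast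
  obtain c where c: "c \<noteq> 0" "\<And>x. x \<in> carrier_vec n \<Longrightarrow> c * sform m x (e 1) = scalar_prod x (f n)"
    using lowest_weight_dual[OF infU assms(1,2,6-11)] by blast
  have "1 \<in> {1..n}" using assms(1,2) by simp
  then have e1: "e 1 \<in> carrier_vec n"
    using \<open>weight_basis n T e\<close> unfolding weight_basis_def weight_vector_def by blast
  obtain c0 xs where w: "w = (c0, xs)" by (cases w)
  have isw: "is_word (GL n) r w" using \<open>reduced_word (GL n) r w\<close> by (simp add: reduced_word_def)
  then have c0: "c0 \<in> carrier (GL n)" by (simp add: is_word_def w)
  have letters: "fst (xs ! j) \<in> {1..r} \<and> fst (snd (xs ! j)) \<in> {1, -1} \<and> snd (snd (xs ! j)) \<in> carrier (GL n)"
    if "j < length xs" for j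
  proof -
    have "Suc j \<in> {1..word_length w}" using that by (simp add: word_length_def w)
    from isw[unfolded is_word_def, THEN conjunct2, rule_format, OF this]
    show ?thesis by (simp add: word_var_def word_sign_def word_const_def w)
  qed
  show ?thesis
    unfolding w
  proof (rule zariski_dim_word_image[OF infK subfield_set_to_ac[OF assms(4)] assms(1,2) c0])
    show "xs \<noteq> []" using \<open>word_length w \<ge> 2\<close> by (auto simp: word_length_def w)
    show "i \<in> {1..r} \<and> \<epsilon> \<in> {1, -1} \<and> c \<in> carrier (GL n)" if "(i, \<epsilon>, c) \<in> set xs" for i \<epsilon> c
      using letters that by (metis fst_conv in_set_conv_nth snd_conv)
    fix j assume j: "Suc j < length xs" "fst (xs ! j) = fst (xs ! Suc j)"
      "fst (snd (xs ! j)) = - fst (snd (xs ! Suc j))"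
    let ?c = "snd (snd (xs ! j))"
    \<comment> \<open>Critical indices count letters from 1 and list positions from 0, so the
      constant at position \<open>j\<close> has index \<open>Suc j\<close>.\<close>
    have "Suc j \<in> critical_indices w"
      using j by (simp add: critical_indices_def word_length_def word_var_def word_sign_def w)
    then have "?c \<in> critical_constants w"
      unfolding critical_constants_def by (intro image_eqI) (simp_all add: word_const_def w)
    then have "?c \<notin> tomanov_small n (Sp m UNIV) (e 1) (f n)" using assms(14) by blast
    then show "\<exists>v\<in>carrier_vec n. sform m (row_act v ?c) v \<noteq> 0"
      using not_tomanov_small_sform[of "e 1" m c "f n" ?c] e1 c(2) letters[of j] j(1) assms(2) by auto
  qed
qed

end
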